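(* Let $n\in\mathbb N$, $n\ge 1$, and let $r,s\in(0,\infty)\setminus\mathbb N$ with $0<s-r<n$. Assume that the Young function $A$ satisfies $$\int_0\Big(\frac{t}{A(t)}\Big)^{\frac{s-r}{n-s+r}}\,dt<\infty$$ (convergence of the integral near $0$), and let $A_{\frac n{s-r}}$ be the Young function defined by $A_{\frac n{s-r}}(t)=A(H^{-1}(t))$ for $t\ge0$, where $$H(t)=\bigg(\int_0^t\Big(\frac{\tau}{A(\tau)}\Big)^{\frac{s-r}{n-s+r}}\,d\tau\bigg)^{\frac{n-s+r}{n}}\quad\text{for } t\ge0 .$$ Then $$W^{s,A}(\mathbb R^n)\to W^{r,A_{\frac n{s-r}}}(\mathbb R^n)$$ (continuous embedding). Moreover, there exists a constant $c=c(n,s,r)$, depending only on $n,s,r$ (in particular not on $A$), such that $$\|u\|_{W^{r,A_{\frac n{s-r}}}(\mathbb R^n)}\le c\,\|u\|_{W^{s,A}(\mathbb R^n)}$$ for every $u\in W^{s,A}(\mathbb R^n)$.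
   Context: A Young function is a function $A:[0,\infty)\to[0,\infty]$ that is convex, left-continuous, vanishes at $0$, and is neither identically $0$ nor identically $\infty$ (on $(0,\infty)$). One sets $A(\infty)=\infty$, and $t/A(t)=0$ where $A(t)=\infty$. $H^{-1}$ is the generalized left-continuous inverse of $H$; if $\lim_{t\to\infty}H(t)<\infty$, then $H^{-1}(t)=\infty$, and hence $A_{\frac n{s-r}}(t)=\infty$, for $t>\lim_{\tau\to\infty}H(\tau)$. $\mathcal M(\mathbb R^n)$ is the space of real-valued measurable functions on $\mathbb R^n$. The Luxemburg norm is $\|u\|_{L^A(\mathbb R^n)}=\inf\{\lambda>0:\int_{\mathbb R^n}A(|u(x)|/\lambda)\,dx\le1\}$, and $L^A(\mathbb R^n)$ is the set of $u\in\mathcal M(\mathbb R^n)$ with finite norm. For $s\in(0,1)$, the seminorm is $$|u|_{s,A,\mathbb R^n}=\inf\Big\{\lambda>0:\int_{\mathbb R^n}\int_{\mathbb R^n}A\Big(\frac{|u(x)-u(y)|}{\lambda|x-y|^s}\Big)\frac{dx\,dy}{|x-y|^n}\le1\Big\}$$ (also used for vector-valued $u$), $W^{s,A}(\mathbb R^n)=\{u\in L^A(\mathbb R^n):|u|_{s,A,\mathbb R^n}<\infty\}$, and $\|u\|_{W^{s,A}(\mathbb R^n)}=\|u\|_{L^A(\mathbb R^n)}+|u|_{s,A,\mathbb R^n}$. For $m\in\mathbb N$, $W^{m,A}(\mathbb R^n)=\{u\in L^A(\mathbb R^n):|\nabla^ku|\in L^A(\mathbb R^n),\ k=1,\dots,m\}$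 with norm $\sum_{k=0}^m\|\nabla^ku\|_{L^A(\mathbb R^n)}$, where $\nabla^ku$ is the vector of all weak derivatives of $u$ of order $k$ and $\nabla^0u=u$. For $s\in(1,\infty)\setminus\mathbb N$, with $[s]$ the integer part and $\{s\}=s-[s]$ the fractional part, $W^{s,A}(\mathbb R^n)=\{u\in W^{[s],A}(\mathbb R^n):|\nabla^{[s]}u|_{\{s\},A,\mathbb R^n}<\infty\}$ with norm $\|u\|_{W^{s,A}(\mathbb R^n)}=\|u\|_{W^{[s],A}(\mathbb R^n)}+|\nabla^{[s]}u|_{\{s\},A,\mathbb R^n}$. *)

theory Defs
  imports "HOL-Analysis.Analysis"
begin

section \<open>Young functions\<close>

text \<open>
  A function \<open>[0,\<infinity>) \<rightarrow> [0,\<infinity>]\<close> is represented by a term of type \<^typ>\<open>real \<Rightarrow> ennreal\<close>; its values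
  at negative arguments are irrelevant. In \<^typ>\<open>ennreal\<close> we have \<open>0 * \<infinity> = 0\<close>, so the convexity
  inequality is harmless at \<open>l = 0\<close> and \<open>l = 1\<close>.
\<close>

definition young_function :: "(real \<Rightarrow> ennreal) \<Rightarrow> bool" where
  "young_function A \<longleftrightarrow>
     (\<forall>x\<ge>0. \<forall>y\<ge>0. \<forall>l\<in>{0..1}.
        A (l * x + (1 - l) * y) \<le> ennreal l * A x + ennreal (1 - l) * A y) \<and>
     (\<forall>t>0. continuous (at_left t) A) \<and>
     A 0 = 0 \<and>
     (\<exists>t>0. A t \<noteq> 0) \<and>
     (\<exists>t>0. A t \<noteq> \<infinity>)"

text \<open>Evaluation at a possibly infinite argument, with the convention \<open>A(\<infinity>) = \<infinity>\<close>.\<close>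

definition young_extend :: "(real \<Rightarrow> ennreal) \<Rightarrow> ennreal \<Rightarrow> ennreal" where
  "young_extend A t = (if t = \<infinity> then \<infinity> else A (enn2real t))"

text \<open>Only used for exponents \<open>a > 0\<close>, so that \<open>\<infinity>\<close> to the power \<open>a\<close> is \<open>\<infinity>\<close>.\<close>

definition ennreal_powr :: "ennreal \<Rightarrow> real \<Rightarrow> ennreal" where
  "ennreal_powr x a = (if x = \<infinity> then \<infinity> else ennreal (enn2real x powr a))"

text \<open>
  The function \<open>(t / A(t))\<close> to the power \<open>\<sigma>/(n-\<sigma>)\<close>, where \<open>\<sigma> = s - r\<close>. Division in \<^typ>\<open>ennreal\<close> gives
  \<open>t / \<infinity> = 0\<close>, and \<open>t / 0 = \<infinity>\<close> for \<open>t > 0\<close>.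
\<close>

definition conj_integrand :: "nat \<Rightarrow> real \<Rightarrow> (real \<Rightarrow> ennreal) \<Rightarrow> real \<Rightarrow> ennreal" where
  "conj_integrand n \<sigma> A t = ennreal_powr (ennreal t / A t) (\<sigma> / (real n - \<sigma>))"

definition converges_near_zero :: "nat \<Rightarrow> real \<Rightarrow> (real \<Rightarrow> ennreal) \<Rightarrow> bool" where
  "converges_near_zero n \<sigma> A \<longleftrightarrow>
     (\<exists>\<delta>>0. (\<integral>\<^sup>+t\<in>{0..\<delta>}. conj_integrand n \<sigma> A t \<partial>lborel) < \<infinity>)"

definition conj_H :: "nat \<Rightarrow> real \<Rightarrow> (real \<Rightarrow> ennreal) \<Rightarrow> real \<Rightarrow> ennreal" where
  "conj_H n \<sigma> A t =
     ennreal_powr (\<integral>\<^sup>+\<tau>\<in>{0..t}. conj_integrand n \<sigma> A \<tau> \<partial>lborel) ((real n - \<sigma>) / real n)"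

text \<open>
  Generalized left-continuous inverse of a nondecreasing function. The infimum of the empty set is
  \<open>\<infinity>\<close>, so the value is \<open>\<infinity>\<close> for every \<open>t\<close> above the supremum of \<open>F\<close>.
\<close>

definition left_inverse :: "(real \<Rightarrow> ennreal) \<Rightarrow> real \<Rightarrow> ennreal" where
  "left_inverse F t = (INF \<tau>\<in>{\<tau>. 0 \<le> \<tau> \<and> ennreal t \<le> F \<tau>}. ennreal \<tau>)"

text \<open>The function \<open>A\<^bsub>n/\<sigma>\<^esub> = A \<circ> H\<^sup>-\<^sup>1\<close>.\<close>

definition sobolev_conj :: "nat \<Rightarrow> real \<Rightarrow> (real \<Rightarrow> ennreal) \<Rightarrow> real \<Rightarrow> ennreal" where
  "sobolev_conj n \<sigma> A t = young_extend A (left_inverse (conj_H n \<sigma> A) t)"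

section \<open>Orlicz spaces\<close>

text \<open>
  Norms and seminorms take values in \<^typ>\<open>ennreal\<close>, being \<open>\<infinity>\<close> when the set of
  admissible numbers is empty. Functions are not identified when they agree almost everywhere.
  Measurability is Lebesgue measurability.
\<close>

definition luxemburg_norm :: "(real \<Rightarrow> ennreal) \<Rightarrow> (real^'n \<Rightarrow> real) \<Rightarrow> ennreal" where
  "luxemburg_norm A u =
     (INF lam\<in>{lam. 0 < lam \<and> (\<integral>\<^sup>+x. A (\<bar>u x\<bar> / lam) \<partial>lebesgue) \<le> 1}. ennreal lam)"

definition orlicz_space :: "(real \<Rightarrow> ennreal) \<Rightarrow> (real^'n \<Rightarrow> real) set" where
  "orlicz_space A = {u \<in> borel_measurable lebesgue. luxemburg_norm A u < \<infinity>}"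

text \<open>
  Seminorm of a vector-valued function, given by the family \<open>U\<close> of its components with index set \<open>I\<close>;
  \<^const>\<open>L2_set\<close> is the Euclidean length. On the diagonal \<open>x = y\<close>, a null set, the integrand is
  \<open>A(0)/0 = 0\<close>.
\<close>

definition frac_seminorm ::
  "real \<Rightarrow> (real \<Rightarrow> ennreal) \<Rightarrow> 'i set \<Rightarrow> ('i \<Rightarrow> real^'n \<Rightarrow> real) \<Rightarrow> ennreal" where
  "frac_seminorm \<theta> A I U =
     (INF lam\<in>{lam. 0 < lam \<and>
        (\<integral>\<^sup>+y. (\<integral>\<^sup>+x. A (L2_set (\<lambda>i. U i x - U i y) I / (lam * norm (x - y) powr \<theta>))
                   / ennreal (norm (x - y) ^ CARD('n)) \<partial>lebesgue) \<partial>lebesgue) \<le> 1}. ennreal lam)"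

section \<open>Weak derivatives\<close>

definition partial :: "'n::finite \<Rightarrow> (real^'n \<Rightarrow> real) \<Rightarrow> real^'n \<Rightarrow> real" where
  "partial i f x = frechet_derivative f (at x) (axis i 1)"

text \<open>\<open>partials [i\<^sub>1, \<dots>, i\<^sub>k]\<close> is the iterated partial derivative in the directions \<open>i\<^sub>1, \<dots>, i\<^sub>k\<close>.\<close>

definition partials :: "'n::finite list \<Rightarrow> (real^'n \<Rightarrow> real) \<Rightarrow> real^'n \<Rightarrow> real" where
  "partials w f = foldr partial w f"

text \<open>
  The functions of class \<open>C\<^sup>\<infinity>\<close> with compact support: if every iterated partial derivative exists and
  is (Frechet) differentiable, then each of them is in particular continuous.
\<close>

definition test_function :: "(real^'n::finite \<Rightarrow> real) \<Rightarrow> bool" where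
  "test_function \<phi> \<longleftrightarrow>
     (\<forall>w. partials w \<phi> differentiable_on UNIV) \<and> compact (closure {x. \<phi> x \<noteq> 0})"

definition locally_integrable :: "(real^'n \<Rightarrow> real) \<Rightarrow> bool" where
  "locally_integrable u \<longleftrightarrow> (\<forall>K. compact K \<longrightarrow> set_integrable lebesgue K u)"

definition is_weak_deriv ::
  "'n::finite list \<Rightarrow> (real^'n \<Rightarrow> real) \<Rightarrow> (real^'n \<Rightarrow> real) \<Rightarrow> bool" where
  "is_weak_deriv w u v \<longleftrightarrow>
     locally_integrable u \<and> locally_integrable v \<and>
     (\<forall>\<phi>. test_function \<phi> \<longrightarrow>
        (LINT x|lebesgue. u x * partials w \<phi> x) =
        (- 1) ^ length w * (LINT x|lebesgue. v x * \<phi> x))"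

text \<open>
  A representative of the weak derivative, which is unique up to null sets; no norm or seminorm
  above depends on the choice. The derivative of order \<open>0\<close> is the function itself.
\<close>

definition weak_deriv :: "'n::finite list \<Rightarrow> (real^'n \<Rightarrow> real) \<Rightarrow> real^'n \<Rightarrow> real" where
  "weak_deriv w u = (if w = [] then u else (SOME v. is_weak_deriv w u v))"

text \<open>
  The components of \<open>\<nabla>\<^sup>k u\<close> are indexed by the words of length \<open>k\<close> over the coordinate directions, so
  that \<open>\<nabla>\<^sup>0 u\<close> has the single component \<open>u\<close>, and \<open>\<nabla>\<^sup>2 u\<close> is the full Hessian matrix.
\<close>

definition words :: "nat \<Rightarrow> 'n::finite list set" where
  "words k = {w. length w = k}"

definition grad_length :: "nat \<Rightarrow> (real^'n::finite \<Rightarrow> real) \<Rightarrow> real^'n \<Rightarrow> real" where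
  "grad_length k u x = L2_set (\<lambda>w. weak_deriv w u x) (words k)"

section \<open>Orlicz-Sobolev spaces\<close>

definition sobolev_space :: "nat \<Rightarrow> (real \<Rightarrow> ennreal) \<Rightarrow> (real^'n::finite \<Rightarrow> real) set" where
  "sobolev_space m A =
     {u \<in> orlicz_space A. \<forall>k\<in>{1..m}.
        (\<forall>w\<in>words k. \<exists>v. is_weak_deriv w u v) \<and> grad_length k u \<in> orlicz_space A}"

definition sobolev_norm :: "nat \<Rightarrow> (real \<Rightarrow> ennreal) \<Rightarrow> (real^'n::finite \<Rightarrow> real) \<Rightarrow> ennreal" where
  "sobolev_norm m A u = (\<Sum>k=0..m. luxemburg_norm A (grad_length k u))"

text \<open>
  Fractional spaces, for \<open>s > 0\<close> not an integer. For \<open>s < 1\<close> the integer part is \<open>0\<close>, and these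
  are the space of all \<open>u\<close> in the Orlicz space with finite seminorm of order \<open>s\<close>, and the sum of the
  Luxemburg norm and that seminorm (lemmas \<open>frac_sobolev_lt_1\<close> below).
\<close>

definition grad_seminorm :: "real \<Rightarrow> (real \<Rightarrow> ennreal) \<Rightarrow> (real^'n::finite \<Rightarrow> real) \<Rightarrow> ennreal" where
  "grad_seminorm s A u =
     frac_seminorm (frac s) A (words (nat \<lfloor>s\<rfloor>)) (\<lambda>w. weak_deriv w u)"

definition frac_sobolev_space :: "real \<Rightarrow> (real \<Rightarrow> ennreal) \<Rightarrow> (real^'n::finite \<Rightarrow> real) set" where
  "frac_sobolev_space s A = {u \<in> sobolev_space (nat \<lfloor>s\<rfloor>) A. grad_seminorm s A u < \<infinity>}"

definition frac_sobolev_norm ::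
  "real \<Rightarrow> (real \<Rightarrow> ennreal) \<Rightarrow> (real^'n::finite \<Rightarrow> real) \<Rightarrow> ennreal" where
  "frac_sobolev_norm s A u = sobolev_norm (nat \<lfloor>s\<rfloor>) A u + grad_seminorm s A u"

definition continuously_embedded ::
  "'a set \<Rightarrow> ('a \<Rightarrow> ennreal) \<Rightarrow> 'a set \<Rightarrow> ('a \<Rightarrow> ennreal) \<Rightarrow> bool" where
  "continuously_embedded X NX Y NY \<longleftrightarrow>
     X \<subseteq> Y \<and> (\<exists>C>0. \<forall>u\<in>X. NY u \<le> ennreal C * NX u)"

section \<open>The case \<open>0 < s < 1\<close>\<close>

lemma luxemburg_norm_abs: "luxemburg_norm A (\<lambda>x. \<bar>u x\<bar>) = luxemburg_norm A u"
  by (simp add: luxemburg_norm_def)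

lemma words_0: "words 0 = {[]}"
  by (auto simp: words_def)

lemma frac_sobolev_lt_1:
  fixes u :: "real^'n::finite \<Rightarrow> real"
  assumes "0 < s" "s < 1"
  shows "grad_seminorm s A u =
      (INF lam\<in>{lam. 0 < lam \<and>
        (\<integral>\<^sup>+y. (\<integral>\<^sup>+x. A (\<bar>u x - u y\<bar> / (lam * norm (x - y) powr s))
                   / ennreal (norm (x - y) ^ CARD('n)) \<partial>lebesgue) \<partial>lebesgue) \<le> 1}. ennreal lam)"
    and "frac_sobolev_space s A = {u :: real^'n \<Rightarrow> real. u \<in> orlicz_space A \<and> grad_seminorm s A u < \<infinity>}"
    and "frac_sobolev_norm s A u = luxemburg_norm A u + grad_seminorm s A u"
proof -
  have fl: "\<lfloor>s\<rfloor> = 0" and fr: "frac s = s"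
    using assms by (auto simp: frac_eq floor_eq_iff)
  have grad0: "grad_length 0 u = (\<lambda>x. \<bar>u x\<bar>)"
    by (simp add: fun_eq_iff grad_length_def words_0 weak_deriv_def)
  show "grad_seminorm s A u =
      (INF lam\<in>{lam. 0 < lam \<and>
        (\<integral>\<^sup>+y. (\<integral>\<^sup>+x. A (\<bar>u x - u y\<bar> / (lam * norm (x - y) powr s))
                   / ennreal (norm (x - y) ^ CARD('n)) \<partial>lebesgue) \<partial>lebesgue) \<le> 1}. ennreal lam)"
    by (simp add: grad_seminorm_def frac_seminorm_def fl fr words_0 weak_deriv_def)
  show "frac_sobolev_space s A = {u :: real^'n \<Rightarrow> real. u \<in> orlicz_space A \<and> grad_seminorm s A u < \<infinity>}"
    by (simp add: frac_sobolev_space_def sobolev_space_def fl)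
  show "frac_sobolev_norm s A u = luxemburg_norm A u + grad_seminorm s A u"
    by (simp add: frac_sobolev_norm_def sobolev_norm_def fl grad0 luxemburg_norm_abs)
qed

end

theory Submission
  imports Defs
begin

text \<open>
  Write \<open>\<sigma> = s - r\<close>, and let \<open>B\<close> be the Sobolev conjugate of \<open>A\<close>. Since \<open>t / A(t)\<close> is nonincreasing,
  \<open>H(t) \<ge> t A(t)\<^sup>-\<^sup>\<sigma>\<^sup>/\<^sup>n\<close>, and therefore \<open>B(2\<^sup>-\<^sup>j\<^sup>\<sigma> t) \<le> A(t)\<close> whenever \<open>A(t) \<le> 2\<^sup>j\<^sup>n\<close>. Decompose a derivative of \<open>u\<close>
  of order \<open>k < r\<close> into Littlewood-Paley pieces at the scales \<open>2\<^sup>-\<^sup>j\<close>, \<open>j \<ge> 0\<close>. Up to constants, the piece at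
  scale \<open>2\<^sup>-\<^sup>j\<close> is \<open>2\<^sup>-\<^sup>j\<^sup>(\<^sup>s\<^sup>-\<^sup>k\<^sup>)\<close> times a mean oscillation \<open>f\<^sub>j\<close> of the top order derivatives over a ball of radius comparable to
  \<open>2\<^sup>-\<^sup>j\<close>. By Jensen's inequality, a unit bound on the norm of \<open>u\<close> in the domain space gives both
  \<open>A(f\<^sub>j) \<le> 2\<^sup>j\<^sup>n\<close> pointwise and a bound on the sum over \<open>j\<close> of the integrals of \<open>A(f\<^sub>j)\<close>. Hence
  \<open>B(2\<^sup>-\<^sup>j\<^sup>\<sigma> f\<^sub>j) \<le> A(f\<^sub>j)\<close> scale by scale, and the scales are summed with geometric weights, which are available
  because \<open>r\<close> is positive and not an integer.
\<close>

section \<open>Young functions and their Sobolev conjugates\<close>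

text \<open>\<open>A\<close> may vanish near 0, jump to \<infinity> or grow without any doubling
  condition, so smooth functions need not be dense and constants cannot be moved out of
  \<open>A\<close>. Hence the decomposition is a pointwise statement valid almost everywhere, not a
  density argument, and constants are absorbed into the argument through
  \<open>P (c * t) \<le> c * P t\<close> for \<open>c \<le> 1\<close>. The pieces are differences of
  consecutive mollifications of a derivative of order \<open>k\<close>. The mollifier is built so
  that the difference of two consecutive kernels is a sum over coordinates of pure derivatives of
  order N + 1, where N = m - k and m is the integer part of s. N of them are integrated by parts and
  produce top order derivatives; the last one leaves a kernel of mean zero, which turns sizes into
  oscillations. For the norms the scales are summed with the leftover decay r - k > 0. For the
  seminorm an increment over distance h carries the weight min(1, T) T^-\<rho> with T = 2^j h and
  \<rho> the fractional part of r; it decays in both directions because 0 < \<rho> < 1. Constants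
  are always fixed before \<open>A\<close> and \<open>u\<close>, which makes the final one depend on
  n, s, r only.\<close>

definition star_function :: "(ennreal \<Rightarrow> ennreal) \<Rightarrow> bool" where
  "star_function P \<longleftrightarrow> mono P \<and> P 0 = 0 \<and> (\<exists>b. b < \<infinity> \<and> P b \<noteq> 0) \<and>
     (\<forall>c t. c \<le> 1 \<longrightarrow> P (c * t) \<le> c * P t)"

text \<open>Superlevel sets of a monotone map are upward closed, and in the complete linear order of
  \<open>ennreal\<close> such a set is the half-line above its infimum, with or without the
  endpoint. The empty set is included, its infimum being \<infinity>.\<close>

lemma borel_measurable_mono_ennreal:
  fixes P :: "ennreal \<Rightarrow> ennreal"
  assumes "mono P"
  shows "P \<in> borel_measurable borel"
proof (rule borel_measurableI_greater)
  fix y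
  let ?S = "{x. y < P x}"
  have up: "y < P z" if "y < P x" "x \<le> z" for x z
    using that(1) monoD[OF assms that(2)] by (rule order.strict_trans2)
  have "?S = {Inf ?S..} \<or> ?S = {Inf ?S<..}"
  proof (cases "Inf ?S \<in> ?S")
    case True
    then have "y < P (Inf ?S)" by simp
    then have "?S = {Inf ?S..}"
      by (intro equalityI subsetI) (auto intro: Inf_lower up)
    then show ?thesis by blast
  next
    case False
    have "?S = {Inf ?S<..}"
    proof (intro equalityI subsetI)
      fix x assume "x \<in> ?S"
      then show "x \<in> {Inf ?S<..}" using False Inf_lower[of x ?S] by (cases "x = Inf ?S") auto
    next
      fix x assume "x \<in> {Inf ?S<..}"
      then obtain z where "z \<in> ?S" "z < x" by (auto simp: Inf_less_iff)
      then show "x \<in> ?S" using up[of z x] by simp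
    qed
    then show ?thesis by blast
  qed
  then have "?S \<in> sets borel"
  proof
    assume *: "?S = {Inf ?S..}" show ?thesis by (subst *) simp
  next
    assume *: "?S = {Inf ?S<..}" show ?thesis by (subst *) simp
  qed
  then show "{x \<in> space borel. y < P x} \<in> sets borel" by simp
qed

lemma star_functionD:
  assumes "star_function P"
  shows "mono P" "P 0 = 0" "c \<le> 1 \<Longrightarrow> P (c * t) \<le> c * P t"
    and star_function_measurable: "P \<in> borel_measurable borel"
  using assms by (auto simp: star_function_def intro: borel_measurable_mono_ennreal)

section \<open>Young functions as star-shaped functions of an extended argument\<close>

lemma young_function_scale:
  assumes "young_function A" "0 \<le> c" "c \<le> 1" "0 \<le> t"
  shows "A (c * t) \<le> ennreal c * A t"
proof -
  have "\<forall>x\<ge>0. \<forall>y\<ge>0. \<forall>l\<in>{0..1}. A (l * x + (1 - l) * y) \<le> ennreal l * A x + ennreal (1 - l) * A y"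
    using assms(1) unfolding young_function_def by (rule conjunct1)
  then have "A (c * t + (1 - c) * 0) \<le> ennreal c * A t + ennreal (1 - c) * A 0"
    using assms(2-) by (metis atLeastAtMost_iff order_refl)
  moreover have "A 0 = 0"
    using assms(1) unfolding young_function_def by auto
  ultimately show ?thesis by simp
qed

lemma young_function_mono:
  assumes "young_function A" "0 \<le> x" "x \<le> y"
  shows "A x \<le> A y"
proof (cases "y = 0")
  case False
  then have y: "y > 0" using assms by auto
  have "A x = A ((x / y) * y)" using y by simp
  also have "\<dots> \<le> ennreal (x / y) * A y"
    using assms y by (intro young_function_scale) auto
  also have "\<dots> \<le> 1 * A y"
    using assms y by (intro mult_right_mono) (auto simp: ennreal_le_1)
  finally show ?thesis by simp
qed (use assms in auto)

lemma young_extend_ennreal [simp]: "0 \<le> t \<Longrightarrow> young_extend A (ennreal t) = A t"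
  by (simp add: young_extend_def)

text \<open>Jensen's inequality and the estimates over scales are stated for functions of this kind.
  The extended argument lets averages and oscillations, which are \<open>ennreal\<close> integrals,
  be inserted before their finiteness is known.\<close>

lemma young_extend_star:
  assumes A: "young_function A"
  shows "star_function (young_extend A)"
  unfolding star_function_def
proof (intro conjI allI impI)
  have A0: "A 0 = 0" using A by (simp add: young_function_def)
  show "mono (young_extend A)"
  proof (rule monoI)
    fix x y :: ennreal assume "x \<le> y"
    then show "young_extend A x \<le> young_extend A y"
      by (cases x; cases y)
         (auto simp: young_extend_def top_unique intro!: young_function_mono[OF A])
  qed
  show "young_extend A 0 = 0" using A0 by (simp add: young_extend_def)
  obtain t where "t > 0" "A t \<noteq> 0" using A by (auto simp: young_function_def)
  then show "\<exists>b<\<infinity>. young_extend A b \<noteq> 0"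
    by (intro exI[of _ "ennreal t"]) auto
  fix c t :: ennreal assume c: "c \<le> 1"
  show "young_extend A (c * t) \<le> c * young_extend A t"
  \<comment> \<open>For \<open>c > 0\<close> an infinite \<open>t\<close> stays infinite;
    \<open>c = 0\<close> is separate because \<open>0 * \<infinity> = 0\<close>.\<close>
  proof (cases "c = 0")
    case False
    then obtain c' where c': "c = ennreal c'" "0 < c'" "c' \<le> 1"
      using c by (cases c) (auto simp: top_unique ennreal_le_1)
    show ?thesis
    proof (cases t)
      case (real t')
      then show ?thesis using c' young_function_scale[OF A, of c' t']
        by (simp flip: ennreal_mult)
    next
      case top
      then show ?thesis using c' by (simp add: young_extend_def ennreal_mult_top)
    qed
  qed (simp add: A0 young_extend_def)
qed

text \<open>Star-shapedness gives \<open>P f \<ge> (f / b) * P b\<close> as soon as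
  \<open>f \<ge> b\<close>. Weakening \<open>f / b\<close> to \<open>(f - b) / b\<close> with
  truncated subtraction makes the bound valid for every \<open>f\<close>, and it is then a constant
  multiple of \<open>f - b\<close>, which can be integrated.\<close>

lemma star_function_lower:
  assumes P: "star_function P" and b: "b \<noteq> 0" "b < \<infinity>"
  shows "(f - b) / b * P b \<le> P f"
proof (cases "b \<le> f")
  case True
  show ?thesis
  proof (cases f)
    case (real r)
    obtain b' where b': "b = ennreal b'" "b' > 0" using b by (cases b) auto
    have r: "r \<ge> b'" using True b' real by simp
    have "P b = P (ennreal (b' / r) * f)"
      using b' r real by (simp flip: ennreal_mult)
    also have "\<dots> \<le> ennreal (b' / r) * P f"
      using b' r by (intro star_functionD[OF P]) auto
    finally have *: "P b \<le> ennreal (b' / r) * P f" .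
    have "(f - b) / b = ennreal ((r - b') / b')"
      using b' r real by (simp add: divide_ennreal ennreal_minus)
    also have "\<dots> \<le> ennreal (r / b')"
      using b' r by (intro ennreal_leI divide_right_mono) auto
    finally have "(f - b) / b * P b \<le> ennreal (r / b') * (ennreal (b' / r) * P f)"
      using * by (intro mult_mono) auto
    also have "\<dots> = P f"
      using b' r by (simp flip: ennreal_mult mult.assoc)
    finally show ?thesis .
  next
    case top
    show ?thesis
    proof (cases "P f = 0")
      case True
      have "P b \<le> P f" using top by (intro monoD[OF star_functionD(1)[OF P]]) auto
      then show ?thesis using True by auto
    next
      case False
      \<comment> \<open>Halving fixes \<infinity>, so a finite positive value \<open>v\<close> would
        satisfy \<open>v \<le> v / 2\<close>.\<close>
      have "P f = \<infinity>"
      proof (rule ccontr)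
        assume "P f \<noteq> \<infinity>"
        then obtain v where v: "P f = ennreal v" "v > 0" using False by (cases "P f") auto
        have "P (ennreal (1/2) * f) \<le> ennreal (1/2) * P f"
          by (intro star_functionD[OF P]) (simp del: ennreal_half add: ennreal_le_1)
        moreover have "ennreal (1/2) * f = f" using top by (simp add: ennreal_mult_top)
        ultimately have "ennreal v \<le> ennreal (1/2 * v)" using v
            by (metis ennreal_mult less_imp_le zero_le_divide_1_iff zero_le_numeral)
        then show False using v by (subst (asm) ennreal_le_iff) auto
      qed
      then show ?thesis by simp
    qed
  qed
next
  case False
  then have "f - b = 0" by (auto simp: diff_eq_0_iff_ennreal not_le intro: less_imp_le order.strict_trans2)
  then show ?thesis by simp
qed

lemma ennreal_le_add_diff: "x \<le> b + (x - b)" for b x :: ennreal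
  by (cases "b \<le> x") (auto simp: add_diff_inverse_ennreal not_le intro: order_trans[OF less_imp_le])

lemma nn_integral_minus_const_ge:
  assumes [measurable]: "f \<in> borel_measurable M" "S \<in> sets M"
  shows "(\<integral>\<^sup>+x\<in>S. f x \<partial>M) \<le> (\<integral>\<^sup>+x\<in>S. (f x - b) \<partial>M) + b * emeasure M S"
proof -
  have "(\<integral>\<^sup>+x\<in>S. f x \<partial>M) \<le> (\<integral>\<^sup>+x. (f x - b) * indicator S x + b * indicator S x \<partial>M)"
    by (intro nn_integral_mono) (auto simp: indicator_def add.commute ennreal_le_add_diff)
  also have "\<dots> = (\<integral>\<^sup>+x\<in>S. (f x - b) \<partial>M) + b * emeasure M S"
    by (simp add: nn_integral_add nn_integral_cmult_indicator)
  finally show ?thesis .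
qed

text \<open>Integrating the lower bound \<open>P f \<ge> (f - b) / b * P b\<close>, which only needs star-shapedness,
  gives Jensen's inequality up to a factor 2 in the argument.\<close>

lemma star_function_jensen:
  assumes P: "star_function P" and f[measurable]: "f \<in> borel_measurable M"
    and S[measurable]: "S \<in> sets M" and v: "0 < v" "emeasure M S = ennreal v"
  shows "P (ennreal (1 / (2 * v)) * (\<integral>\<^sup>+x\<in>S. f x \<partial>M)) \<le> ennreal (1 / v) * (\<integral>\<^sup>+x\<in>S. P (f x) \<partial>M)"
proof -
  note [measurable] = star_function_measurable[OF P]
  let ?I = "\<integral>\<^sup>+x\<in>S. f x \<partial>M"
  have key: "(\<integral>\<^sup>+x\<in>S. (f x - b) \<partial>M) / b * P b \<le> (\<integral>\<^sup>+x\<in>S. P (f x) \<partial>M)"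
    if "b \<noteq> 0" "b < \<infinity>" for b
  proof -
    have "(\<integral>\<^sup>+x\<in>S. (f x - b) \<partial>M) / b * P b = (\<integral>\<^sup>+x. (f x - b) * indicator S x / b * P b \<partial>M)"
      by (simp add: nn_integral_divide nn_integral_multc)
    also have "\<dots> \<le> (\<integral>\<^sup>+x\<in>S. P (f x) \<partial>M)"
      using star_function_lower[OF P that]
      by (intro nn_integral_mono) (auto simp: indicator_def)
    finally show ?thesis .
  qed
  show ?thesis
  proof (cases "?I = 0 \<or> ?I = \<infinity>")
    case False
    then obtain a where a: "?I = ennreal a" "a > 0"
      by (metis ennreal_cases ennreal_eq_0_iff infinity_ennreal_def linorder_not_le)
    \<comment> \<open>Half the average of \<open>f\<close>: subtracting \<open>b\<close> on a set of
      measure \<open>v\<close> costs at most half of the integral \<open>a\<close>.\<close>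
    define b where "b = ennreal (a / (2 * v))"
    have b: "b \<noteq> 0" "b < \<infinity>" using a v by (auto simp: b_def)
    have "ennreal a \<le> (\<integral>\<^sup>+x\<in>S. (f x - b) \<partial>M) + b * ennreal v"
      using nn_integral_minus_const_ge[OF f S, of b] a v by simp
    also have "b * ennreal v = ennreal (a / 2)"
      using v a by (simp add: b_def flip: ennreal_mult)
    finally have "ennreal (a / 2) \<le> (\<integral>\<^sup>+x\<in>S. (f x - b) \<partial>M)"
      using a by (cases "\<integral>\<^sup>+x\<in>S. (f x - b) \<partial>M") (auto simp flip: ennreal_plus)
    then have "ennreal (a / 2) / b * P b \<le> (\<integral>\<^sup>+x\<in>S. P (f x) \<partial>M)"
      by (intro order_trans[OF _ key[OF b]] mult_right_mono divide_right_mono_ennreal) auto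
    moreover have "ennreal (a / 2) / b = ennreal v"
      using a v by (simp add: b_def divide_ennreal)
    ultimately have "ennreal (1/v) * (ennreal v * P b) \<le> ennreal (1/v) * (\<integral>\<^sup>+x\<in>S. P (f x) \<partial>M)"
      by (intro mult_left_mono) auto
    moreover have "ennreal (1/v) * (ennreal v * P b) = P b"
      using v by (simp flip: mult.assoc ennreal_mult)
    moreover have "b = ennreal (1 / (2 * v)) * ?I"
      using a v by (simp add: b_def flip: ennreal_mult)
    ultimately show ?thesis by simp
  next
    case True
    then show ?thesis
    proof
      assume I: "?I = \<infinity>"
      \<comment> \<open>With an infinite integral any finite \<open>b\<close> with
        \<open>P b \<noteq> 0\<close> works: \<open>b * v\<close> is finite, so the integral of
        \<open>f - b\<close> stays infinite.\<close>
      obtain b where b: "b < \<infinity>" "P b \<noteq> 0" using P by (auto simp: star_function_def)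
      then have b0: "b \<noteq> 0" using star_functionD(2)[OF P] by auto
      have "b * ennreal v < \<infinity>" using b by (simp add: ennreal_mult_less_top)
      then have "(\<integral>\<^sup>+x\<in>S. (f x - b) \<partial>M) = \<infinity>"
        using nn_integral_minus_const_ge[OF f S, of b] I v
        by (auto simp: top_unique)
      then have "\<infinity> / b * P b \<le> (\<integral>\<^sup>+x\<in>S. P (f x) \<partial>M)"
        using key[OF b0 b(1)] by simp
      moreover have "\<infinity> / b * P b = \<infinity>"
        using b b0 by (simp add: ennreal_top_divide ennreal_top_mult)
      ultimately have "(\<integral>\<^sup>+x\<in>S. P (f x) \<partial>M) = \<infinity>" by (simp add: top_unique)
      then show ?thesis using v by (simp add: ennreal_mult_top)
    qed (simp add: star_functionD[OF P])
  qed
qed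

text \<open>The only property of \<^const>\<open>sobolev_conj\<close> that the embedding needs. It holds because
  \<open>H(t) \<ge> t A(t)\<^sup>-\<^sup>\<sigma>\<^sup>/\<^sup>n\<close>, the integrand in \<open>H\<close> being nonincreasing.\<close>

lemma sobolev_conj_le:
  fixes \<sigma> :: real and L :: real
  assumes A: "young_function A" and \<sigma>: "0 < \<sigma>" "\<sigma> < real n"
    and L: "0 < L" and t: "young_extend A t \<le> ennreal (L ^ n)"
    and b: "0 \<le> b" "ennreal b \<le> ennreal (L powr - \<sigma>) * t"
  shows "sobolev_conj n \<sigma> A b \<le> young_extend A t"
proof -
  have "t \<noteq> \<infinity>" using t by (auto simp: young_extend_def top_unique)
  then obtain t' where t': "t = ennreal t'" "0 \<le> t'" by (cases t) auto
  have At: "A t' \<le> ennreal (L ^ n)" using t t' by simp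
  have bt: "b \<le> L powr - \<sigma> * t'" using b t' L by (simp flip: ennreal_mult)
  let ?a = "\<sigma> / (real n - \<sigma>)"
  have H: "ennreal b \<le> conj_H n \<sigma> A t'"
  proof (cases "t' = 0")
    case True
    then show ?thesis using bt by (simp add: ennreal_neg)
  next
    case False
    then have tp: "t' > 0" using t' by simp
    have a0: "?a > 0" using \<sigma> by simp
    \<comment> \<open>By star-shapedness \<open>A t' \<le> L ^ n\<close> forces
      \<open>A \<tau> \<le> \<tau> / q\<close> on \<open>(0, t']\<close>, so the integrand of H is
      there at least the constant \<open>q powr (\<sigma> / (n - \<sigma>))\<close>.\<close>
    define q where "q = t' / L ^ n"
    have q: "q > 0" using tp L by (simp add: q_def)
    have int: "ennreal (q powr ?a) \<le> conj_integrand n \<sigma> A \<tau>" if \<tau>: "0 < \<tau>" "\<tau> \<le> t'" for \<tau>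
    proof -
      have "A ((\<tau> / t') * t') \<le> ennreal (\<tau> / t') * A t'"
        using tp \<tau> by (intro young_function_scale[OF A]) auto
      also have "\<dots> \<le> ennreal (\<tau> / t') * ennreal (L ^ n)"
        using At by (intro mult_left_mono) auto
      also have "\<dots> = ennreal (\<tau> / q)"
        using tp \<tau> L by (simp add: q_def flip: ennreal_mult)
      finally have Ale: "A \<tau> \<le> ennreal (\<tau> / q)" using tp by simp
      show ?thesis
      proof (cases "A \<tau> = 0")
        case True
        then have "ennreal \<tau> / A \<tau> = \<infinity>" using \<tau> by (simp add: ennreal_divide_zero)
        then show ?thesis by (simp add: conj_integrand_def ennreal_powr_def)
      next
        case False
        have "A \<tau> \<noteq> \<infinity>" using Ale by (auto simp: top_unique)
        then obtain y where y: "A \<tau> = ennreal y" "y > 0" using False by (cases "A \<tau>") auto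
        have "y \<le> \<tau> / q" using Ale y \<tau> q by simp
        then have "q \<le> \<tau> / y" using y q by (simp add: field_simps)
        then have "q powr ?a \<le> (\<tau> / y) powr ?a" using q a0 by (intro powr_mono2) auto
        then show ?thesis using y \<tau>
          by (simp add: conj_integrand_def ennreal_powr_def divide_ennreal)
      qed
    qed
    have "(\<integral>\<^sup>+\<tau>. ennreal (q powr ?a) * indicator {0<..t'} \<tau> \<partial>lborel) = ennreal (q powr ?a) * ennreal t'"
      using tp by (subst nn_integral_cmult_indicator) auto
    then have "ennreal (t' * q powr ?a) = (\<integral>\<^sup>+\<tau>. ennreal (q powr ?a) * indicator {0<..t'} \<tau> \<partial>lborel)"
      using tp by (simp add: mult.commute flip: ennreal_mult)
    also have "\<dots> \<le> (\<integral>\<^sup>+\<tau>\<in>{0..t'}. conj_integrand n \<sigma> A \<tau> \<partial>lborel)" (is "_ \<le> ?G")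
      by (intro nn_integral_mono) (auto simp: indicator_def int)
    finally have G: "ennreal (t' * q powr ?a) \<le> ?G" .
    \<comment> \<open>The outer power of H turns the constant into t'^(1 - \<sigma>/n)
      q^(\<sigma>/n), and with q = t' / L^n this is exactly L^-\<sigma> t'.\<close>
    have "b \<le> (t' * q powr ?a) powr ((real n - \<sigma>) / real n)"
    proof -
      have "?a * ((real n - \<sigma>) / real n) = \<sigma> / real n" using \<sigma> by simp
      then have "(t' * q powr ?a) powr ((real n - \<sigma>) / real n)
          = t' powr ((real n - \<sigma>) / real n) * q powr (\<sigma> / real n)"
        using tp q by (subst powr_mult) (auto simp: powr_powr simp del: times_divide_eq_right
            times_divide_eq_left)
      also have "q powr (\<sigma> / real n) = t' powr (\<sigma> / real n) * L powr - \<sigma>"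
        using tp L \<sigma> by (simp add: q_def powr_divide powr_minus_divide powr_powr
            flip: powr_realpow)
      also have "t' powr ((real n - \<sigma>) / real n) * (t' powr (\<sigma> / real n) * L powr - \<sigma>)
          = t' powr ((real n - \<sigma>) / real n + \<sigma> / real n) * L powr - \<sigma>"
        by (simp add: powr_add)
      also have "(real n - \<sigma>) / real n + \<sigma> / real n = 1"
        using \<sigma> by (simp add: diff_divide_distrib)
      finally show ?thesis using bt tp by (simp add: mult.commute)
    qed
    then have le: "b \<le> (t' * q powr ?a) powr ((real n - \<sigma>) / real n)" .
    show ?thesis
    proof (cases ?G)
      case (real g)
      then have "t' * q powr ?a \<le> g" using G by simp
      then have "(t' * q powr ?a) powr ((real n - \<sigma>) / real n) \<le> g powr ((real n - \<sigma>) / real n)"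
        using \<sigma> tp by (intro powr_mono2) auto
      then show ?thesis using le real by (simp add: conj_H_def ennreal_powr_def ennreal_leI)
    qed (simp add: conj_H_def ennreal_powr_def)
  qed
  have "left_inverse (conj_H n \<sigma> A) b \<le> t"
    unfolding left_inverse_def using H t' by (auto intro!: INF_lower2[of t'])
  then show ?thesis
    unfolding sobolev_conj_def using monoD[OF star_functionD(1)[OF young_extend_star[OF A]]] by auto
qed

lemma sobolev_conj_0:
  assumes "young_function A"
  shows "sobolev_conj n \<sigma> A 0 = 0"
proof -
  have "left_inverse (conj_H n \<sigma> A) 0 = 0"
    unfolding left_inverse_def by (intro antisym INF_lower2[of 0]) auto
  then show ?thesis using assms
    by (simp add: sobolev_conj_def young_extend_def young_function_def)
qed

lemma sobolev_conj_mono: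
  assumes "young_function A" "x \<le> y"
  shows "sobolev_conj n \<sigma> A x \<le> sobolev_conj n \<sigma> A y"
proof -
  have "left_inverse (conj_H n \<sigma> A) x \<le> left_inverse (conj_H n \<sigma> A) y"
    unfolding left_inverse_def
    using assms(2) by (intro INF_superset_mono) (auto intro: order_trans[OF ennreal_leI])
  then show ?thesis
    unfolding sobolev_conj_def
    using monoD[OF star_functionD(1)[OF young_extend_star[OF assms(1)]]] by auto
qed

section \<open>Sums and integrals over dyadic scales\<close>

text \<open>The weight of a piece at scale \<open>2^-j\<close> seen at distance \<open>h\<close>,
  with \<open>\<tau> = 2^j * h\<close>. It is small at both ends, so that it is summable over
  \<open>j\<close> for fixed \<open>h\<close> and, divided by \<open>h^n\<close>, integrable over
  space for fixed \<open>j\<close>.\<close>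

definition decay :: "real \<Rightarrow> real \<Rightarrow> real" where
  "decay \<epsilon> \<tau> = min (\<tau> powr \<epsilon>) (\<tau> powr - \<epsilon>)"

definition geom_bound :: "real \<Rightarrow> real" where
  "geom_bound \<epsilon> = 1 / (1 - 2 powr - \<epsilon>)"

lemma two_powr_neg_bounds:
  assumes "0 < \<epsilon>" shows "0 < 2 powr - \<epsilon>" "2 powr - \<epsilon> < (1::real)"
  using assms by (auto intro: powr_less_one)

lemma geom_bound_pos: "0 < \<epsilon> \<Longrightarrow> 0 < geom_bound \<epsilon>"
  using two_powr_neg_bounds[of \<epsilon>] by (simp add: geom_bound_def)

lemma decay_nonneg [simp]: "0 \<le> decay \<epsilon> \<tau>"
  by (simp add: decay_def)

lemma decay_le_1:
  assumes "0 < \<epsilon>" "0 \<le> \<tau>" shows "decay \<epsilon> \<tau> \<le> 1"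
proof (cases "\<tau> \<le> 1")
  case True
  then have "\<tau> powr \<epsilon> \<le> 1 powr \<epsilon>" using assms by (intro powr_mono2) auto
  then show ?thesis by (simp add: decay_def)
next
  case False
  then have "\<tau> powr - \<epsilon> \<le> 1 powr - \<epsilon>" using assms by (intro powr_mono2') auto
  then show ?thesis by (simp add: decay_def)
qed

lemma measurable_decay [measurable]: "decay \<epsilon> \<in> borel_measurable borel"
  unfolding decay_def by measurable

lemma powr_two_power: "((2::real) ^ k) powr - \<epsilon> = (2 powr - \<epsilon>) ^ k"
  by (induction k) (simp_all add: powr_mult)

lemma powr_half_power: "(1 / (2::real) ^ k) powr \<epsilon> = (2 powr - \<epsilon>) ^ k"
proof (induction k)
  case (Suc k)
  have "(1 / (2::real) ^ Suc k) powr \<epsilon> = (1 / 2) powr \<epsilon> * (1 / 2 ^ k) powr \<epsilon>"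
    by (subst powr_mult[symmetric]) auto
  also have "(1 / 2 :: real) powr \<epsilon> = 2 powr - \<epsilon>"
    by (simp add: powr_divide powr_minus inverse_eq_divide)
  finally show ?case using Suc by simp
qed simp

lemma suminf_geom_ennreal:
  assumes "0 < \<epsilon>"
  shows "(\<Sum>k. ennreal ((2 powr - \<epsilon>) ^ k)) = ennreal (geom_bound \<epsilon>)"
proof (rule suminf_ennreal_eq)
  show "(\<lambda>k. (2 powr - \<epsilon>) ^ k) sums geom_bound \<epsilon>"
    unfolding geom_bound_def by (rule geometric_sums) (use two_powr_neg_bounds[OF assms] in simp)
qed simp

lemma dyadic_scale:
  fixes \<tau> :: real assumes "1 \<le> \<tau>"
  obtains k :: nat where "2 ^ k \<le> \<tau>" "\<tau> \<le> 2 ^ Suc k"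
proof -
  obtain m :: nat where m: "\<tau> < 2 ^ m"
    using real_arch_pow[of 2 \<tau>] by auto
  define k where "k = (LEAST m. \<tau> < 2 ^ m)"
  have k: "\<tau> < 2 ^ k" unfolding k_def by (rule LeastI[of "\<lambda>m. \<tau> < 2 ^ m", OF m])
  have "k \<noteq> 0" using k assms by (intro notI) simp
  then obtain k' where k': "k = Suc k'" by (cases k) auto
  have "\<not> \<tau> < 2 ^ k'" using not_less_Least[of k' "\<lambda>m. \<tau> < 2 ^ m"] k' by (simp add: k_def)
  then show ?thesis using k k' by (intro that[of k']) auto
qed

text \<open>The weights fall off geometrically on either side of the first \<open>j\<close> with
  \<open>2^j * h \<ge> 1\<close>, and each side costs one \<open>geom_bound\<close>. For
  \<open>h = 0\<close> all terms vanish, because 0 \<open>powr\<close> anything is 0.\<close>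

lemma decay_sum_le:
  assumes \<epsilon>: "0 < \<epsilon>" and h: "0 \<le> h"
  shows "(\<Sum>j. ennreal (decay \<epsilon> (2 ^ j * h))) \<le> ennreal (2 * geom_bound \<epsilon>)"
proof (cases "h = 0")
  case False
  then have h: "0 < h" using assms by simp
  define q where "q = 2 powr - \<epsilon>"
  have q: "0 < q" "q < 1" using two_powr_neg_bounds[OF \<epsilon>] by (auto simp: q_def)
  obtain m :: nat where "1 / h < 2 ^ m" using real_arch_pow[of 2 "1 / h"] by auto
  then have m: "1 \<le> 2 ^ m * h" using h by (simp add: field_simps)
  define J where "J = (LEAST m. 1 \<le> 2 ^ m * h)"
  have J: "1 \<le> 2 ^ J * h" unfolding J_def by (rule LeastI[of "\<lambda>m. 1 \<le> 2 ^ m * h", OF m])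
  have J': "2 ^ j * h < 1" if "j < J" for j
    using not_less_Least[of j "\<lambda>m. 1 \<le> 2 ^ m * h"] that by (simp add: J_def)
  \<comment> \<open>Minimality of \<open>J\<close> gives \<open>2 ^ (J - 1) * h < 1\<close>; the
    exponent \<open>J - Suc j\<close> counts the steps from \<open>j\<close> up to
    \<open>J - 1\<close>.\<close>
  have lo: "decay \<epsilon> (2 ^ j * h) \<le> q ^ (J - Suc j)" if "j < J" for j
  proof -
    have "2 ^ (J - Suc j) * (2 ^ j * h) = 2 ^ (J - 1) * h"
      using that by (simp flip: power_add mult.assoc)
    also have "\<dots> \<le> 1" using J'[of "J - 1"] that by simp
    finally have "2 ^ j * h \<le> 1 / 2 ^ (J - Suc j)" by (simp add: field_simps)
    then have "(2 ^ j * h) powr \<epsilon> \<le> (1 / 2 ^ (J - Suc j)) powr \<epsilon>"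
      using h \<epsilon> by (intro powr_mono2) auto
    also have "\<dots> = q ^ (J - Suc j)"
      unfolding q_def by (rule powr_half_power)
    finally show ?thesis by (simp add: decay_def)
  qed
  have hi: "decay \<epsilon> (2 ^ (i + J) * h) \<le> q ^ i" for i
  proof -
    have "2 ^ i * 1 \<le> 2 ^ i * (2 ^ J * h)" using J by (intro mult_left_mono) auto
    then have "(2 ^ (i + J) * h) powr - \<epsilon> \<le> (2 ^ i) powr - \<epsilon>"
      using \<epsilon> by (intro powr_mono2') (auto simp: power_add mult.assoc)
    then show ?thesis by (simp add: decay_def q_def powr_two_power)
  qed
  have "(\<Sum>j. ennreal (decay \<epsilon> (2 ^ j * h)))
      = (\<Sum>i. ennreal (decay \<epsilon> (2 ^ (i + J) * h))) + (\<Sum>j<J. ennreal (decay \<epsilon> (2 ^ j * h)))"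
    by (rule suminf_offset) simp
  also have "\<dots> \<le> (\<Sum>i. ennreal (q ^ i)) + (\<Sum>j<J. ennreal (q ^ (J - Suc j)))"
    by (intro add_mono suminf_le sum_mono ennreal_leI lo hi) auto
  also have "(\<Sum>j<J. ennreal (q ^ (J - Suc j))) = (\<Sum>j<J. ennreal (q ^ j))"
    by (rule sum.nat_diff_reindex)
  also have "(\<Sum>i. ennreal (q ^ i)) + \<dots> \<le> (\<Sum>i. ennreal (q ^ i)) + (\<Sum>i. ennreal (q ^ i))"
    by (intro add_left_mono sum_le_suminf) auto
  also have "\<dots> = ennreal (2 * geom_bound \<epsilon>)"
    using geom_bound_pos[OF \<epsilon>] unfolding q_def suminf_geom_ennreal[OF \<epsilon>]
    by (subst ennreal_plus[symmetric]) (auto simp: less_imp_le)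
  finally show ?thesis .
qed (simp add: decay_def)

section \<open>Ball volumes and radial integrals\<close>

definition ball_vol :: "'n::finite itself \<Rightarrow> real" where
  "ball_vol _ = unit_ball_vol (real CARD('n))"

lemma ball_vol_pos [simp]: "0 < ball_vol TYPE('n::finite)"
  by (simp add: ball_vol_def)

lemma ball_vol_nonneg [simp]: "0 \<le> ball_vol TYPE('n::finite)"
  by (simp add: ball_vol_def)

lemma emeasure_cball_cart:
  assumes "0 \<le> r"
  shows "emeasure lborel (cball (x :: real^'n::finite) r) = ennreal (ball_vol TYPE('n) * r ^ CARD('n))"
  using emeasure_cball[OF assms, of x] by (simp add: ball_vol_def)

text \<open>A function of \<open>norm (x - y)\<close> is dominated by a combination of indicators of dyadic balls; this
  replaces integration in polar coordinates.\<close>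

lemma decay_integral_le:
  fixes y :: "real^'n::finite"
  assumes \<epsilon>: "0 < \<epsilon>" and a: "0 < a"
  shows "(\<integral>\<^sup>+x. ennreal (decay \<epsilon> (a * norm (x - y)) / norm (x - y) ^ CARD('n)) \<partial>lborel)
    \<le> ennreal (2 * (ball_vol TYPE('n) * 2 ^ CARD('n)) * geom_bound \<epsilon>)"
proof -
  let ?n = "CARD('n)"
  let ?w = "ball_vol TYPE('n)"
  define q where "q = 2 powr - \<epsilon>"
  have q: "0 < q" "q < 1" using two_powr_neg_bounds[OF \<epsilon>] by (auto simp: q_def)
  \<comment> \<open>On the shell \<open>2^-(k+1) \<le> a * h \<le> 2^-k\<close> the integrand is at
    most \<open>c k\<close>, and on \<open>2^k \<le> a * h \<le> 2^(k+1)\<close> at most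
    \<open>d k\<close>. Multiplied by the volume of the enclosing ball, the powers of
    \<open>2^k\<close> and of \<open>a\<close> cancel, and both families become the same geometric
    sequence.\<close>
  define c where "c k = a ^ ?n * 2 ^ (Suc k * ?n) * q ^ k" for k
  define d where "d k = a ^ ?n / 2 ^ (k * ?n) * q ^ k" for k
  have cd: "0 \<le> c k" "0 \<le> d k" for k using a q by (auto simp: c_def d_def)
  have pt: "ennreal (decay \<epsilon> (a * norm (x - y)) / norm (x - y) ^ ?n)
     \<le> (\<Sum>k. ennreal (c k) * indicator (cball y (1 / 2 ^ k / a)) x)
       + (\<Sum>k. ennreal (d k) * indicator (cball y (2 ^ Suc k / a)) x)" (is "?l x \<le> ?s1 x + ?s2 x") for x
  proof (cases "x = y")
    case False
    define h where "h = norm (x - y)"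
    have h: "h > 0" using False by (simp add: h_def)
    have dist: "dist y x = h" by (simp add: h_def dist_norm norm_minus_commute)
    show ?thesis
    proof (cases "1 \<le> a * h")
      case True
      then obtain k where k: "2 ^ k \<le> a * h" "a * h \<le> 2 ^ Suc k" by (rule dyadic_scale)
      have "(a * h) powr - \<epsilon> \<le> (2 ^ k) powr - \<epsilon>" using k \<epsilon> by (intro powr_mono2') auto
      then have 1: "decay \<epsilon> (a * h) \<le> q ^ k" by (simp add: decay_def q_def powr_two_power)
      have "(2 ^ k / a) ^ ?n \<le> h ^ ?n" using k a by (intro power_mono) (auto simp: field_simps)
      then have "1 / h ^ ?n \<le> 1 / (2 ^ k / a) ^ ?n" using a h by (intro divide_left_mono) auto
      also have "\<dots> = a ^ ?n / 2 ^ (k * ?n)" by (simp add: power_divide power_mult)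
      finally have "decay \<epsilon> (a * h) * (1 / h ^ ?n) \<le> q ^ k * (a ^ ?n / 2 ^ (k * ?n))"
        using 1 q h by (intro mult_mono) auto
      then have "ennreal (decay \<epsilon> (a * h) / h ^ ?n) \<le> ennreal (d k) * indicator (cball y (2 ^ Suc k / a)) x"
        using k a dist by (auto simp: d_def mult.commute pos_le_divide_eq intro!: ennreal_leI)
      also have "\<dots> \<le> ?s2 x"
        using sum_le_suminf[of "\<lambda>k. ennreal (d k) * indicator (cball y (2 ^ Suc k / a)) x" "{k}"]
        by (simp only: sum.insert sum.empty finite.intros empty_iff add_0_right simp_thms)
          simp
      also have "\<dots> \<le> ?s1 x + ?s2 x" by simp
      finally show ?thesis by (simp add: h_def)
    next
      case False
      then have "1 \<le> 1 / (a * h)" using a h by (simp add: field_simps)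
      then obtain k where k: "2 ^ k \<le> 1 / (a * h)" "1 / (a * h) \<le> 2 ^ Suc k" by (rule dyadic_scale)
      have k1: "a * h \<le> 1 / 2 ^ k" using k(1) a h by (simp add: field_simps)
      have "(a * h) powr \<epsilon> \<le> (1 / 2 ^ k) powr \<epsilon>" using k1 a h \<epsilon> by (intro powr_mono2) auto
      also have "\<dots> = q ^ k"
        unfolding q_def by (rule powr_half_power)
      finally have 1: "decay \<epsilon> (a * h) \<le> q ^ k" by (simp add: decay_def)
      have "1 / h \<le> a * 2 ^ Suc k" using k(2) a h by (simp add: field_simps)
      then have "(1 / h) ^ ?n \<le> (a * 2 ^ Suc k) ^ ?n" using h by (intro power_mono) auto
      then have "1 / h ^ ?n \<le> a ^ ?n * 2 ^ (Suc k * ?n)"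
        by (simp only: power_mult_distrib power_mult power_one_over)
      then have "decay \<epsilon> (a * h) * (1 / h ^ ?n) \<le> q ^ k * (a ^ ?n * 2 ^ (Suc k * ?n))"
        using 1 q h by (intro mult_mono) auto
      moreover have "h \<le> 1 / 2 ^ k / a" using k1 a by (simp add: field_simps)
      ultimately have "ennreal (decay \<epsilon> (a * h) / h ^ ?n)
          \<le> ennreal (c k) * indicator (cball y (1 / 2 ^ k / a)) x"
        using dist by (auto simp: c_def mult.commute intro!: ennreal_leI)
      also have "\<dots> \<le> ?s1 x"
        using sum_le_suminf[of "\<lambda>k. ennreal (c k) * indicator (cball y (1 / 2 ^ k / a)) x" "{k}"]
        by (simp only: sum.insert sum.empty finite.intros empty_iff add_0_right simp_thms)
          simp
      also have "\<dots> \<le> ?s1 x + ?s2 x" by simp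
      finally show ?thesis by (simp add: h_def)
    qed
  qed (simp add: decay_def)
  have e1: "c k * (?w * (1 / 2 ^ k / a) ^ ?n) = ?w * 2 ^ ?n * q ^ k" for k
  proof -
    have "(1 / 2 ^ k / a) ^ ?n = 1 / (2 ^ (k * ?n) * a ^ ?n)"
      by (simp add: power_divide power_mult power_mult_distrib)
    moreover have "c k = a ^ ?n * (2 ^ ?n * 2 ^ (k * ?n)) * q ^ k"
      by (simp add: c_def power_add)
    ultimately show ?thesis using a by simp
  qed
  have e2: "d k * (?w * (2 ^ Suc k / a) ^ ?n) = ?w * 2 ^ ?n * q ^ k" for k
  proof -
    have "(2 ^ Suc k / a) ^ ?n = 2 ^ ?n * 2 ^ (k * ?n) / a ^ ?n"
      by (simp add: power_divide power_mult power_mult_distrib)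
    then show ?thesis using a by (simp add: d_def)
  qed
  have i1: "(\<integral>\<^sup>+x. ennreal (c k) * indicator (cball y (1 / 2 ^ k / a)) x \<partial>lborel) = ennreal (?w * 2 ^ ?n)
      * ennreal (q ^ k)" for k
  proof -
    have "(\<integral>\<^sup>+x. ennreal (c k) * indicator (cball y (1 / 2 ^ k / a)) x \<partial>lborel)
        = ennreal (c k) * ennreal (?w * (1 / 2 ^ k / a) ^ ?n)"
      using a by (subst nn_integral_cmult_indicator) (simp_all del: power_Suc add: emeasure_cball_cart)
    also have "\<dots> = ennreal (?w * 2 ^ ?n * q ^ k)"
      unfolding e1[symmetric] using cd a by (intro ennreal_mult[symmetric]) auto
    finally show ?thesis using q by (subst (asm) ennreal_mult) auto
  qed
  have i2: "(\<integral>\<^sup>+x. ennreal (d k) * indicator (cball y (2 ^ Suc k / a)) x \<partial>lborel) = ennreal (?w * 2 ^ ?n)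
      * ennreal (q ^ k)" for k
  proof -
    have "(\<integral>\<^sup>+x. ennreal (d k) * indicator (cball y (2 ^ Suc k / a)) x \<partial>lborel)
        = ennreal (d k) * ennreal (?w * (2 ^ Suc k / a) ^ ?n)"
      using a by (subst nn_integral_cmult_indicator) (simp_all del: power_Suc add: emeasure_cball_cart)
    also have "\<dots> = ennreal (?w * 2 ^ ?n * q ^ k)"
      unfolding e2[symmetric] using cd a by (intro ennreal_mult[symmetric]) auto
    finally show ?thesis using q by (subst (asm) ennreal_mult) auto
  qed
  have m1': "(\<lambda>x. ennreal (c k) * indicator (cball y (1 / 2 ^ k / a)) x) \<in> borel_measurable lborel" for k
    by (intro borel_measurable_times_ennreal borel_measurable_indicator) auto
  then have m1: "?s1 \<in> borel_measurable lborel" by (rule borel_measurable_suminf_order)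
  have m2': "(\<lambda>x. ennreal (d k) * indicator (cball y (2 ^ Suc k / a)) x) \<in> borel_measurable lborel" for k
    by (intro borel_measurable_times_ennreal borel_measurable_indicator) auto
  then have m2: "?s2 \<in> borel_measurable lborel" by (rule borel_measurable_suminf_order)
  have "(\<integral>\<^sup>+x. ?l x \<partial>lborel) \<le> (\<integral>\<^sup>+x. ?s1 x + ?s2 x \<partial>lborel)"
    by (intro nn_integral_mono pt)
  also have "\<dots> = (\<Sum>k. ennreal (?w * 2 ^ ?n) * ennreal (q ^ k)) + (\<Sum>k. ennreal (?w * 2 ^ ?n)
      * ennreal (q ^ k))"
    by (simp only: nn_integral_add[OF m1 m2] nn_integral_suminf[OF m1'] nn_integral_suminf[OF m2'] i1 i2)
  also have "\<dots> = ennreal (2 * (?w * 2 ^ ?n) * geom_bound \<epsilon>)"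
    using geom_bound_pos[OF \<epsilon>] unfolding q_def ennreal_suminf_cmult suminf_geom_ennreal[OF \<epsilon>]
    by (simp only: mult_2 distrib_right, subst ennreal_plus) (auto simp: less_imp_le ennreal_mult)
  finally show ?thesis .
qed

text \<open>Pigeonhole: if every \<open>t j\<close> were at most \<open>X / (2 * C * W)\<close>, the
  weighted series would account for at most \<open>X / 2\<close>. The factor 2 makes the
  contradiction strict.\<close>

lemma series_selection:
  fixes t w :: "nat \<Rightarrow> ennreal"
  assumes X: "0 < X" "ennreal X \<le> ennreal C * (\<Sum>j. w j * t j)" "(\<Sum>j. w j) \<le> ennreal W"
    and C: "0 < C" "0 < W"
  obtains j where "ennreal (X / (2 * C * W)) \<le> t j"
proof (rule ccontr)
  assume "\<not> thesis"
  then have lt: "t j \<le> ennreal (X / (2 * C * W))" for j using that[of j] by (cases "ennreal (X / (2 * C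
      * W)) \<le> t j") auto
  have "ennreal X \<le> ennreal C * (\<Sum>j. w j * ennreal (X / (2 * C * W)))"
    using lt by (intro order_trans[OF X(2)] mult_left_mono suminf_le) auto
  also have "\<dots> \<le> ennreal C * (ennreal W * ennreal (X / (2 * C * W)))"
    using X(3) by (auto intro!: mult_left_mono mult_right_mono)
  also have "\<dots> = ennreal (C * (W * (X / (2 * C * W))))"
    using X(1) C by (simp only: ennreal_mult less_imp_le zero_le_mult_iff zero_le_divide_iff
        zero_le_numeral simp_thms)
  also have "C * (W * (X / (2 * C * W))) = X / 2" using C by simp
  finally show False using X(1) by simp
qed

section \<open>Orlicz modulars of dyadic series\<close>

text \<open>The relation between \<open>A\<close> (as \<open>P\<close>) and its Sobolev conjugate \<open>B\<close> at the dyadic scales \<open>2\<^sup>-\<^sup>j\<close>.\<close>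

definition dyadic_dominated :: "nat \<Rightarrow> real \<Rightarrow> (real \<Rightarrow> ennreal) \<Rightarrow> (ennreal \<Rightarrow> ennreal) \<Rightarrow> bool" where
  "dyadic_dominated n \<sigma> B P \<longleftrightarrow> B 0 = 0 \<and>
     (\<forall>j t b. P t \<le> ennreal ((2 ^ j) ^ n) \<longrightarrow> 0 \<le> b \<longrightarrow> ennreal b \<le> ennreal ((2 ^ j) powr - \<sigma>) * t
        \<longrightarrow> B b \<le> P t)"

lemma sobolev_conj_dominated:
  assumes "young_function A" "0 < \<sigma>" "\<sigma> < real n"
  shows "dyadic_dominated n \<sigma> (sobolev_conj n \<sigma> A) (young_extend A)"
  unfolding dyadic_dominated_def using sobolev_conj_0[OF assms(1)]
  by (auto intro!: sobolev_conj_le[OF assms])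

lemma ennreal_mult_le_one_mono: "c \<le> 1 \<Longrightarrow> c * t \<le> (t :: ennreal)"
  using mult_right_mono[of c 1 t] by simp

text \<open>A single term of the series already dominates \<open>X\<close>, so that no convexity of \<open>B\<close> is needed.\<close>

lemma dominated_series:
  fixes T s w :: "nat \<Rightarrow> ennreal"
  assumes P: "star_function P" and B: "dyadic_dominated n \<sigma> B P"
    and X: "0 \<le> X" "ennreal X \<le> ennreal C * (\<Sum>j. w j * (s j * (ennreal ((2 ^ j) powr - \<sigma>) * T j)))"
    and W: "(\<Sum>j. w j) \<le> ennreal W"
    and C: "0 < C" "0 < W" and \<delta>: "0 \<le> \<delta>" "\<delta> \<le> 1" and s: "\<And>j. s j \<le> 1"
    and T: "\<And>j. P (T j) \<le> ennreal ((2 ^ j) ^ n)"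
  shows "B (\<delta> / (2 * C * W) * X) \<le> ennreal \<delta> * (\<Sum>j. s j * P (T j))"
proof (cases "X = 0")
  case True
  then show ?thesis using B by (simp add: dyadic_dominated_def)
next
  case False
  then have "0 < X" using X by simp
  \<comment> \<open>The weight \<open>w\<close> is spent on selecting one scale; \<open>s\<close>
    survives as a coefficient in the conclusion, where it is available for a later
    integration.\<close>
  from series_selection[OF this X(2) W C] obtain j where
    j: "ennreal (X / (2 * C * W)) \<le> s j * (ennreal ((2 ^ j) powr - \<sigma>) * T j)" .
  have d1: "ennreal \<delta> \<le> 1" using \<delta> by simp
  \<comment> \<open>Placed inside \<open>P\<close>, the factor \<open>\<delta> * s j\<close> comes
    out as a factor of the modular by star-shapedness, and the smaller argument still satisfies the
    bound under which \<open>B\<close> is dominated.\<close>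
  have "ennreal \<delta> * s j \<le> 1 * 1" using d1 s by (intro mult_mono) auto
  then have c1: "ennreal \<delta> * s j \<le> 1" by simp
  have Pc: "P (ennreal \<delta> * s j * T j) \<le> ennreal \<delta> * s j * P (T j)"
    using c1 by (rule star_functionD[OF P])
  then have "P (ennreal \<delta> * s j * T j) \<le> ennreal ((2 ^ j) ^ n)"
    using ennreal_mult_le_one_mono[OF c1] T[of j] by (meson order_trans)
  moreover have "ennreal (\<delta> / (2 * C * W) * X) = ennreal \<delta> * ennreal (X / (2 * C * W))"
    using \<delta> X(1) C by (subst ennreal_mult[symmetric]) auto
  then have "ennreal (\<delta> / (2 * C * W) * X) \<le> ennreal ((2 ^ j) powr - \<sigma>) * (ennreal \<delta> * s j * T j)"
    using mult_left_mono[OF j, of "ennreal \<delta>"] by (simp add: ac_simps)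
  moreover have "0 \<le> \<delta> / (2 * C * W) * X" using \<delta> X(1) C by simp
  ultimately have "B (\<delta> / (2 * C * W) * X) \<le> P (ennreal \<delta> * s j * T j)"
    using B by (simp add: dyadic_dominated_def)
  also have "\<dots> \<le> ennreal \<delta> * (s j * P (T j))" using Pc by (simp add: mult.assoc)
  also have "s j * P (T j) \<le> (\<Sum>j. s j * P (T j))"
    using sum_le_suminf[of "\<lambda>j. s j * P (T j)" "{j}"] by simp
  finally show ?thesis by (simp add: mult_left_mono)
qed

text \<open>The decay \<open>\<kappa>\<close> in excess of \<open>\<sigma>\<close> is the selection
  weight, with total \<open>geom_bound \<kappa>\<close>; the second weight \<open>s\<close> is 1
  here. The choice \<open>\<delta> = 1 / K\<close> normalizes the total modular to 1.\<close>

lemma dominated_modular: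
  fixes F :: "nat \<Rightarrow> real^'n::finite \<Rightarrow> ennreal" and X :: "real^'n \<Rightarrow> real"
  assumes P: "star_function P" and B: "dyadic_dominated CARD('n) \<sigma> B P"
    and F[measurable]: "\<And>j. F j \<in> borel_measurable borel"
    and T: "\<And>j x. P (F j x) \<le> ennreal ((2 ^ j) ^ CARD('n))"
    and K: "(\<Sum>j. \<integral>\<^sup>+x. P (F j x) \<partial>lborel) \<le> ennreal K" "1 \<le> K"
    and C: "0 < C" and \<kappa>: "0 < \<kappa>"
    and X: "\<And>x. 0 \<le> X x"
      "AE x in lborel. ennreal (X x) \<le> ennreal C * (\<Sum>j. ennreal ((2 ^ j) powr - (\<sigma> + \<kappa>)) * F j x)"
  shows "(\<integral>\<^sup>+x. B (1 / K / (2 * C * geom_bound \<kappa>) * X x) \<partial>lborel) \<le> 1"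
proof -
  note [measurable] = star_function_measurable[OF P]
  have "B (1 / K / (2 * C * geom_bound \<kappa>) * X x) \<le> ennreal (1 / K) * (\<Sum>j. P (F j x))"
    if x: "ennreal (X x) \<le> ennreal C * (\<Sum>j. ennreal ((2 ^ j) powr - (\<sigma> + \<kappa>)) * F j x)" for x
  proof -
    have e: "ennreal ((2 ^ j) powr - (\<sigma> + \<kappa>)) = ennreal ((2 powr - \<kappa>) ^ j) * (1
        * ennreal ((2 ^ j) powr - \<sigma>))" for j
      by (simp add: powr_two_power[symmetric] ennreal_mult'[symmetric] powr_add[symmetric] add.commute)
    have "B (1 / K / (2 * C * geom_bound \<kappa>) * X x) \<le> ennreal (1 / K) * (\<Sum>j. 1 * P (F j x))"
    proof (rule dominated_series[OF P B])
      show "ennreal (X x) \<le> ennreal C * (\<Sum>j. ennreal ((2 powr - \<kappa>) ^ j) * (1 * (ennreal ((2 ^ j) powr - \<sigma>)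
          * F j x)))"
        using x unfolding e by (simp add: mult.assoc)
      show "(\<Sum>j. ennreal ((2 powr - \<kappa>) ^ j)) \<le> ennreal (geom_bound \<kappa>)"
        by (simp add: suminf_geom_ennreal[OF \<kappa>])
    qed (use X(1) K(2) C geom_bound_pos[OF \<kappa>] T in auto)
    then show ?thesis by simp
  qed
  then have "(\<integral>\<^sup>+x. B (1 / K / (2 * C * geom_bound \<kappa>) * X x) \<partial>lborel)
      \<le> (\<integral>\<^sup>+x. ennreal (1 / K) * (\<Sum>j. P (F j x)) \<partial>lborel)"
    using X(2) by (intro nn_integral_mono_AE) (auto elim: eventually_mono)
  also have "\<dots> = ennreal (1 / K) * (\<Sum>j. \<integral>\<^sup>+x. P (F j x) \<partial>lborel)"
    by (simp add: nn_integral_cmult nn_integral_suminf)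
  also have "\<dots> \<le> ennreal (1 / K) * ennreal K" by (intro mult_left_mono K) auto
  also have "\<dots> = 1" using K(2) by (simp add: ennreal_mult'[symmetric])
  finally show ?thesis .
qed

text \<open>Splits one weight into two: one copy selects a scale, the other is kept for the
  integration over \<open>x\<close> and \<open>y\<close>. Both minima switch branch at
  \<open>\<tau> = 1\<close>, so the branches match.\<close>

lemma decay_mult_self: "decay \<epsilon> \<tau> * decay \<epsilon> \<tau> = decay (2 * \<epsilon>) \<tau>" if "0 \<le> \<tau>" "0 < \<epsilon>"
proof (cases "\<tau> \<le> 1")
  case True
  then have "\<tau> powr \<epsilon> \<le> \<tau> powr - \<epsilon>" "\<tau> powr (2 * \<epsilon>) \<le> \<tau> powr - (2 * \<epsilon>)"
    using that by (cases "\<tau> = 0"; auto intro!: powr_mono')+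
  then show ?thesis by (simp add: decay_def min_def powr_add[symmetric])
next
  case False
  then have "\<tau> powr - \<epsilon> \<le> \<tau> powr \<epsilon>" "\<tau> powr - (2 * \<epsilon>) \<le> \<tau> powr (2 * \<epsilon>)"
    using that by (auto intro!: powr_mono)
  then have "decay \<epsilon> \<tau> = \<tau> powr - \<epsilon>" "decay (2 * \<epsilon>) \<tau> = \<tau> powr - (2 * \<epsilon>)"
    by (auto simp: decay_def)
  then show ?thesis by (simp add: powr_add[symmetric])
qed

text \<open>After the selection one weight \<open>decay \<epsilon>\<close> remains in front of each
  modular. Divided by |x - y|^n it has integral at most \<open>Q\<close> in either variable,
  uniformly in \<open>j\<close>. The terms in \<open>x\<close> and in \<open>y\<close> thus
  contribute at most \<open>Q * K\<close> each, whence the factor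
  \<open>1 / (2 * Q * K)\<close>.\<close>

lemma dominated_seminorm:
  fixes F :: "nat \<Rightarrow> real^'n::finite \<Rightarrow> ennreal" and X :: "real^'n \<Rightarrow> real^'n \<Rightarrow> real"
  assumes P: "star_function P" and B: "dyadic_dominated CARD('n) \<sigma> B P"
    and F[measurable]: "\<And>j. F j \<in> borel_measurable borel"
    and T: "\<And>j x. P (F j x) \<le> ennreal ((2 ^ j) ^ CARD('n))"
    and K: "(\<Sum>j. \<integral>\<^sup>+x. P (F j x) \<partial>lborel) \<le> ennreal K" "1 \<le> K"
    and C: "0 < C" and \<epsilon>: "0 < \<epsilon>"
    and Q: "1 \<le> Q" "2 * (ball_vol TYPE('n) * 2 ^ CARD('n)) * geom_bound \<epsilon> \<le> Q"
    and X: "\<And>x y. 0 \<le> X x y"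
      "AE y in lborel. AE x in lborel. ennreal (X x y) \<le> ennreal C *
         (\<Sum>j. ennreal (decay (2 * \<epsilon>) (2 ^ j * norm (x - y))) * (ennreal ((2 ^ j) powr - \<sigma>) * (F j x
             + F j y)))"
  shows "(\<integral>\<^sup>+y. \<integral>\<^sup>+x. B (1 / (2 * Q * K) / (2 * (2 * C) * (2 * geom_bound \<epsilon>)) * X x y)
      / ennreal (norm (x - y) ^ CARD('n)) \<partial>lborel \<partial>lborel) \<le> 1"
proof -
  note [measurable] = star_function_measurable[OF P]
  let ?d = "\<lambda>j x y. ennreal (decay \<epsilon> (2 ^ j * norm (x - y :: real^'n)))"
  let ?N = "\<lambda>x y. ennreal (norm (x - y :: real^'n) ^ CARD('n))"
  let ?\<delta> = "1 / (2 * Q * K)"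
  let ?c = "?\<delta> / (2 * (2 * C) * (2 * geom_bound \<epsilon>))"
  have \<delta>: "0 \<le> ?\<delta>" "?\<delta> \<le> 1" using K(2) Q(1) mult_mono[of 1 Q 1 K] by (auto simp: divide_simps)
  have Pmax: "P (max a b) \<le> P a + P b" for a b by (simp add: max_def)
  have pt: "B (?c * X x y) \<le> ennreal ?\<delta> * (\<Sum>j. ?d j x y * P (F j x) + ?d j x y * P (F j y))"
    if x: "ennreal (X x y) \<le> ennreal C *
         (\<Sum>j. ennreal (decay (2 * \<epsilon>) (2 ^ j * norm (x - y))) * (ennreal ((2 ^ j) powr - \<sigma>) * (F j x
             + F j y)))" for x y
  proof -
    have "B (?c * X x y) \<le> ennreal ?\<delta> * (\<Sum>j. ?d j x y * P (max (F j x) (F j y)))"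
    proof (rule dominated_series[OF P B])
      have dd: "ennreal (decay (2 * \<epsilon>) (2 ^ j * norm (x - y))) = ?d j x y * ?d j x y" for j
        by (subst ennreal_mult[symmetric]) (simp_all add: decay_mult_self[OF _ \<epsilon>])
      \<comment> \<open>A maximum instead of a sum: \<open>P (max a b)\<close> is one of
        \<open>P a\<close>, \<open>P b\<close>, so the pointwise bound by \<open>2^(jn)\<close> is
        kept without any growth condition on \<open>P\<close>.\<close>
      have "F j x + F j y \<le> 2 * max (F j x) (F j y)" for j
        by (simp add: mult_2 add_mono)
      then have "ennreal C * (\<Sum>j. ennreal (decay (2 * \<epsilon>) (2 ^ j * norm (x - y)))
          * (ennreal ((2 ^ j) powr - \<sigma>) * (F j x + F j y)))
        \<le> ennreal C * (\<Sum>j. ennreal (decay (2 * \<epsilon>) (2 ^ j * norm (x - y))) * (ennreal ((2 ^ j) powr - \<sigma>)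
            * (2 * max (F j x) (F j y))))"
        by (intro mult_left_mono suminf_le) auto
      also have "\<dots> = ennreal C * (\<Sum>j. 2 * (?d j x y * (?d j x y * (ennreal ((2 ^ j) powr - \<sigma>)
          * max (F j x) (F j y)))))"
        unfolding dd by (simp only: ac_simps)
      also have "\<dots> = ennreal (2 * C) * (\<Sum>j. ?d j x y * (?d j x y * (ennreal ((2 ^ j) powr - \<sigma>)
          * max (F j x) (F j y))))"
        using C by (simp add: ennreal_suminf_cmult ennreal_mult ac_simps)
      finally show "ennreal (X x y) \<le> ennreal (2 * C) * (\<Sum>j. ?d j x y * (?d j x y
          * (ennreal ((2 ^ j) powr - \<sigma>) * max (F j x) (F j y))))"
        using x by (rule order_trans[rotated])
      show "(\<Sum>j. ?d j x y) \<le> ennreal (2 * geom_bound \<epsilon>)" by (intro decay_sum_le \<epsilon>) auto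
      show "?d j x y \<le> 1" for j using decay_le_1[OF \<epsilon>] by simp
      show "P (max (F j x) (F j y)) \<le> ennreal ((2 ^ j) ^ CARD('n))" for j
        using T[of j x] T[of j y] by (simp add: max_def)
    qed (use X(1) \<delta> C geom_bound_pos[OF \<epsilon>] in auto)
    also have "\<dots> \<le> ennreal ?\<delta> * (\<Sum>j. ?d j x y * P (F j x) + ?d j x y * P (F j y))"
      using Pmax by (intro mult_left_mono suminf_le) (auto simp: distrib_left[symmetric] mult_left_mono)
    finally show ?thesis .
  qed
  have dN: "?d j x y * t / ?N x y = ennreal (decay \<epsilon> (2 ^ j * norm (x - y)) / norm (x - y) ^ CARD('n)) * t"
    if "x \<noteq> y" for j x y t
    using that by (simp add: divide_ennreal[symmetric] ennreal_times_divide mult.commute)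
  let ?k = "\<lambda>j x y. ennreal (decay \<epsilon> (2 ^ j * norm (x - y)) / norm (x - y :: real^'n) ^ CARD('n))"
  have k: "(\<integral>\<^sup>+x. ?k j x y \<partial>lborel) \<le> ennreal Q" for j y
    by (rule order_trans[OF decay_integral_le[OF \<epsilon>]]) (use Q in \<open>auto intro: ennreal_leI\<close>)
  have k': "(\<integral>\<^sup>+y. ?k j x y \<partial>lborel) \<le> ennreal Q" for j x
    using k[of j x] by (simp add: norm_minus_commute)
  have "(\<integral>\<^sup>+y. \<integral>\<^sup>+x. B (?c * X x y) / ?N x y \<partial>lborel \<partial>lborel)
     \<le> (\<integral>\<^sup>+y. \<integral>\<^sup>+x. ennreal ?\<delta> * (\<Sum>j. ?k j x y * P (F j x) + ?k j x y * P (F j y)) \<partial>lborel \<partial>lborel)"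
  proof (intro nn_integral_mono_AE, use X(2) in eventually_elim, intro nn_integral_mono_AE)
    fix y assume "AE x in lborel. ennreal (X x y) \<le> ennreal C *
         (\<Sum>j. ennreal (decay (2 * \<epsilon>) (2 ^ j * norm (x - y))) * (ennreal ((2 ^ j) powr - \<sigma>) * (F j x
             + F j y)))"
    then show "AE x in lborel. B (?c * X x y) / ?N x y
        \<le> ennreal ?\<delta> * (\<Sum>j. ?k j x y * P (F j x) + ?k j x y * P (F j y))"
      using AE_lborel_singleton[of y]
    proof eventually_elim
      fix x assume a: "ennreal (X x y) \<le> ennreal C *
         (\<Sum>j. ennreal (decay (2 * \<epsilon>) (2 ^ j * norm (x - y))) * (ennreal ((2 ^ j) powr - \<sigma>) * (F j x
             + F j y)))"
        and xy: "x \<noteq> y"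
      have "B (?c * X x y) / ?N x y \<le> ennreal ?\<delta> * (\<Sum>j. ?d j x y * P (F j x) + ?d j x y * P (F j y)) / ?N x y"
        by (intro divide_right_mono_ennreal pt a)
      also have "\<dots> = ennreal ?\<delta> * (\<Sum>j. (?d j x y * P (F j x) + ?d j x y * P (F j y)) / ?N x y)"
        by (simp add: divide_ennreal_def ennreal_suminf_multc[symmetric] mult.assoc del: ennreal_suminf_multc)
      also have "\<dots> = ennreal ?\<delta> * (\<Sum>j. ?k j x y * P (F j x) + ?k j x y * P (F j y))"
        using xy by (simp add: add_divide_distrib_ennreal dN)
      finally show "B (?c * X x y) / ?N x y
        \<le> ennreal ?\<delta> * (\<Sum>j. ?k j x y * P (F j x) + ?k j x y * P (F j y))" .
    qed
  qed
  also have "\<dots> = ennreal ?\<delta> * (\<Sum>j. (\<integral>\<^sup>+y. \<integral>\<^sup>+x. ?k j x y * P (F j x) \<partial>lborel \<partial>lborel)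
      + (\<integral>\<^sup>+y. \<integral>\<^sup>+x. ?k j x y * P (F j y) \<partial>lborel \<partial>lborel))"
    by (simp add: nn_integral_cmult nn_integral_suminf nn_integral_add)
  also have "\<dots> \<le> ennreal ?\<delta> * (\<Sum>j. 2 * ennreal Q * (\<integral>\<^sup>+x. P (F j x) \<partial>lborel))"
  proof (intro mult_left_mono suminf_le)
    fix j
    have 1: "(\<integral>\<^sup>+y. \<integral>\<^sup>+x. ?k j x y * P (F j y) \<partial>lborel \<partial>lborel) \<le> ennreal Q * (\<integral>\<^sup>+x. P (F j x) \<partial>lborel)"
      using k by (subst nn_integral_cmult[symmetric], simp)
        (auto simp: nn_integral_multc intro!: nn_integral_mono mult_right_mono)
    have "(\<integral>\<^sup>+y. \<integral>\<^sup>+x. ?k j x y * P (F j x) \<partial>lborel \<partial>lborel) = (\<integral>\<^sup>+x. \<integral>\<^sup>+y. ?k j x y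
        * P (F j x) \<partial>lborel \<partial>lborel)"
      by (intro lborel_pair.Fubini') measurable
    also have "\<dots> \<le> ennreal Q * (\<integral>\<^sup>+x. P (F j x) \<partial>lborel)"
      using k' by (subst nn_integral_cmult[symmetric], simp)
        (auto simp: nn_integral_multc intro!: nn_integral_mono mult_right_mono)
    finally show "(\<integral>\<^sup>+y. \<integral>\<^sup>+x. ?k j x y * P (F j x) \<partial>lborel \<partial>lborel)
      + (\<integral>\<^sup>+y. \<integral>\<^sup>+x. ?k j x y * P (F j y) \<partial>lborel \<partial>lborel) \<le> 2 * ennreal Q * (\<integral>\<^sup>+x. P (F j x) \<partial>lborel)"
      using add_mono[OF _ 1] by (simp add: mult_2 distrib_right)
  qed auto
  also have "\<dots> \<le> ennreal ?\<delta> * (2 * ennreal Q * ennreal K)"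
    using K(1) by (simp add: mult_left_mono)
  also have "\<dots> = 1"
  proof -
    have "ennreal ?\<delta> * (2 * ennreal Q * ennreal K) = ennreal (?\<delta> * (2 * Q * K))"
      using Q K(2) \<delta> by (simp add: ennreal_mult del: times_divide_eq_left times_divide_eq_right)
    also have "?\<delta> * (2 * Q * K) = 1" using Q K(2) by simp
    finally show ?thesis by simp
  qed
  finally show ?thesis .
qed

section \<open>Mean oscillations at dyadic scales\<close>

text \<open>For balls whose centre is itself an integration variable, as in the applications of
  Fubini below.\<close>

lemma measurable_pred_cball [measurable (raw)]:
  fixes f g :: "'a \<Rightarrow> real^'n::finite"
  assumes [measurable]: "f \<in> borel_measurable M" "g \<in> borel_measurable M"
  shows "Measurable.pred M (\<lambda>x. g x \<in> cball (f x) r)"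
  unfolding mem_cball by measurable

lemma ennreal_mult_divide_shuffle:
  fixes b q D N :: real and F :: ennreal
  assumes "0 \<le> b" "0 \<le> q" "0 \<le> D" "0 < N"
  shows "ennreal (b * (q * D / N)) * F = ennreal (b * q) * (ennreal D * (F / ennreal N))"
proof -
  have "F / ennreal N = F * ennreal (1 / N)"
    using assms by (simp add: divide_ennreal_def inverse_ennreal inverse_eq_divide)
  moreover have "ennreal (b * (q * D / N)) = ennreal (b * q) * (ennreal D * ennreal (1 / N))"
    using assms by (simp add: ennreal_mult[symmetric])
  ultimately show ?thesis by (simp only: ac_simps)
qed

lemma measurable_indicator_cball [measurable (raw)]:
  fixes f g :: "'a \<Rightarrow> real^'n::finite"
  assumes [measurable]: "f \<in> borel_measurable M" "g \<in> borel_measurable M"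
  shows "(\<lambda>x. indicator (cball (f x) r) (g x) :: ennreal) \<in> borel_measurable M"
proof -
  have "(\<lambda>x. indicator (cball (f x) r) (g x) :: ennreal) = (\<lambda>x. if dist (f x) (g x) \<le> r then 1 else 0)"
    by (auto simp: fun_eq_iff indicator_def)
  then show ?thesis by simp
qed

text \<open>Left unnormalized, so that all powers of \<open>2^j\<close> are collected in
  \<open>scale_energy\<close>. In the application \<open>d z y\<close> is the Euclidean distance of
  the top order gradients at \<open>z\<close> and \<open>y\<close>.\<close>

definition osc :: "(real^'n::finite \<Rightarrow> real^'n \<Rightarrow> real) \<Rightarrow> real \<Rightarrow> real^'n \<Rightarrow> ennreal" where
  "osc d r x = (\<integral>\<^sup>+y\<in>cball x r. (\<integral>\<^sup>+z\<in>cball x r. ennreal (d z y) \<partial>lborel) \<partial>lborel)"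

lemma measurable_osc:
  assumes [measurable]: "case_prod d \<in> borel_measurable (borel \<Otimes>\<^sub>M borel)"
  shows "osc d r \<in> borel_measurable borel"
  unfolding osc_def by measurable

text \<open>On the ball \<open>norm (z - y) \<le> 2 * r\<close>, so \<open>d\<close> is at most
  \<open>(2 * r) powr \<theta>\<close> times the difference quotient. Jensen is then applied in
  \<open>z\<close> and in \<open>y\<close>, losing a factor 2 each time: hence
  \<open>4 * v^2\<close>.\<close>

lemma osc_jensen:
  fixes d :: "real^'n::finite \<Rightarrow> real^'n \<Rightarrow> real"
  assumes P: "star_function P"
    and d[measurable]: "case_prod d \<in> borel_measurable (borel \<Otimes>\<^sub>M borel)"
    and d0: "\<And>y. d y y = 0" "\<And>y z. 0 \<le> d y z"
    and \<theta>: "0 < \<theta>" and r: "0 < r"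
  defines "v \<equiv> ball_vol TYPE('n) * r ^ CARD('n)"
  shows "P (ennreal (1 / (4 * v^2 * (2 * r) powr \<theta>)) * osc d r x)
    \<le> ennreal (1 / v^2) * (\<integral>\<^sup>+y\<in>cball x r. (\<integral>\<^sup>+z\<in>cball x r. P (ennreal (d z y / norm (z - y) powr \<theta>))
        \<partial>lborel) \<partial>lborel)"
proof -
  note [measurable] = star_function_measurable[OF P]
  have v: "0 < v" "emeasure lborel (cball x r) = ennreal v"
    using r by (auto simp: v_def emeasure_cball_cart)
  let ?f = "\<lambda>y z. ennreal (d z y / norm (z - y) powr \<theta>)"
  let ?S = "cball x r"
  have le: "ennreal (1 / (4 * v^2 * (2 * r) powr \<theta>)) * osc d r x
      \<le> ennreal (1 / (2 * v)) * (\<integral>\<^sup>+y\<in>?S. ennreal (1 / (2 * v)) * (\<integral>\<^sup>+z\<in>?S. ?f y z \<partial>lborel) \<partial>lborel)"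
  proof -
    have "osc d r x \<le> (\<integral>\<^sup>+y\<in>?S. (\<integral>\<^sup>+z\<in>?S. ennreal ((2 * r) powr \<theta>) * ?f y z \<partial>lborel) \<partial>lborel)"
      unfolding osc_def
    proof (intro nn_integral_mono)
      fix y
      show "(\<integral>\<^sup>+z\<in>?S. ennreal (d z y) \<partial>lborel) * indicator ?S y
        \<le> (\<integral>\<^sup>+z\<in>?S. ennreal ((2 * r) powr \<theta>) * ?f y z \<partial>lborel) * indicator ?S y"
      proof (cases "y \<in> ?S")
        case True
        have "ennreal (d z y) \<le> ennreal ((2 * r) powr \<theta>) * ?f y z" if "z \<in> ?S" for z
        proof (cases "z = y")
          case False
          have "norm (z - y) \<le> 2 * r"
            using True that dist_triangle[of z y x] by (simp add: dist_norm[symmetric] dist_commute)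
          then have "norm (z - y) powr \<theta> \<le> (2 * r) powr \<theta>" using \<theta> by (intro powr_mono2) auto
          then have "d z y * 1 \<le> d z y * ((2 * r) powr \<theta> / norm (z - y) powr \<theta>)"
            using False d0 by (intro mult_left_mono) auto
          then show ?thesis using d0 by (simp add: ennreal_mult'[symmetric] mult.commute ennreal_leI)
        qed (use d0 in simp)
        then show ?thesis using True
          by (auto intro!: nn_integral_mono simp del: mem_cball split: split_indicator)
      qed simp
    qed
    also have "\<dots> = ennreal ((2 * r) powr \<theta>) * (\<integral>\<^sup>+y\<in>?S. (\<integral>\<^sup>+z\<in>?S. ?f y z \<partial>lborel) \<partial>lborel)"
      by (simp add: nn_integral_cmult mult.assoc)
    finally have "ennreal (1 / (4 * v^2 * (2 * r) powr \<theta>)) * osc d r x \<le> ennreal (1 / (4 * v^2 * (2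
        * r) powr \<theta>)) *
        (ennreal ((2 * r) powr \<theta>) * (\<integral>\<^sup>+y\<in>?S. (\<integral>\<^sup>+z\<in>?S. ?f y z \<partial>lborel) \<partial>lborel))"
      by (intro mult_left_mono) auto
    also have "\<dots> = ennreal (1 / (2 * v) * (1 / (2 * v))) * (\<integral>\<^sup>+y\<in>?S. (\<integral>\<^sup>+z\<in>?S. ?f y z \<partial>lborel) \<partial>lborel)"
      using v r by (simp add: mult.assoc[symmetric] ennreal_mult'[symmetric] power2_eq_square)
    also have "\<dots> = ennreal (1 / (2 * v)) * (\<integral>\<^sup>+y\<in>?S. ennreal (1 / (2 * v))
        * (\<integral>\<^sup>+z\<in>?S. ?f y z \<partial>lborel) \<partial>lborel)"
      using v by (subst ennreal_mult) (simp_all add: nn_integral_cmult mult.assoc)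
    finally show ?thesis .
  qed
  have "P (ennreal (1 / (4 * v^2 * (2 * r) powr \<theta>)) * osc d r x)
    \<le> P (ennreal (1 / (2 * v)) * (\<integral>\<^sup>+y\<in>?S. ennreal (1 / (2 * v)) * (\<integral>\<^sup>+z\<in>?S. ?f y z \<partial>lborel) \<partial>lborel))"
    using le by (rule monoD[OF star_functionD(1)[OF P]])
  also have "\<dots> \<le> ennreal (1 / v) * (\<integral>\<^sup>+y\<in>?S. P (ennreal (1 / (2 * v)) * (\<integral>\<^sup>+z\<in>?S. ?f y z \<partial>lborel)) \<partial>lborel)"
    by (rule star_function_jensen[OF P]) (use v in auto)
  also have "\<dots> \<le> ennreal (1 / v) * (\<integral>\<^sup>+y\<in>?S. ennreal (1 / v) * (\<integral>\<^sup>+z\<in>?S. P (?f y z) \<partial>lborel) \<partial>lborel)"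
    by (intro mult_left_mono nn_integral_mono mult_right_mono star_function_jensen[OF P]) (use v in auto)
  also have "\<dots> = ennreal (1 / v^2) * (\<integral>\<^sup>+y\<in>?S. (\<integral>\<^sup>+z\<in>?S. P (?f y z) \<partial>lborel) \<partial>lborel)"
  proof -
    have "ennreal (1 / v^2) = ennreal (1 / v) * ennreal (1 / v)"
      using v by (subst ennreal_mult[symmetric]) (auto simp: power2_eq_square)
    then show ?thesis by (simp add: nn_integral_cmult mult.assoc)
  qed
  finally show ?thesis .
qed

text \<open>Inside the ball the factor (2r / |z - y|)^n is at least 1 and may be inserted. After
  division by the squared volume, of order r^(2n), a multiple of r^-n remains, which for
  \<open>r = R / 2^j\<close> is the pointwise bound of order \<open>2^(jn)\<close>.\<close>

lemma scaled_energy_le: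
  fixes f :: "real^'n::finite \<Rightarrow> real^'n \<Rightarrow> ennreal"
  assumes [measurable]: "case_prod f \<in> borel_measurable (borel \<Otimes>\<^sub>M borel)"
    and f0: "\<And>y. f y y = 0" and r: "0 < r"
    and I: "(\<integral>\<^sup>+y. \<integral>\<^sup>+z. f y z / ennreal (norm (z - y) ^ CARD('n)) \<partial>lborel \<partial>lborel) \<le> 1"
  shows "(\<integral>\<^sup>+y\<in>cball x r. (\<integral>\<^sup>+z\<in>cball x r. f y z \<partial>lborel) \<partial>lborel) \<le> ennreal ((2 * r) ^ CARD('n))"
proof -
  let ?N = "\<lambda>y z. ennreal (norm (z - y :: real^'n) ^ CARD('n))"
  have "(\<integral>\<^sup>+y\<in>cball x r. (\<integral>\<^sup>+z\<in>cball x r. f y z \<partial>lborel) \<partial>lborel)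
     \<le> (\<integral>\<^sup>+y. (\<integral>\<^sup>+z. ennreal ((2 * r) ^ CARD('n)) * (f y z / ?N y z) \<partial>lborel) \<partial>lborel)"
  proof (intro nn_integral_mono)
    fix y
    show "(\<integral>\<^sup>+z\<in>cball x r. f y z \<partial>lborel) * indicator (cball x r) y
      \<le> (\<integral>\<^sup>+z. ennreal ((2 * r) ^ CARD('n)) * (f y z / ?N y z) \<partial>lborel)"
    proof (cases "y \<in> cball x r")
      case True
      have "f y z \<le> ennreal ((2 * r) ^ CARD('n)) * (f y z / ?N y z)" if "z \<in> cball x r" for z
      proof (cases "z = y")
        case False
        have "norm (z - y) \<le> 2 * r"
          using True that dist_triangle[of z y x] by (simp add: dist_norm[symmetric] dist_commute)
        then have "norm (z - y) ^ CARD('n) \<le> (2 * r) ^ CARD('n)" by (intro power_mono) auto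
        then have N: "?N y z \<le> ennreal ((2 * r) ^ CARD('n))" "?N y z \<noteq> 0"
          using False by (auto simp del: power_mult_distrib intro!: ennreal_leI)
        have "f y z = ?N y z * (f y z / ?N y z)"
          using N(2) by (simp add: ennreal_times_divide ennreal_mult_divide_eq mult.commute)
        also have "\<dots> \<le> ennreal ((2 * r) ^ CARD('n)) * (f y z / ?N y z)"
          using N by (intro mult_right_mono) auto
        finally show ?thesis .
      qed (simp add: f0)
      then show ?thesis using True by (auto intro!: nn_integral_mono simp: indicator_def)
    qed simp
  qed
  also have "\<dots> = ennreal ((2 * r) ^ CARD('n)) * (\<integral>\<^sup>+y. (\<integral>\<^sup>+z. f y z / ?N y z \<partial>lborel) \<partial>lborel)"
    by (simp add: nn_integral_cmult)
  also have "\<dots> \<le> ennreal ((2 * r) ^ CARD('n)) * 1"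
    by (intro mult_left_mono I) auto
  finally show ?thesis by simp
qed

text \<open>The cut-off at \<open>2 * R\<close> makes the power summable over scales:
  \<open>(2 * R) ^ (2 * n)\<close> dominates both 1 and \<open>\<tau> ^ (2 * n)\<close>, one for
  each branch of \<open>decay\<close>.\<close>

lemma truncated_power_le_decay:
  assumes "1 \<le> R" "0 \<le> \<tau>" "\<tau> \<le> 2 * R" "0 < n"
  shows "\<tau> ^ n \<le> (2 * R) ^ (2 * n) * decay (real n) \<tau>"
proof (cases "\<tau> = 0")
  case False
  then have t: "\<tau> > 0" using assms by simp
  have d: "decay (real n) \<tau> = min (\<tau> ^ n) (1 / \<tau> ^ n)"
    using t by (simp add: decay_def powr_minus_divide powr_realpow)
  have R1: "1 \<le> (2 * R) ^ (2 * n)" using assms by (intro one_le_power) auto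
  have "\<tau> ^ n \<le> (2 * R) ^ (2 * n) * \<tau> ^ n"
    using mult_right_mono[OF R1, of "\<tau> ^ n"] t by simp
  moreover have "\<tau> ^ (2 * n) \<le> (2 * R) ^ (2 * n)" using assms by (intro power_mono) auto
  then have "\<tau> ^ n * \<tau> ^ n \<le> (2 * R) ^ (2 * n)" by (simp only: mult_2 power_add)
  then have "\<tau> ^ n \<le> (2 * R) ^ (2 * n) * (1 / \<tau> ^ n)"
    using t by (simp only: mult_1_right times_divide_eq_right pos_le_divide_eq zero_less_power)
  ultimately show ?thesis unfolding d by (simp add: min_def)
qed (use assms in \<open>simp add: power_0_left\<close>)

text \<open>By Fubini the centre \<open>x\<close> is integrated first. Centres whose ball contains
  both \<open>y\<close> and \<open>z\<close> exist only for |z - y| \<le> 2R / 2^j, and their volume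
  is at most that of one ball. Up to constants this leaves (2^j |z - y|)^n / |z - y|^n with a
  cut-off, and the numerators sum over \<open>j\<close> to a constant.\<close>

lemma scaled_energy_sum:
  fixes f :: "real^'n::finite \<Rightarrow> real^'n \<Rightarrow> ennreal"
  assumes f[measurable]: "case_prod f \<in> borel_measurable (borel \<Otimes>\<^sub>M borel)"
    and f0: "\<And>y. f y y = 0" and R: "1 \<le> R"
    and I: "(\<integral>\<^sup>+y. \<integral>\<^sup>+z. f y z / ennreal (norm (z - y) ^ CARD('n)) \<partial>lborel \<partial>lborel) \<le> 1"
  shows "(\<Sum>j. \<integral>\<^sup>+x. ennreal (((2 ^ j) ^ CARD('n))^2) *
      (\<integral>\<^sup>+y\<in>cball x (R / 2 ^ j). (\<integral>\<^sup>+z\<in>cball x (R / 2 ^ j). f y z \<partial>lborel) \<partial>lborel) \<partial>lborel)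
    \<le> ennreal (ball_vol TYPE('n) * R ^ CARD('n) * (2 * R) ^ (2 * CARD('n)) * (2
        * geom_bound (real CARD('n))))"
proof -
  let ?n = "CARD('n)"
  let ?b = "ball_vol TYPE('n) * R ^ CARD('n)"
  let ?N = "\<lambda>y z. norm (z - y :: real^'n) ^ ?n"
  let ?D = "\<lambda>j y z. decay (real ?n) (2 ^ j * norm (z - y :: real^'n))"
  have each: "(\<integral>\<^sup>+x. ennreal (((2 ^ j) ^ ?n)^2) *
      (\<integral>\<^sup>+y\<in>cball x (R / 2 ^ j). (\<integral>\<^sup>+z\<in>cball x (R / 2 ^ j). f y z \<partial>lborel) \<partial>lborel) \<partial>lborel)
    \<le> (\<integral>\<^sup>+y. \<integral>\<^sup>+z. ennreal (?b * (2 * R) ^ (2 * ?n)) * (ennreal (?D j y z)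
        * (f y z / ennreal (?N y z))) \<partial>lborel \<partial>lborel)" for j
  proof -
    let ?r = "R / 2 ^ j"
    let ?q = "ennreal (((2 ^ j) ^ ?n)^2)"
    let ?g = "\<lambda>x y z. ?q * (f y z * indicator (cball x ?r) z * indicator (cball x ?r) y)"
    have "(\<integral>\<^sup>+x. ?q * (\<integral>\<^sup>+y\<in>cball x ?r. (\<integral>\<^sup>+z\<in>cball x ?r. f y z \<partial>lborel) \<partial>lborel) \<partial>lborel)
        = (\<integral>\<^sup>+x. \<integral>\<^sup>+y. \<integral>\<^sup>+z. ?g x y z \<partial>lborel \<partial>lborel \<partial>lborel)"
      by (simp add: nn_integral_cmult nn_integral_multc)
    also have "\<dots> = (\<integral>\<^sup>+y. \<integral>\<^sup>+x. \<integral>\<^sup>+z. ?g x y z \<partial>lborel \<partial>lborel \<partial>lborel)"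
      by (intro lborel_pair.Fubini') measurable
    also have "\<dots> = (\<integral>\<^sup>+y. \<integral>\<^sup>+z. \<integral>\<^sup>+x. ?g x y z \<partial>lborel \<partial>lborel \<partial>lborel)"
      by (intro nn_integral_cong lborel_pair.Fubini') measurable
    also have "\<dots> \<le> (\<integral>\<^sup>+y. \<integral>\<^sup>+z. ennreal (?b * (2 * R) ^ (2 * ?n)) * (ennreal (?D j y z)
        * (f y z / ennreal (?N y z))) \<partial>lborel \<partial>lborel)"
    proof (intro nn_integral_mono)
      fix y z :: "real^'n"
      let ?h = "norm (z - y)"
      have "(\<integral>\<^sup>+x. ?g x y z \<partial>lborel) = ?q * f y z * (\<integral>\<^sup>+x. indicator (cball x ?r) z
          * indicator (cball x ?r) y \<partial>lborel)"
        by (simp add: nn_integral_cmult mult.assoc)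
      also have "\<dots> \<le> ennreal (?b * (2 * R) ^ (2 * ?n)) * (ennreal (?D j y z) * (f y z / ennreal (?N y z)))"
      proof (cases "z = y")
        case False
        then have h: "?h > 0" by simp
        show ?thesis
        proof (cases "?h \<le> 2 * ?r")
          case True
          have "(\<integral>\<^sup>+x. indicator (cball x ?r) z * indicator (cball x ?r) y \<partial>lborel)
              \<le> (\<integral>\<^sup>+x. indicator (cball y ?r) x \<partial>lborel)"
            by (intro nn_integral_mono) (auto simp: indicator_def dist_commute)
          also have "\<dots> = ennreal (?b / (2 ^ j) ^ ?n)"
            using R by (simp add: emeasure_cball_cart power_divide)
          finally have "?q * f y z * (\<integral>\<^sup>+x. indicator (cball x ?r) z * indicator (cball x ?r) y \<partial>lborel)
              \<le> ?q * f y z * ennreal (?b / (2 ^ j) ^ ?n)"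
            by (intro mult_left_mono) auto
          also have "\<dots> = ennreal (((2 ^ j) ^ ?n)^2 * (?b / (2 ^ j) ^ ?n)) * f y z"
            by (subst ennreal_mult) (use R in \<open>auto simp: ac_simps\<close>)
          also have "((2 ^ j) ^ ?n)^2 * (?b / (2 ^ j) ^ ?n) = ?b * ((2 ^ j * ?h) ^ ?n / ?N y z)"
            using h by (simp add: power2_eq_square power_mult_distrib)
          also have "ennreal (?b * ((2 ^ j * ?h) ^ ?n / ?N y z)) * f y z
             \<le> ennreal (?b * ((2 * R) ^ (2 * ?n) * ?D j y z / ?N y z)) * f y z"
            using True h R by (intro mult_right_mono ennreal_leI mult_left_mono divide_right_mono
                truncated_power_le_decay) (auto simp: field_simps)
          also have "\<dots> = ennreal (?b * (2 * R) ^ (2 * ?n)) * (ennreal (?D j y z)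
              * (f y z / ennreal (?N y z)))"
            using h R by (intro ennreal_mult_divide_shuffle) auto
          finally show ?thesis .
        next
          case far: False
          have "indicator (cball x ?r) z * indicator (cball x ?r) y = (0::ennreal)" for x
            using far dist_triangle[of z y x] by (auto simp: indicator_def dist_norm dist_commute
                norm_minus_commute)
          then have "(\<integral>\<^sup>+x. indicator (cball x ?r) z * indicator (cball x ?r) y \<partial>lborel) = 0"
            by (simp only: nn_integral_const mult_zero_left)
          then show ?thesis by simp
        qed
      qed (simp add: f0)
      finally show "(\<integral>\<^sup>+x. ?g x y z \<partial>lborel) \<le> ennreal (?b * (2 * R) ^ (2 * ?n)) * (ennreal (?D j y z)
          * (f y z / ennreal (?N y z)))" .
    qed
    finally show ?thesis .
  qed
  have "(\<Sum>j. \<integral>\<^sup>+x. ennreal (((2 ^ j) ^ ?n)^2) *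
      (\<integral>\<^sup>+y\<in>cball x (R / 2 ^ j). (\<integral>\<^sup>+z\<in>cball x (R / 2 ^ j). f y z \<partial>lborel) \<partial>lborel) \<partial>lborel)
    \<le> (\<Sum>j. \<integral>\<^sup>+y. \<integral>\<^sup>+z. ennreal (?b * (2 * R) ^ (2 * ?n)) * (ennreal (?D j y z)
        * (f y z / ennreal (?N y z))) \<partial>lborel \<partial>lborel)"
    by (intro suminf_le each) auto
  also have "\<dots> = ennreal (?b * (2 * R) ^ (2 * ?n)) * (\<integral>\<^sup>+y. \<integral>\<^sup>+z. (\<Sum>j. ennreal (?D j y z))
      * (f y z / ennreal (?N y z)) \<partial>lborel \<partial>lborel)"
    by (simp add: nn_integral_suminf[symmetric] nn_integral_cmult)
  also have "\<dots> \<le> ennreal (?b * (2 * R) ^ (2 * ?n)) * (\<integral>\<^sup>+y. \<integral>\<^sup>+z. ennreal (2 * geom_bound (real ?n))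
      * (f y z / ennreal (?N y z)) \<partial>lborel \<partial>lborel)"
    by (intro mult_left_mono nn_integral_mono mult_right_mono decay_sum_le) auto
  also have "\<dots> = ennreal (?b * (2 * R) ^ (2 * ?n)) * (ennreal (2 * geom_bound (real ?n))
      * (\<integral>\<^sup>+y. \<integral>\<^sup>+z. f y z / ennreal (?N y z) \<partial>lborel \<partial>lborel))"
    by (simp add: nn_integral_cmult)
  also have "\<dots> \<le> ennreal (?b * (2 * R) ^ (2 * ?n)) * (ennreal (2 * geom_bound (real ?n)) * 1)"
    by (intro mult_left_mono I) auto
  also have "\<dots> = ennreal (?b * (2 * R) ^ (2 * ?n) * (2 * geom_bound (real ?n)))"
    unfolding mult_1_right using R geom_bound_pos[of "real ?n"]
    by (intro ennreal_mult[symmetric]) (auto simp: less_imp_le)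
  finally show ?thesis .
qed

text \<open>The quantity that controls both a Littlewood-Paley piece at scale \<open>2\<^sup>-\<^sup>j\<close> (through the oscillation of
  the top order derivatives) and, for \<open>j = 0\<close>, the low frequencies.\<close>

definition scale_energy ::
  "real \<Rightarrow> real \<Rightarrow> (real^'n::finite \<Rightarrow> real^'n \<Rightarrow> real) \<Rightarrow> (real^'n \<Rightarrow> real) \<Rightarrow> nat \<Rightarrow> real^'n \<Rightarrow> ennreal" where
  "scale_energy \<theta> R d D j x =
     ennreal ((2 ^ j) powr \<theta> * ((2 ^ j) ^ CARD('n))^2) * osc d (R / 2 ^ j) x
       + (if j = 0 then \<integral>\<^sup>+y\<in>cball x R. ennreal (D y) \<partial>lborel else 0)"

lemma measurable_scale_energy:
  assumes [measurable]: "case_prod d \<in> borel_measurable (borel \<Otimes>\<^sub>M borel)" "D \<in> borel_measurable borel"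
  shows "scale_energy \<theta> R d D j \<in> borel_measurable borel"
  using measurable_osc[OF assms(1)] unfolding scale_energy_def by measurable

text \<open>\<open>d\<close> stands for the increments of the top order gradient and
  \<open>D\<close> for the length of the gradient of the order under estimate, both already divided
  by an upper bound of the norm.\<close>

definition unit_energy ::
  "(ennreal \<Rightarrow> ennreal) \<Rightarrow> real \<Rightarrow> (real^'n::finite \<Rightarrow> real^'n \<Rightarrow> real) \<Rightarrow> (real^'n \<Rightarrow> real) \<Rightarrow> bool" where
  "unit_energy P \<theta> d D \<longleftrightarrow> star_function P \<and> case_prod d \<in> borel_measurable (borel \<Otimes>\<^sub>M borel) \<and>
     D \<in> borel_measurable borel \<and> (\<forall>y. d y y = 0) \<and> (\<forall>y z. 0 \<le> d y z) \<and>
     (\<integral>\<^sup>+y. \<integral>\<^sup>+z. P (ennreal (d z y / norm (z - y) powr \<theta>)) / ennreal (norm (z - y) ^ CARD('n)) \<partial>lborel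
         \<partial>lborel) \<le> 1 \<and>
     (\<integral>\<^sup>+y. P (ennreal (D y)) \<partial>lborel) \<le> 1"

text \<open>The order of quantifiers matters: \<open>c\<close> and \<open>K\<close> are fixed before
  \<open>P\<close>, \<open>d\<close> and \<open>D\<close>, so they depend on the dimension,
  \<open>\<theta>\<close> and \<open>R\<close> alone.\<close>

lemma scale_energy_bounds:
  assumes \<theta>: "0 < \<theta>" and R: "1 \<le> R"
  obtains c K where "0 < c" "1 \<le> K"
    "\<And>P (d :: real^'n::finite \<Rightarrow> real^'n \<Rightarrow> real) D j x.
      unit_energy P \<theta> d D \<Longrightarrow>
      P (ennreal c * scale_energy \<theta> R d D j x) \<le> ennreal ((2 ^ j) ^ CARD('n)) \<and>
      (\<Sum>j. \<integral>\<^sup>+x. P (ennreal c * scale_energy \<theta> R d D j x) \<partial>lborel) \<le> ennreal K"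
proof -
  let ?n = "CARD('n)"
  define v where "v = ball_vol TYPE('n) * R ^ ?n"
  have v: "0 < v" using R by (simp add: v_def)
  \<comment> \<open>\<open>c1\<close> is the constant of \<open>osc_jensen\<close> at radius
    \<open>R\<close>, and \<open>1 / (2 * v)\<close> that of Jensen's inequality on one ball;
    \<open>c0\<close> serves both. \<open>C2\<close> bounds the two contributions pointwise relative
    to \<open>2^(jn)\<close>, and \<open>C3\<close> bounds the sum of the oscillation parts. The
    extra \<open>1 / 2\<close> in \<open>c\<close> replaces a sum of two terms by their
    maximum.\<close>
  define c1 where "c1 = 1 / (4 * v^2 * (2 * R) powr \<theta>)"
  have c1: "0 < c1" using v R by (simp add: c1_def)
  define c0 where "c0 = min c1 (1 / (2 * v))"
  have c0: "0 < c0" "c0 \<le> c1" "c0 \<le> 1 / (2 * v)" using c1 v by (auto simp: c0_def)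
  define C2 where "C2 = max 1 ((2 * R) ^ ?n / v^2 + 1 / v)"
  have C2: "1 \<le> C2" by (simp add: C2_def)
  define C3 where "C3 = v * (2 * R) ^ (2 * ?n) * (2 * geom_bound (real ?n)) / v^2"
  have C3: "0 \<le> C3" using v R geom_bound_pos[of "real ?n"] by (auto simp: C3_def less_imp_le)
  define c where "c = 1 / C2 * (c0 / 2)"
  have c: "0 < c" using c0 C2 by (simp add: c_def)
  show thesis
  proof (rule that[of c "C3 + 1"])
    fix P and d :: "real^'n \<Rightarrow> real^'n \<Rightarrow> real" and D :: "real^'n \<Rightarrow> real" and j :: nat and x :: "real^'n"
    assume "unit_energy P \<theta> d D"
    then have P: "star_function P" and d[measurable]: "case_prod d \<in> borel_measurable (borel \<Otimes>\<^sub>M borel)"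
      and D[measurable]: "D \<in> borel_measurable borel" and d0: "\<And>y. d y y = 0" "\<And>y z. 0 \<le> d y z"
      and I: "(\<integral>\<^sup>+y. \<integral>\<^sup>+z. P (ennreal (d z y / norm (z - y) powr \<theta>)) / ennreal (norm (z - y) ^ ?n) \<partial>lborel
          \<partial>lborel) \<le> 1"
      and ID: "(\<integral>\<^sup>+y. P (ennreal (D y)) \<partial>lborel) \<le> 1"
      by (simp_all add: unit_energy_def)
    note [measurable] = star_function_measurable[OF P]
    let ?f = "\<lambda>y z. P (ennreal (d z y / norm (z - y) powr \<theta>))"
    let ?J = "\<lambda>j x. \<integral>\<^sup>+y\<in>cball x (R / 2 ^ j). (\<integral>\<^sup>+z\<in>cball x (R / 2 ^ j). ?f y z \<partial>lborel) \<partial>lborel"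
    define G where "G j x = ennreal (1 / v^2) * (ennreal (((2 ^ j) ^ ?n)^2) * ?J j x)" for j x
    define H where "H j x = (if j = (0::nat) then ennreal (1 / v)
        * (\<integral>\<^sup>+y\<in>cball x R. P (ennreal (D y)) \<partial>lborel) else 0)" for j x
    have [measurable]: "G j \<in> borel_measurable borel" "H j \<in> borel_measurable borel" for j
      unfolding G_def H_def by measurable
    have f0: "?f y y = 0" for y using d0 star_functionD(2)[OF P] by simp
    have Ple: "P (ennreal c * scale_energy \<theta> R d D j x) \<le> ennreal (1 / C2) * (G j x + H j x)" for j x
    proof -
      let ?E = "ennreal ((2 ^ j) powr \<theta> * ((2 ^ j) ^ ?n)^2) * osc d (R / 2 ^ j) x"
      let ?M = "if j = 0 then \<integral>\<^sup>+y\<in>cball x R. ennreal (D y) \<partial>lborel else 0"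
      have 1: "P (ennreal c1 * ?E) \<le> G j x"
      proof -
        let ?vj = "ball_vol TYPE('n) * (R / 2 ^ j) ^ ?n"
        have vj: "?vj = v / (2 ^ j) ^ ?n" by (simp add: v_def power_divide)
        \<comment> \<open>Passing from radius \<open>R\<close> to \<open>R / 2^j\<close> produces
          exactly the prefactor of the oscillation in \<open>scale_energy\<close>.\<close>
        have "1 / (4 * ?vj^2 * (2 * (R / 2 ^ j)) powr \<theta>) = c1 * ((2 ^ j) powr \<theta> * ((2 ^ j) ^ ?n)^2)"
        proof -
          have p: "(2 * (R / 2 ^ j)) powr \<theta> = (2 * R) powr \<theta> / (2 ^ j) powr \<theta>"
            using R by (simp add: powr_divide)
          have "1 / (4 * (v / k)^2 * (a / b)) = 1 / (4 * v^2 * a) * (b * k^2)"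
            if "0 < k" "0 < a" "0 < b" for k a b :: real
            using that v by (simp add: power_divide)
          from this[of "(2 ^ j) ^ ?n" "(2 * R) powr \<theta>" "(2 ^ j) powr \<theta>"] show ?thesis
            unfolding vj c1_def p using R by simp
        qed
        then have "ennreal (1 / (4 * ?vj^2 * (2 * (R / 2 ^ j)) powr \<theta>)) * osc d (R / 2 ^ j) x = ennreal c1
            * ?E"
          using c1 by (simp add: ennreal_mult' mult.assoc)
        moreover have "ennreal (1 / ?vj^2) = ennreal (1 / v^2) * ennreal (((2 ^ j) ^ ?n)^2)"
          unfolding vj using v by (subst ennreal_mult[symmetric]) (auto simp: power_divide)
        ultimately show ?thesis
          using osc_jensen[OF P d d0 \<theta>, of "R / 2 ^ j" x] R by (simp add: G_def mult.assoc)
      qed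
      have 2: "P (ennreal (1 / (2 * v)) * ?M) \<le> H j x"
        using star_function_jensen[OF P, of "\<lambda>y. ennreal (D y)" lborel "cball x R" v] v R
            star_functionD(2)[OF P]
        by (auto simp: H_def emeasure_cball_cart v_def)
      have "scale_energy \<theta> R d D j x = ?E + ?M" by (simp add: scale_energy_def)
      also have "\<dots> \<le> 2 * max ?E ?M" by (simp add: mult_2 add_mono)
      finally have "ennreal (c0 / 2) * scale_energy \<theta> R d D j x \<le> ennreal (c0 / 2) * (2 * max ?E ?M)"
        by (intro mult_left_mono) auto
      also have "\<dots> = ennreal c0 * max ?E ?M"
      proof -
        have "ennreal (c0 / 2) * 2 = ennreal c0"
        proof -
          have "ennreal (c0 / 2) * ennreal 2 = ennreal (c0 / 2 * 2)" using c0
              by (intro ennreal_mult[symmetric]) auto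
          then show ?thesis by simp
        qed
        then show ?thesis by (simp add: mult.assoc[symmetric])
      qed
      finally have "P (ennreal (c0 / 2) * scale_energy \<theta> R d D j x) \<le> P (ennreal c0 * max ?E ?M)"
        by (rule monoD[OF star_functionD(1)[OF P]])
      also have "\<dots> \<le> P (ennreal c0 * ?E) + P (ennreal c0 * ?M)" by (simp add: max_def)
      also have "\<dots> \<le> P (ennreal c1 * ?E) + P (ennreal (1 / (2 * v)) * ?M)"
        using c0 by (intro add_mono monoD[OF star_functionD(1)[OF P]] mult_right_mono ennreal_leI) auto
      also have "\<dots> \<le> G j x + H j x" by (intro add_mono 1 2)
      finally have *: "P (ennreal (c0 / 2) * scale_energy \<theta> R d D j x) \<le> G j x + H j x" .
      have "ennreal c * scale_energy \<theta> R d D j x = ennreal (1 / C2) * (ennreal (c0 / 2)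
          * scale_energy \<theta> R d D j x)"
        unfolding c_def using c0 C2 by (subst ennreal_mult) (auto simp: mult.assoc)
      then have "P (ennreal c * scale_energy \<theta> R d D j x) \<le> ennreal (1 / C2) * P (ennreal (c0 / 2)
          * scale_energy \<theta> R d D j x)"
        using star_functionD(3)[OF P, of "ennreal (1 / C2)"] C2 by simp
      also have "\<dots> \<le> ennreal (1 / C2) * (G j x + H j x)" by (intro mult_left_mono *) auto
      finally show ?thesis .
    qed
    have Gle: "G j x \<le> ennreal ((2 * R) ^ ?n / v^2 * (2 ^ j) ^ ?n)" for j x
    proof -
      have "?J j x \<le> ennreal ((2 * (R / 2 ^ j)) ^ ?n)"
        by (rule scaled_energy_le) (use R I f0 in auto)
      then have "G j x \<le> ennreal (1 / v^2) * (ennreal (((2 ^ j) ^ ?n)^2) * ennreal ((2 * (R / 2 ^ j)) ^ ?n))"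
        unfolding G_def by (intro mult_left_mono) auto
      also have "\<dots> = ennreal (1 / v^2 * (((2 ^ j) ^ ?n)^2 * (2 * (R / 2 ^ j)) ^ ?n))"
        using R by (subst ennreal_mult, simp, simp, subst ennreal_mult) auto
      also have "1 / v^2 * (((2 ^ j) ^ ?n)^2 * (2 * (R / 2 ^ j)) ^ ?n) = (2 * R) ^ ?n / v^2 * (2 ^ j) ^ ?n"
        by (simp add: power_divide power2_eq_square)
      finally show ?thesis .
    qed
    have Hle: "H j x \<le> ennreal (1 / v * (2 ^ j) ^ ?n)" for j x
    proof (cases "j = 0")
      case True
      have "(\<integral>\<^sup>+y\<in>cball x R. P (ennreal (D y)) \<partial>lborel) \<le> (\<integral>\<^sup>+y. P (ennreal (D y)) \<partial>lborel)"
        by (intro nn_integral_mono) (auto simp: indicator_def)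
      also note ID
      finally show ?thesis using True mult_left_mono[of _ 1 "ennreal (1 / v)"] by (simp add: H_def)
    qed (simp add: H_def)
    have bound: "P (ennreal c * scale_energy \<theta> R d D j x) \<le> ennreal ((2 ^ j) ^ ?n)"
    proof -
      have "G j x + H j x \<le> ennreal ((2 * R) ^ ?n / v^2 * (2 ^ j) ^ ?n) + ennreal (1 / v * (2 ^ j) ^ ?n)"
        by (intro add_mono Gle Hle)
      also have "\<dots> = ennreal (((2 * R) ^ ?n / v^2 + 1 / v) * (2 ^ j) ^ ?n)"
        using R v unfolding distrib_right by (intro ennreal_plus[symmetric]) auto
      also have "\<dots> \<le> ennreal (C2 * (2 ^ j) ^ ?n)"
        by (intro ennreal_leI mult_right_mono) (auto simp: C2_def)
      finally have "ennreal (1 / C2) * (G j x + H j x) \<le> ennreal (1 / C2) * ennreal (C2 * (2 ^ j) ^ ?n)"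
        by (intro mult_left_mono) auto
      also have "\<dots> = ennreal ((2 ^ j) ^ ?n)"
        using C2 by (subst ennreal_mult[symmetric]) auto
      finally show ?thesis using Ple order_trans by blast
    qed
    have "(\<Sum>j. \<integral>\<^sup>+x. P (ennreal c * scale_energy \<theta> R d D j x) \<partial>lborel) \<le> (\<Sum>j. \<integral>\<^sup>+x. G j x + H j x \<partial>lborel)"
    proof (intro suminf_le nn_integral_mono)
      fix j x
      have "ennreal (1 / C2) * (G j x + H j x) \<le> G j x + H j x"
        using C2 by (intro ennreal_mult_le_one_mono) simp
      then show "P (ennreal c * scale_energy \<theta> R d D j x) \<le> G j x + H j x"
        using Ple order_trans by blast
    qed auto
    also have "\<dots> = (\<Sum>j. \<integral>\<^sup>+x. G j x \<partial>lborel) + (\<Sum>j. \<integral>\<^sup>+x. H j x \<partial>lborel)"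
      by (simp add: nn_integral_add suminf_add[symmetric])
    also have "(\<Sum>j. \<integral>\<^sup>+x. G j x \<partial>lborel)
        = ennreal (1 / v^2) * (\<Sum>j. \<integral>\<^sup>+x. ennreal (((2 ^ j) ^ ?n)^2) * ?J j x \<partial>lborel)"
      unfolding G_def by (simp add: nn_integral_cmult)
    also have "\<dots> \<le> ennreal (1 / v^2) * ennreal (v * (2 * R) ^ (2 * ?n) * (2 * geom_bound (real ?n)))"
      unfolding v_def using I R f0 by (intro mult_left_mono scaled_energy_sum) auto
    also have "\<dots> = ennreal C3"
      using v R geom_bound_pos[of "real ?n"] unfolding C3_def
          by (subst ennreal_mult[symmetric]) (auto simp: less_imp_le)
    also have "(\<Sum>j. \<integral>\<^sup>+x. H j x \<partial>lborel) = (\<integral>\<^sup>+x. H 0 x \<partial>lborel)"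
    proof -
      have "(\<Sum>j. \<integral>\<^sup>+x. H j x \<partial>lborel) = (\<Sum>j\<in>{0}. \<integral>\<^sup>+x. H j x \<partial>lborel)"
        by (rule suminf_finite) (auto simp: H_def)
      then show ?thesis by simp
    qed
    also have "(\<integral>\<^sup>+x. H 0 x \<partial>lborel) \<le> 1"
    proof -
      have "(\<integral>\<^sup>+x. H 0 x \<partial>lborel) = ennreal (1 / v) * (\<integral>\<^sup>+x. \<integral>\<^sup>+y. P (ennreal (D y))
          * indicator (cball x R) y \<partial>lborel \<partial>lborel)"
        unfolding H_def by (simp add: nn_integral_cmult)
      also have "(\<integral>\<^sup>+x. \<integral>\<^sup>+y. P (ennreal (D y)) * indicator (cball x R) y \<partial>lborel \<partial>lborel)
          = (\<integral>\<^sup>+y. \<integral>\<^sup>+x. P (ennreal (D y)) * indicator (cball x R) y \<partial>lborel \<partial>lborel)"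
        by (intro lborel_pair.Fubini') measurable
      also have "\<dots> = (\<integral>\<^sup>+y. P (ennreal (D y)) * ennreal v \<partial>lborel)"
      proof (intro nn_integral_cong)
        fix y :: "real^'n"
        have "(\<integral>\<^sup>+x. indicator (cball x R) y \<partial>lborel) = (\<integral>\<^sup>+x. indicator (cball y R) x \<partial>lborel)"
          by (intro nn_integral_cong) (auto simp: indicator_def dist_commute)
        also have "\<dots> = ennreal v" using R by (simp add: emeasure_cball_cart v_def)
        finally show "(\<integral>\<^sup>+x. P (ennreal (D y)) * indicator (cball x R) y \<partial>lborel) = P (ennreal (D y))
            * ennreal v"
          by (simp add: nn_integral_cmult)
      qed
      also have "\<dots> = (\<integral>\<^sup>+y. P (ennreal (D y)) \<partial>lborel) * ennreal v" by (simp add: nn_integral_multc)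
      also have "ennreal (1 / v) * \<dots> \<le> ennreal (1 / v) * (1 * ennreal v)"
        by (intro mult_left_mono mult_right_mono ID) auto
      also have "\<dots> = 1" using v by (simp add: ennreal_mult[symmetric])
      finally show ?thesis .
    qed
    finally have sum: "(\<Sum>j. \<integral>\<^sup>+x. P (ennreal c * scale_energy \<theta> R d D j x) \<partial>lborel) \<le> ennreal C3 + 1"
      by (simp add: add_mono)
    then show "P (ennreal c * scale_energy \<theta> R d D j x) \<le> ennreal ((2 ^ j) ^ ?n) \<and>
      (\<Sum>j. \<integral>\<^sup>+x. P (ennreal c * scale_energy \<theta> R d D j x) \<partial>lborel) \<le> ennreal (C3 + 1)"
      using bound C3 by simp
  qed (use c C3 in auto)
qed

section \<open>Smooth kernels with vanishing moments\<close>

definition smooth1 :: "(real \<Rightarrow> real) \<Rightarrow> bool" where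
  "smooth1 f \<longleftrightarrow> (\<forall>k t. ((deriv ^^ k) f has_real_derivative (deriv ^^ Suc k) f t) (at t))"

text \<open>Smoothness is a greatest fixed point: to prove it one exhibits a class closed under
  differentiation, with no formula for the higher derivatives of products or compositions.\<close>

lemma smooth1_coinduct:
  assumes "S f"
    and step: "\<And>f. S f \<Longrightarrow> \<exists>g. S g \<and> (\<forall>t. (f has_real_derivative g t) (at t))"
  shows "smooth1 f"
proof -
  have d: "S (deriv g) \<and> (\<forall>t. (g has_real_derivative deriv g t) (at t))" if g: "S g" for g
  proof -
    obtain h where h: "S h" "\<forall>t. (g has_real_derivative h t) (at t)" using step[OF g] by blast
    then have "deriv g = h" by (auto intro: DERIV_imp_deriv)
    then show ?thesis using h by simp
  qed
  have "S ((deriv ^^ k) f)" for k by (induction k) (use assms(1) d in auto)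
  then show ?thesis using d by (simp add: smooth1_def)
qed

lemma smooth1_DERIV: "smooth1 f \<Longrightarrow> (f has_real_derivative deriv f t) (at t)"
  unfolding smooth1_def by (metis funpow_0 funpow.simps(2) id_apply o_apply)

lemma smooth1_deriv: "smooth1 f \<Longrightarrow> smooth1 (deriv f)"
  unfolding smooth1_def by (metis funpow_Suc_right o_apply)

lemma smooth1_funpow_deriv: "smooth1 f \<Longrightarrow> smooth1 ((deriv ^^ k) f)"
  by (induction k) (auto intro: smooth1_deriv)

lemma smooth1_antiderivative:
  assumes "smooth1 f" "\<And>t. (F has_real_derivative f t) (at t)"
  shows "smooth1 F" "deriv F = f"
proof -
  show "smooth1 F"
  proof (rule smooth1_coinduct[where S = "\<lambda>g. g = F \<or> smooth1 g"])
    fix g assume "g = F \<or> smooth1 g"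
    then show "\<exists>h. (h = F \<or> smooth1 h) \<and> (\<forall>t. (g has_real_derivative h t) (at t))"
    proof
      assume "g = F" then show ?thesis using assms by (intro exI[of _ f]) auto
    next
      assume "smooth1 g" then show ?thesis
        using smooth1_deriv smooth1_DERIV by (intro exI[of _ "deriv g"]) auto
    qed
  qed simp
  show "deriv F = f" using assms(2) by (auto intro: DERIV_imp_deriv)
qed

lemma smooth1_continuous: "smooth1 f \<Longrightarrow> continuous_on S f"
  by (meson DERIV_isCont continuous_at_imp_continuous_on smooth1_DERIV)

lemma smooth1_lincomb:
  assumes "smooth1 f" "smooth1 g"
  shows "smooth1 (\<lambda>t. a * f t + b * g t)"
    and deriv_lincomb: "deriv (\<lambda>t. a * f t + b * g t) = (\<lambda>t. a * deriv f t + b * deriv g t)"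
proof -
  have D: "((\<lambda>t. a * f t + b * g t) has_real_derivative a * deriv f t + b * deriv g t) (at t)"
    if "smooth1 f" "smooth1 g" for t f g
    using that[THEN smooth1_DERIV, of t] by (auto intro!: derivative_eq_intros)
  show "smooth1 (\<lambda>t. a * f t + b * g t)"
  proof (rule smooth1_coinduct[where S = "\<lambda>h. \<exists>f g. smooth1 f \<and> smooth1 g \<and> h = (\<lambda>t. a * f t + b * g t)"])
    fix h assume "\<exists>f g. smooth1 f \<and> smooth1 g \<and> h = (\<lambda>t. a * f t + b * g t)"
    then obtain f g where fg: "smooth1 f" "smooth1 g" "h = (\<lambda>t. a * f t + b * g t)" by blast
    then show "\<exists>h'. (\<exists>f g. smooth1 f \<and> smooth1 g \<and> h' = (\<lambda>t. a * f t + b * g t)) \<and>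
       (\<forall>t. (h has_real_derivative h' t) (at t))"
      using D[OF fg(1,2)] smooth1_deriv
      by (intro exI[of _ "\<lambda>t. a * deriv f t + b * deriv g t"]) blast
  qed (use assms in blast)
  show "deriv (\<lambda>t. a * f t + b * g t) = (\<lambda>t. a * deriv f t + b * deriv g t)"
    using D[OF assms] by (auto intro: DERIV_imp_deriv)
qed

lemma funpow_deriv_lincomb:
  assumes "smooth1 f" "smooth1 g"
  shows "(deriv ^^ k) (\<lambda>t. a * f t + b * g t) = (\<lambda>t. a * (deriv ^^ k) f t + b * (deriv ^^ k) g t)"
  by (induction k) (auto simp: deriv_lincomb smooth1_funpow_deriv assms)

lemma smooth1_affine:
  assumes "smooth1 f"
  shows "smooth1 (\<lambda>t. f (a * (t - b)))"
    and funpow_deriv_affine: "(deriv ^^ k) (\<lambda>t. f (a * (t - b))) = (\<lambda>t. a ^ k * (deriv ^^ k) f (a * (t - b)))"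
proof -
  have D: "((\<lambda>t. c * f (a * (t - b))) has_real_derivative c * a * deriv f (a * (t - b))) (at t)"
    if "smooth1 f" for t c f
  proof -
    have "((\<lambda>t. a * (t - b)) has_real_derivative a) (at t)" by (auto intro!: derivative_eq_intros)
    from DERIV_chain2[where f = f and g = "\<lambda>t. a * (t - b)", OF smooth1_DERIV[OF that] this]
    show ?thesis by (auto intro!: derivative_eq_intros)
  qed
  have S: "smooth1 (\<lambda>t. 1 * f (a * (t - b)))"
  proof (rule smooth1_coinduct[where S = "\<lambda>h. \<exists>f c. smooth1 f \<and> h = (\<lambda>t. c * f (a * (t - b)))"])
    fix h assume "\<exists>f c. smooth1 f \<and> h = (\<lambda>t. c * f (a * (t - b)))"
    then obtain f c where fg: "smooth1 f" "h = (\<lambda>t. c * f (a * (t - b)))" by blast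
    then show "\<exists>h'. (\<exists>f c. smooth1 f \<and> h' = (\<lambda>t. c * f (a * (t - b)))) \<and>
       (\<forall>t. (h has_real_derivative h' t) (at t))"
      using D[OF fg(1)] smooth1_deriv
      by (intro exI[of _ "\<lambda>t. c * a * deriv f (a * (t - b))"]) blast
  qed (use assms in blast)
  then show "smooth1 (\<lambda>t. f (a * (t - b)))" by simp
  show "(deriv ^^ k) (\<lambda>t. f (a * (t - b))) = (\<lambda>t. a ^ k * (deriv ^^ k) f (a * (t - b)))"
  proof (induction k)
    case (Suc k)
    show ?case
      using D[OF smooth1_funpow_deriv[OF assms], of "a ^ k" k]
      by (auto simp: Suc mult.commute intro!: DERIV_imp_deriv)
  qed simp
qed

lemma smooth1_mult:
  assumes "smooth1 f" "smooth1 g"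
  shows "smooth1 (\<lambda>t. f t * g t)"
proof -
  \<comment> \<open>Products are not closed under differentiation, but finite sums of products are;
    lists represent the sums.\<close>
  let ?S = "\<lambda>h. \<exists>xs :: ((real \<Rightarrow> real) \<times> (real \<Rightarrow> real)) list. (\<forall>p\<in>set xs. smooth1 (fst p) \<and> smooth1 (snd p)) \<and>
     h = (\<lambda>t. \<Sum>p\<leftarrow>xs. fst p t * snd p t)"
  have "\<exists>h'. ?S h' \<and> (\<forall>t. ((\<lambda>t. \<Sum>p\<leftarrow>xs. fst p t * snd p t) has_real_derivative h' t) (at t))"
    if "\<forall>p\<in>set xs. smooth1 (fst p) \<and> smooth1 (snd p)" for xs :: "((real \<Rightarrow> real) \<times> (real \<Rightarrow> real)) list"
    using that
  proof (induction xs)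
    case Nil
    then show ?case by (intro exI[of _ "\<lambda>_. 0"] conjI exI[of _ "[]"]) auto
  next
    case (Cons p xs)
    then obtain ys where ys: "\<forall>p\<in>set ys. smooth1 (fst p) \<and> smooth1 (snd p)"
      "\<And>t. ((\<lambda>t. \<Sum>p\<leftarrow>xs. fst p t * snd p t) has_real_derivative (\<Sum>p\<leftarrow>ys. fst p t * snd p t)) (at t)"
      by auto
    let ?zs = "(deriv (fst p), snd p) # (fst p, deriv (snd p)) # ys"
    have p: "smooth1 (fst p)" "smooth1 (snd p)" using Cons by auto
    have "((\<lambda>t. \<Sum>p\<leftarrow>p # xs. fst p t * snd p t) has_real_derivative (\<Sum>p\<leftarrow>?zs. fst p t * snd p t)) (at t)" for t
      using ys(2) p[THEN smooth1_DERIV] by (auto intro!: derivative_eq_intros)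
    moreover have "\<forall>p\<in>set ?zs. smooth1 (fst p) \<and> smooth1 (snd p)"
      using ys(1) p smooth1_deriv by auto
    ultimately show ?case
      by (intro exI[of _ "\<lambda>t. \<Sum>p\<leftarrow>?zs. fst p t * snd p t"] conjI exI[of _ ?zs]) auto
  qed
  then show ?thesis
    by (intro smooth1_coinduct[where S = ?S] exI[of _ "[(f, g)]"]) (use assms in auto)
qed

text \<open>The polynomial factor closes the family under differentiation: for \<open>t > 0\<close>
  the derivative of p(1/t) exp(-1/t) has the same form with x^2 (p - p') in place of
  \<open>p\<close>.\<close>

definition flat_exp :: "real poly \<Rightarrow> real \<Rightarrow> real" where
  "flat_exp p t = (if 0 < t then poly p (1 / t) * exp (- (1 / t)) else 0)"

lemma flat_exp_tendsto_0: "(flat_exp p \<longlongrightarrow> 0) (at 0)"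
proof -
  have "((\<lambda>y. poly p y * exp (- y)) \<longlongrightarrow> 0) at_top"
  proof -
    have "((\<lambda>y. \<Sum>i\<le>degree p. coeff p i * (y ^ i / exp y)) \<longlongrightarrow> (\<Sum>i\<le>degree p. coeff p i * 0)) at_top"
      by (intro tendsto_sum tendsto_mult tendsto_const tendsto_power_div_exp_0)
    then show ?thesis
      by (simp add: poly_altdef sum_distrib_right exp_minus divide_inverse mult.assoc)
  qed
  then have "((\<lambda>t. poly p (inverse t) * exp (- inverse t)) \<longlongrightarrow> 0) (at_right 0)"
    by (rule filterlim_compose) (rule filterlim_inverse_at_top_right)
  then have "(flat_exp p \<longlongrightarrow> 0) (at_right 0)"
    by (rule Lim_transform_eventually)
      (auto simp: flat_exp_def eventually_at_filter inverse_eq_divide)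
  moreover have "(flat_exp p \<longlongrightarrow> 0) (at_left 0)"
    by (rule Lim_transform_eventually[OF tendsto_const[of 0]])
      (auto simp: flat_exp_def eventually_at_filter)
  ultimately show ?thesis by (simp add: filterlim_split_at)
qed

lemma flat_exp_DERIV:
  "(flat_exp p has_real_derivative flat_exp ([:0, 0, 1:] * (p - pderiv p)) t) (at t)"
proof -
  consider "t < 0" | "t = 0" | "0 < t" by linarith
  then show ?thesis
  proof cases
    case 1
    have "((\<lambda>_. 0) has_real_derivative 0) (at t)" by simp
    then have "(flat_exp p has_real_derivative 0) (at t)"
      by (rule has_field_derivative_transform_within_open[of _ _ _ "{..<0}"])
        (use 1 in \<open>auto simp: flat_exp_def\<close>)
    then show ?thesis using 1 by (simp add: flat_exp_def)
  next
    case 2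
    \<comment> \<open>Dividing by \<open>h\<close> multiplies the polynomial by its variable, so the
      difference quotient at 0 is again of the form \<open>flat_exp\<close> and tends to 0.\<close>
    have "((\<lambda>h. flat_exp p h / h) \<longlongrightarrow> 0) (at 0)"
      by (rule Lim_transform_eventually[OF flat_exp_tendsto_0[of "[:0, 1:] * p"]])
        (auto simp: flat_exp_def eventually_at_filter)
    then show ?thesis using 2 by (simp add: has_field_derivative_iff flat_exp_def)
  next
    case 3
    have "((\<lambda>t. poly p (1 / t) * exp (- (1 / t))) has_real_derivative
        poly (pderiv p) (1 / t) * (- 1 / t^2) * exp (- (1 / t)) + poly p (1 / t) * (exp (- (1 / t))
            * (1 / t^2))) (at t)"
      using 3 by (auto intro!: derivative_eq_intros poly_DERIV[THEN DERIV_chain2] simp: power2_eq_square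
          field_simps)
    also have "poly (pderiv p) (1 / t) * (- 1 / t^2) * exp (- (1 / t)) + poly p (1 / t) * (exp (- (1 / t))
        * (1 / t^2))
        = flat_exp ([:0, 0, 1:] * (p - pderiv p)) t"
      using 3 by (simp add: flat_exp_def power2_eq_square field_simps)
    finally show ?thesis
      by (rule has_field_derivative_transform_within_open[of _ _ _ "{0<..}"])
        (use 3 in \<open>auto simp: flat_exp_def\<close>)
  qed
qed

lemma smooth1_flat_exp: "smooth1 (flat_exp p)"
  by (rule smooth1_coinduct[where S = "\<lambda>h. \<exists>p. h = flat_exp p"]) (use flat_exp_DERIV in blast)+

section \<open>Bumps and compactly supported antiderivatives\<close>

lemma integrable_compact_support1:
  fixes f :: "real \<Rightarrow> real"
  assumes "continuous_on UNIV f" "\<And>t. R < \<bar>t\<bar> \<Longrightarrow> f t = 0"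
  shows "integrable lborel f"
proof -
  have "integrable lborel (\<lambda>t. indicator {-R..R} t *\<^sub>R f t)"
    using assms(1) by (intro borel_integrable_compact) (auto intro: continuous_on_subset)
  moreover have "(\<lambda>t. indicator {-R..R} t *\<^sub>R f t) = f"
  proof
    fix t show "indicator {-R..R} t *\<^sub>R f t = f t"
      using assms(2)[of t] by (cases "R < \<bar>t\<bar>") (auto simp: indicator_def)
  qed
  ultimately show ?thesis by simp
qed

lemma normalized_bump1:
  obtains \<eta> where "smooth1 \<eta>" "\<And>t. 1 < \<bar>t\<bar> \<Longrightarrow> \<eta> t = 0" "(LINT t|lborel. \<eta> t) = 1"
proof -
  let ?h = "flat_exp 1"
  \<comment> \<open>The product of exp(-1/(1+t)) and exp(-1/(1-t)), each extended by 0; the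
    arguments are written in the shape of \<open>smooth1_affine\<close>.\<close>
  define b where "b t = ?h (1 * (t - (-1))) * ?h ((-1) * (t - 1))" for t
  have b: "smooth1 b"
    unfolding b_def by (intro smooth1_mult smooth1_affine smooth1_flat_exp)
  have supp: "b t = 0" if "1 < \<bar>t\<bar>" for t
    using that by (auto simp: b_def flat_exp_def)
  have nn: "0 \<le> b t" for t by (auto simp: b_def flat_exp_def)
  have pos: "0 < b t" if "\<bar>t\<bar> < 1" for t using that by (auto simp: b_def flat_exp_def)
  have int: "integrable lborel b"
    using smooth1_continuous[OF b] supp by (rule integrable_compact_support1)
  define I where "I = (LINT t|lborel. b t)"
  have b_nz: "t \<notin> {-1<..<1}" if "b t = 0" for t
    using pos[of t] that by (auto simp: abs_less_iff)
  have "I \<noteq> 0"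
  proof
    assume "I = 0"
    then have "AE t in lborel. b t = 0"
      using integral_nonneg_eq_0_iff_AE[OF int] nn by (simp add: I_def)
    then have "AE t in lborel. t \<notin> {-1<..<1::real}"
      by (rule eventually_mono) (rule b_nz)
    then have "{-1<..<1::real} \<in> null_sets lborel"
      by (subst AE_iff_null_sets) auto
    then show False by (auto simp: null_sets_def)
  qed
  \<comment> \<open>The summand \<open>0 * b t\<close> gives the normalized bump the shape of
    \<open>smooth1_lincomb\<close>.\<close>
  show thesis
  proof (rule that[of "\<lambda>t. (1 / I) * b t + 0 * b t"])
    show "smooth1 (\<lambda>t. (1 / I) * b t + 0 * b t)" by (intro smooth1_lincomb b)
    show "(LINT t|lborel. (1 / I) * b t + 0 * b t) = 1" using \<open>I \<noteq> 0\<close> by (simp add: I_def)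
  qed (use supp in auto)
qed

text \<open>The antiderivative that vanishes at -1 is constant on either side of
  \<open>{-1..1}\<close>: it is 0 on the left by normalization and on the right because the total
  integral is 0.\<close>

lemma smooth1_antiderivative_compact:
  assumes f: "smooth1 f" and supp: "\<And>t. 1 < \<bar>t\<bar> \<Longrightarrow> f t = 0" and int: "(LINT t|lborel. f t) = 0"
  obtains F where "smooth1 F" "\<And>t. 1 < \<bar>t\<bar> \<Longrightarrow> F t = 0" "deriv F = f"
proof -
  define G where "G u = (LBINT y=ereal 0..ereal u. f y)" for u
  have G: "(G has_real_derivative f x) (at x)" for x
  proof -
    let ?b = "\<bar>x\<bar> + 1"
    have "(G has_vector_derivative f x) (at x within {-?b..?b})"
      unfolding G_def by (rule interval_integral_FTC2) (auto intro: smooth1_continuous f)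
    moreover have "at x within {-?b..?b} = at x" by (rule at_within_Icc_at) auto
    ultimately show ?thesis by (simp add: has_real_derivative_iff_has_vector_derivative)
  qed
  define F where "F u = G u - G (-1)" for u
  have F: "(F has_real_derivative f x) (at x)" for x
    unfolding F_def using G by (auto intro!: derivative_eq_intros)
  have cont: "continuous_on S F" for S using F by (meson DERIV_isCont continuous_at_imp_continuous_on)
  have left: "F t = 0" if "t \<le> -1" for t
  proof (cases "t = -1")
    case False
    then have "t < -1" using that by simp
    then have "F (-1) = F t"
      by (rule DERIV_isconst_end[OF _ cont]) (use F supp in \<open>metis abs_of_neg less_minus_iff less_trans neg_less_0_iff_less zero_less_one\<close>)
    then show ?thesis by (simp add: F_def)
  qed (simp add: F_def)
  have "(\<integral>x. f x * indicator {-1..1} x \<partial>lborel) = F 1 - F (-1)"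
    by (rule integral_FTC_Icc_real) (use F smooth1_continuous[OF f, of UNIV] in \<open>auto simp: continuous_on_eq_continuous_at\<close>)
  moreover have "(\<lambda>x. f x * indicator {-1..1} x) = f"
  proof
    fix t show "f t * indicator {-1..1} t = f t"
      using supp[of t] by (cases "1 < \<bar>t\<bar>") (auto simp: indicator_def)
  qed
  ultimately have F1: "F 1 = 0" using int left[of "-1"] by simp
  have right: "F t = 0" if "1 < t" for t
  proof -
    have "F t = F 1"
      by (rule DERIV_isconst_end[OF that cont]) (use F supp in \<open>metis abs_of_pos less_trans zero_less_one\<close>)
    then show ?thesis using F1 by simp
  qed
  show thesis
    by (rule that[OF smooth1_antiderivative(1)[OF f F] _ smooth1_antiderivative(2)[OF f F]])
      (use left right in \<open>smt (verit)\<close>)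
qed

section \<open>Telescoping kernels in one variable\<close>

lemma lborel_integral_double:
  fixes f :: "real \<Rightarrow> real"
  shows "(LINT t|lborel. f (2 * t)) = (LINT t|lborel. f t) / 2"
  using lborel_integral_real_affine[of 2 f 0] by simp

lemma smooth1_double: "smooth1 f \<Longrightarrow> smooth1 (\<lambda>t. f (2 * t))"
  using smooth1_affine[of f 2 0] by simp

lemma funpow_deriv_double: "smooth1 f \<Longrightarrow> (deriv ^^ k) (\<lambda>t. f (2 * t)) = (\<lambda>t. 2 ^ k * (deriv ^^ k) f (2 * t))"
  using funpow_deriv_affine[of f k 2 0] by simp

text \<open>If \<open>2 \<eta>(2t) - \<eta>(t) = \<zeta>\<^sup>(\<^sup>m\<^sup>)(t)\<close>, then a suitable combination of \<open>\<eta>\<close> and \<open>2 \<eta>(2\<cdot>)\<close> turns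
  \<open>\<zeta>\<close> into a function of mean zero, which can be integrated once more.\<close>

lemma kernel1:
  "\<exists>\<eta> \<zeta>. smooth1 \<eta> \<and> smooth1 \<zeta> \<and> (\<forall>t. 1 < \<bar>t\<bar> \<longrightarrow> \<eta> t = 0 \<and> \<zeta> t = 0) \<and>
     (LINT t|lborel. \<eta> t) = 1 \<and> (\<forall>t. 2 * \<eta> (2 * t) - \<eta> t = (deriv ^^ Suc m) \<zeta> t)"
proof (induction m)
  case 0
  obtain \<eta> where \<eta>: "smooth1 \<eta>" "\<And>t. 1 < \<bar>t\<bar> \<Longrightarrow> \<eta> t = 0" "(LINT t|lborel. \<eta> t) = 1"
    using normalized_bump1 by blast
  define f where "f t = 2 * \<eta> (2 * t) + (-1) * \<eta> t" for t
  have f: "smooth1 f" unfolding f_def by (intro smooth1_lincomb smooth1_double \<eta>)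
  have int: "integrable lborel \<eta>" "integrable lborel (\<lambda>t. \<eta> (2 * t))"
    by (rule integrable_compact_support1[of _ 1]; use \<eta> smooth1_continuous smooth1_double in auto)+
  have supp: "f t = 0" if "1 < \<bar>t\<bar>" for t using that \<eta>(2)[of t] \<eta>(2)[of "2 * t"] by (simp add: f_def abs_mult)
  have "(LINT t|lborel. f t) = 0"
    unfolding f_def using int \<eta>(3) by (simp add: lborel_integral_double)
  then obtain \<zeta> where "smooth1 \<zeta>" "\<And>t. 1 < \<bar>t\<bar> \<Longrightarrow> \<zeta> t = 0" "deriv \<zeta> = f"
    using smooth1_antiderivative_compact[OF f supp] by metis
  then show ?case using \<eta> by (intro exI[of _ \<eta>] exI[of _ \<zeta>]) (auto simp: f_def)
next
  case (Suc m)
  then obtain \<eta> \<zeta> where \<eta>: "smooth1 \<eta>" "\<And>t. 1 < \<bar>t\<bar> \<Longrightarrow> \<eta> t = 0" "(LINT t|lborel. \<eta> t) = 1"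
    and \<zeta>: "smooth1 \<zeta>" "\<And>t. 1 < \<bar>t\<bar> \<Longrightarrow> \<zeta> t = 0"
    and e: "\<And>t. 2 * \<eta> (2 * t) - \<eta> t = (deriv ^^ Suc m) \<zeta> t" by blast
  \<comment> \<open>\<open>M\<close> is the factor that \<open>Suc m\<close> derivatives of
    \<open>\<zeta> (2 * t)\<close> produce, compensated by \<open>1 / M\<close> in \<open>f\<close>.
    The equation \<open>a + b = 1\<close> preserves the integral of \<open>\<eta>\<close>, and
    \<open>a * M + b = 0\<close> makes the integral of \<open>f\<close> vanish.\<close>
  define M :: real where "M = 2 ^ Suc m"
  have M: "1 < M" unfolding M_def by (rule one_less_power) auto
  define a b where "a = - 1 / (M - 1)" and "b = M / (M - 1)"
  have ab: "a + b = 1" "a * M + b = 0" using M by (auto simp: a_def b_def divide_simps)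
  define \<eta>' where "\<eta>' t = a * \<eta> t + (b * 2) * \<eta> (2 * t)" for t
  define f where "f t = a * \<zeta> t + (b * 2 / M) * \<zeta> (2 * t)" for t
  have int: "integrable lborel \<eta>" "integrable lborel (\<lambda>t. \<eta> (2 * t))"
     "integrable lborel \<zeta>" "integrable lborel (\<lambda>t. \<zeta> (2 * t))"
    by (rule integrable_compact_support1[of _ 1]; use \<eta> \<zeta> smooth1_continuous smooth1_double in auto)+
  have f: "smooth1 f" unfolding f_def by (intro smooth1_lincomb smooth1_double \<zeta>)
  have supp: "f t = 0" if "1 < \<bar>t\<bar>" for t using that \<zeta>(2)[of t] \<zeta>(2)[of "2 * t"] by (simp add: f_def abs_mult)
  have "(LINT t|lborel. f t) = (a + b / M) * (LINT t|lborel. \<zeta> t)"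
    unfolding f_def using int by (simp add: lborel_integral_double distrib_right)
  also have "a + b / M = 0" using ab(2) M by (simp add: field_simps)
  finally have "(LINT t|lborel. f t) = 0" by simp
  then obtain \<xi> where \<xi>: "smooth1 \<xi>" "\<And>t. 1 < \<bar>t\<bar> \<Longrightarrow> \<xi> t = 0" "deriv \<xi> = f"
    using smooth1_antiderivative_compact[OF f supp] by metis
  have "2 * \<eta>' (2 * t) - \<eta>' t = (deriv ^^ Suc (Suc m)) \<xi> t" for t
  proof -
    have "(deriv ^^ Suc (Suc m)) \<xi> t = (deriv ^^ Suc m) f t"
      by (simp only: funpow_Suc_right[of "Suc m"] o_apply \<xi>(3))
    also have "\<dots> = a * (deriv ^^ Suc m) \<zeta> t + (b * 2 / M) * (M * (deriv ^^ Suc m) \<zeta> (2 * t))"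
      unfolding f_def using \<zeta>(1) by (subst funpow_deriv_lincomb) (auto simp only: smooth1_double
          funpow_deriv_double M_def)
    also have "\<dots> = a * (2 * \<eta> (2 * t) - \<eta> t) + b * 2 * (2 * \<eta> (2 * (2 * t)) - \<eta> (2 * t))"
      unfolding e using M by simp
    also have "\<dots> = 2 * \<eta>' (2 * t) - \<eta>' t" by (simp add: \<eta>'_def algebra_simps)
    finally show ?thesis ..
  qed
  moreover have "(LINT t|lborel. \<eta>' t) = 1"
    unfolding \<eta>'_def using int \<eta>(3) ab(1) by (simp add: lborel_integral_double)
  moreover have "smooth1 \<eta>'" unfolding \<eta>'_def by (intro smooth1_lincomb smooth1_double \<eta>)
  moreover have "\<eta>' t = 0" if "1 < \<bar>t\<bar>" for t
    using that \<eta>(2)[of t] \<eta>(2)[of "2 * t"] by (simp add: \<eta>'_def abs_mult)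
  ultimately show ?case using \<xi> by (intro exI[of _ \<eta>'] exI[of _ \<xi>]) auto
qed

section \<open>Tensor products\<close>

definition tens :: "('n::finite \<Rightarrow> real \<Rightarrow> real) \<Rightarrow> real^'n \<Rightarrow> real" where
  "tens g x = (\<Prod>k\<in>UNIV. g k (x $ k))"

lemma tens_upd: "tens (g(i := f)) x = f (x $ i) * (\<Prod>k\<in>UNIV - {i}. g k (x $ k))"
proof -
  have "tens (g(i := f)) x = f (x $ i) * (\<Prod>k\<in>UNIV - {i}. (g(i := f)) k (x $ k))"
    unfolding tens_def by (subst prod.remove[of _ i]) auto
  also have "(\<Prod>k\<in>UNIV - {i}. (g(i := f)) k (x $ k)) = (\<Prod>k\<in>UNIV - {i}. g k (x $ k))"
    by (intro prod.cong) auto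
  finally show ?thesis .
qed

lemma tens_has_derivative:
  assumes "\<And>k. smooth1 (g k)"
  shows "(tens g has_derivative (\<lambda>h. \<Sum>i\<in>UNIV. h $ i * deriv (g i) (x $ i)
      * (\<Prod>j\<in>UNIV - {i}. g j (x $ j)))) (at x)"
proof -
  have "((\<lambda>x. g i (x $ i)) has_derivative (\<lambda>h. h $ i * deriv (g i) (x $ i))) (at x)" for i
  proof -
    have "(g i has_derivative (*) (deriv (g i) (x $ i))) (at (x $ i))"
      using smooth1_DERIV[OF assms, of i "x $ i"] by (rule has_field_derivative_imp_has_derivative)
    from has_derivative_compose[of "\<lambda>x. x $ i" "\<lambda>h. h $ i" x UNIV, OF _ this]
    show ?thesis by (simp add: mult.commute bounded_linear_imp_has_derivative bounded_linear_vec_nth)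
  qed
  then show ?thesis unfolding tens_def by (rule has_derivative_prod)
qed

lemma tens_differentiable: "(\<And>k. smooth1 (g k)) \<Longrightarrow> tens g differentiable_on S"
  unfolding differentiable_on_def differentiable_def
  using tens_has_derivative has_derivative_at_withinI by blast

lemma partial_tens:
  assumes "\<And>k. smooth1 (g k)"
  shows "partial i (tens g) = tens (g(i := deriv (g i)))"
proof
  fix x
  have "partial i (tens g) x = (\<Sum>j\<in>UNIV. axis i 1 $ j * deriv (g j) (x $ j) * (\<Prod>k\<in>UNIV - {j}. g k (x $ k)))"
    unfolding partial_def using frechet_derivative_at[OF tens_has_derivative[OF assms, where x
        = x], symmetric] by simp
  also have "\<dots> = (\<Sum>j\<in>UNIV. if j = i then deriv (g i) (x $ i) * (\<Prod>k\<in>UNIV - {i}. g k (x $ k)) else 0)"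
    by (intro sum.cong) (auto simp: axis_def)
  finally show "partial i (tens g) x = tens (g(i := deriv (g i))) x"
    by (simp add: tens_upd)
qed

lemma partials_replicate_tens:
  assumes "\<And>k. smooth1 (g k)"
  shows "partials (replicate N i) (tens g) = tens (g(i := (deriv ^^ N) (g i)))"
proof (induction N)
  case (Suc N)
  have "smooth1 ((g(i := (deriv ^^ N) (g i))) k)" for k
    using assms by (auto intro: smooth1_funpow_deriv)
  note * = partial_tens[OF this, of i]
  have "partials (replicate (Suc N) i) (tens g) = partial i (tens (g(i := (deriv ^^ N) (g i))))"
    unfolding Suc[symmetric] by (simp add: partials_def)
  also note *
  finally show ?case by (simp only: fun_upd_upd fun_upd_same funpow.simps o_apply)
qed (simp add: partials_def)

lemma partials_tens:
  assumes "\<And>k. smooth1 (g k)"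
  shows "\<exists>h. (\<forall>k. smooth1 (h k)) \<and> partials w (tens g) = tens h"
proof (induction w)
  case Nil
  then show ?case using assms by (auto simp: partials_def)
next
  case (Cons i w)
  then obtain h where h: "\<And>k. smooth1 (h k)" "partials w (tens g) = tens h" by blast
  have "partials (i # w) (tens g) = partial i (tens h)"
    unfolding h(2)[symmetric] by (simp add: partials_def)
  also have "\<dots> = tens (h(i := deriv (h i)))" by (rule partial_tens[OF h(1)])
  finally have "partials (i # w) (tens g) = tens (h(i := deriv (h i)))" .
  moreover have "\<forall>k. smooth1 ((h(i := deriv (h i))) k)" using h(1) smooth1_deriv by auto
  ultimately show ?case by blast
qed

lemma tens_eq_0: "g k (x $ k) = 0 \<Longrightarrow> tens g x = 0"
  unfolding tens_def by (rule prod_zero) auto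

text \<open>The norm is at most the sum of the absolute values of the \<open>CARD('n)\<close>
  coordinates, so one of them exceeds \<open>R\<close> and its factor vanishes.\<close>

lemma tens_support:
  fixes x :: "real^'n::finite" and R :: real
  assumes "\<And>k t. R < \<bar>t\<bar> \<Longrightarrow> g k t = 0" "CARD('n) * R < norm x"
  shows "tens g x = 0"
proof -
  have "\<exists>k. R < \<bar>x $ k\<bar>"
  proof (rule ccontr)
    assume "\<not> (\<exists>k. R < \<bar>x $ k\<bar>)"
    then have "(\<Sum>k\<in>UNIV. \<bar>x $ k\<bar>) \<le> (\<Sum>k\<in>(UNIV :: 'n set). R)"
      by (intro sum_mono) (auto simp: not_less)
    then show False using assms(2) norm_le_l1_cart[of x] by simp
  qed
  then obtain k where "R < \<bar>x $ k\<bar>" by blast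
  then show ?thesis by (intro tens_eq_0[of g k] assms(1))
qed

lemma test_function_tens:
  fixes g :: "'n::finite \<Rightarrow> real \<Rightarrow> real" and R :: real
  assumes "\<And>k. smooth1 (g k)" "\<And>k t. R < \<bar>t\<bar> \<Longrightarrow> g k t = 0"
  shows "test_function (tens g)"
  unfolding test_function_def
proof (intro conjI allI)
  fix w show "partials w (tens g) differentiable_on UNIV"
  proof -
    obtain h where h: "\<And>k. smooth1 (h k)" "partials w (tens g) = tens h"
      using partials_tens[of g w] assms(1) by blast
    show ?thesis unfolding h(2) by (rule tens_differentiable[OF h(1)])
  qed
  have "{x. tens g x \<noteq> 0} \<subseteq> cball 0 (CARD('n) * R)"
    using tens_support[of R g, OF assms(2)] by (force simp: not_less[symmetric])
  then show "compact (closure {x. tens g x \<noteq> 0})"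
    by (meson bounded_cball bounded_subset compact_closure)
qed

lemma lborel_integral_tens:
  fixes g :: "'n::finite \<Rightarrow> real \<Rightarrow> real"
  assumes "\<And>k. integrable lborel (g k)"
  shows "(LINT x|lborel. tens g x) = (\<Prod>k\<in>UNIV. LINT t|lborel. g k t)"
proof -
  interpret product_sigma_finite "\<lambda>_ :: real^'n. lborel :: real measure" by standard
  \<comment> \<open>Lebesgue measure on \<open>real^'n\<close> is a product indexed by the basis
    vectors; \<open>f\<close> carries the factors over from indices \<open>k\<close> to vectors
    \<open>axis k 1\<close>.\<close>
  define f where "f b = g (THE k. b = axis k (1::real))" for b :: "real^'n"
  have the: "(THE k'. axis k (1::real) = axis k' (1::real)) = k" for k :: 'n
    by (rule the_equality) (auto simp: axis_eq_axis)
  have B: "Basis = range (\<lambda>k::'n. axis k (1::real))"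
    by (auto simp: Basis_vec_def)
  have inj: "inj (\<lambda>k::'n. axis k (1::real))" by (auto simp: inj_def axis_eq_axis)
  have m [measurable]: "g k \<in> borel_measurable borel" for k using assms[of k] by auto
  have "(LINT x|lborel. tens g x) = (LINT x|distr (\<Pi>\<^sub>M b\<in>Basis. lborel) borel (\<lambda>f. \<Sum>b\<in>Basis. f b *\<^sub>R b).
      tens g x)"
    by (subst lborel_eq) simp
  also have "\<dots> = (LINT y|(\<Pi>\<^sub>M b\<in>Basis. lborel). tens g (\<Sum>b\<in>Basis. y b *\<^sub>R b :: real^'n))"
    unfolding tens_def by (rule integral_distr) measurable
  also have "\<dots> = (LINT y|(\<Pi>\<^sub>M b\<in>Basis. lborel). (\<Prod>b\<in>Basis. f b (y b)))"
  proof (intro Bochner_Integration.integral_cong refl)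
    fix y :: "real^'n \<Rightarrow> real"
    have "(\<Sum>b\<in>Basis. y b *\<^sub>R b) $ k = y (axis k 1)" for k :: 'n
    proof -
      have "(\<Sum>b\<in>Basis. y b *\<^sub>R b) $ k = (\<Sum>b\<in>Basis. y b *\<^sub>R b) \<bullet> axis k 1"
        by (simp add: inner_axis)
      also have "\<dots> = y (axis k 1)"
        by (rule inner_sum_left_Basis) (auto simp: B)
      finally show ?thesis .
    qed
    then show "tens g (\<Sum>b\<in>Basis. y b *\<^sub>R b) = (\<Prod>b\<in>Basis. f b (y b))"
      unfolding B tens_def by (subst prod.reindex[OF inj]) (auto simp: f_def the)
  qed
  also have "\<dots> = (\<Prod>b\<in>Basis. LINT t|lborel. f b t)"
    by (rule product_integral_prod) (auto simp: f_def assms)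
  also have "\<dots> = (\<Prod>k\<in>UNIV. LINT t|lborel. g k t)"
    unfolding B by (subst prod.reindex[OF inj]) (auto simp: f_def the)
  finally show ?thesis .
qed

text \<open>What the estimates remember of a smooth kernel: the sup bound controls mollifications,
  the Lipschitz bound controls their increments. One \<open>L\<close> serves both.\<close>

definition kernel :: "real \<Rightarrow> real \<Rightarrow> (real^'n::finite \<Rightarrow> real) \<Rightarrow> bool" where
  "kernel R L f \<longleftrightarrow> (\<forall>x. R < norm x \<longrightarrow> f x = 0) \<and> (\<forall>x. \<bar>f x\<bar> \<le> L) \<and>
     (\<forall>x y. \<bar>f x - f y\<bar> \<le> L * norm (x - y))"

lemma smooth1_compact_bounds:
  assumes f: "smooth1 f" and supp: "\<And>t. 1 < \<bar>t\<bar> \<Longrightarrow> f t = 0"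
  obtains L where "1 \<le> L" "\<And>t. \<bar>f t\<bar> \<le> L" "\<And>t s. \<bar>f t - f s\<bar> \<le> L * \<bar>t - s\<bar>"
proof -
  have bdd: "\<exists>B. \<forall>t. \<bar>h t\<bar> \<le> B" if h: "smooth1 h" "\<And>t. 1 < \<bar>t\<bar> \<Longrightarrow> h t = 0" for h :: "real \<Rightarrow> real"
  proof -
    have "compact (h ` {-1..1})" using smooth1_continuous[OF h(1)] by (intro compact_continuous_image) auto
    then obtain B where B: "\<forall>y\<in>h ` {-1..1}. norm y \<le> B" using compact_imp_bounded bounded_iff by metis
    have "\<bar>h t\<bar> \<le> max B 0" for t
    proof (cases "1 < \<bar>t\<bar>")
      case False
      then have "t \<in> {-1..1}" by auto
      then have "\<bar>h t\<bar> \<le> B" using B by auto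
      then show ?thesis by simp
    qed (simp add: h(2))
    then show ?thesis by blast
  qed
  have supp': "deriv f t = 0" if "1 < \<bar>t\<bar>" for t
  proof (rule DERIV_imp_deriv)
    show "(f has_real_derivative 0) (at t)"
    proof (rule has_field_derivative_transform_within_open[of "\<lambda>_. 0" _ _ "- {-1..1}"])
      show "t \<in> - {-1..1}" using that by auto
    qed (use supp in \<open>auto simp: not_le abs_if\<close>)
  qed
  obtain B1 where B1: "\<And>t. \<bar>f t\<bar> \<le> B1" using bdd[OF f supp] by blast
  obtain B2 where B2: "\<And>t. \<bar>deriv f t\<bar> \<le> B2" using bdd[OF smooth1_deriv[OF f] supp'] by blast
  define L where "L = max 1 (max B1 B2)"
  have "\<bar>f t - f s\<bar> \<le> L * \<bar>t - s\<bar>" for t s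
  proof -
    have "norm (f t - f s) \<le> L * norm (t - s)"
      by (rule field_differentiable_bound[of UNIV f "deriv f"])
        (use B2 smooth1_DERIV[OF f] in \<open>auto simp: L_def le_max_iff_disj\<close>)
    then show ?thesis by simp
  qed
  then show thesis
    by (intro that[of L]) (use B1 in \<open>auto simp: L_def le_max_iff_disj\<close>)
qed

lemma kernel_tens:
  fixes g :: "'n::finite \<Rightarrow> real \<Rightarrow> real"
  assumes g: "\<And>k. smooth1 (g k)" and supp: "\<And>k t. 1 < \<bar>t\<bar> \<Longrightarrow> g k t = 0"
  shows "\<exists>L. kernel (real CARD('n)) L (tens g)"
proof -
  have "\<exists>L. 1 \<le> L \<and> (\<forall>t. \<bar>g k t\<bar> \<le> L) \<and> (\<forall>t s. \<bar>g k t - g k s\<bar> \<le> L * \<bar>t - s\<bar>)" for k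
    using smooth1_compact_bounds[OF g supp] by metis
  then obtain l where l: "\<And>k. 1 \<le> l k" "\<And>k t. \<bar>g k t\<bar> \<le> l k" "\<And>k t s. \<bar>g k t - g k s\<bar> \<le> l k * \<bar>t - s\<bar>"
    by metis
  define P where "P = (\<Prod>k\<in>UNIV. l k)"
  have l0: "0 < l k" "l k \<noteq> 0" for k using l(1)[of k] by linarith+
  have P: "0 \<le> P" unfolding P_def by (intro prod_nonneg) (simp add: l0 less_imp_le)
  \<comment> \<open>The factors are normalized to absolute value at most 1, the range in which
    \<open>norm_prod_diff\<close> bounds a difference of products by the sum of the
    differences.\<close>
  have eq: "tens g x = P * (\<Prod>k\<in>UNIV. g k (x $ k) / l k)" for x
    unfolding tens_def P_def prod.distrib[symmetric] using l0 by (intro prod.cong) simp_all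
  have b1: "norm (g k t / l k) \<le> 1" for k t using l(2)[of k t] l0(1)[of k] by simp
  have Lip: "\<bar>tens g x - tens g y\<bar> \<le> P * CARD('n) * norm (x - y)" for x y
  proof -
    have "\<bar>tens g x - tens g y\<bar> = P * norm ((\<Prod>k\<in>UNIV. g k (x $ k) / l k) - (\<Prod>k\<in>UNIV. g k (y $ k) / l k))"
      unfolding eq right_diff_distrib[symmetric] using P by (simp add: abs_mult)
    also have "\<dots> \<le> P * (\<Sum>k\<in>UNIV. norm (g k (x $ k) / l k - g k (y $ k) / l k))"
      using P by (intro mult_left_mono norm_prod_diff b1) auto
    also have "\<dots> \<le> P * (\<Sum>k\<in>(UNIV :: 'n set). norm (x - y))"
    proof (intro mult_left_mono sum_mono P)
      fix k
      have "norm (g k (x $ k) / l k - g k (y $ k) / l k) = \<bar>g k (x $ k) - g k (y $ k)\<bar> / l k"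
        using l0(1)[of k] by (simp add: diff_divide_distrib[symmetric])
      also have "\<dots> \<le> \<bar>x $ k - y $ k\<bar>" using l(3)[of k "x $ k" "y $ k"] l0[of k]
        by (simp add: pos_divide_le_eq mult.commute)
      also have "\<dots> \<le> norm (x - y)" using component_le_norm_cart[of "x - y" k] by simp
      finally show "norm (g k (x $ k) / l k - g k (y $ k) / l k) \<le> norm (x - y)" .
    qed
    finally show ?thesis by simp
  qed
  have bdd: "\<bar>tens g x\<bar> \<le> P" for x
  proof -
    have "(\<Prod>k\<in>UNIV. norm (g k (x $ k) / l k)) \<le> 1" by (intro prod_le_1 conjI b1) auto
    then have "norm (\<Prod>k\<in>UNIV. g k (x $ k) / l k) \<le> 1" by (simp only: prod_norm)
    from mult_left_mono[OF this P] show ?thesis unfolding eq using P by (simp add: abs_mult)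
  qed
  have "P \<le> P * CARD('n)" using P mult_left_mono[of 1 "real CARD('n)" P] by (simp add: Suc_le_eq)
  then have "kernel (real CARD('n)) (P * CARD('n)) (tens g)"
    unfolding kernel_def using tens_support[of 1 g, OF supp] bdd Lip by (auto intro: order_trans)
  then show ?thesis by blast
qed

lemma kernel_mono:
  assumes k: "kernel R L f" and "R \<le> R'" "L \<le> L'"
  shows "kernel R' L' f"
  unfolding kernel_def
proof (intro conjI allI impI)
  fix x y
  show "f x = 0" if "R' < norm x" using k that assms(2) by (auto simp: kernel_def)
  have "\<bar>f x\<bar> \<le> L" "\<bar>f x - f y\<bar> \<le> L * norm (x - y)" using k by (auto simp: kernel_def)
  moreover have "L * norm (x - y) \<le> L' * norm (x - y)" using assms(3) by (intro mult_right_mono) auto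
  ultimately show "\<bar>f x\<bar> \<le> L'" "\<bar>f x - f y\<bar> \<le> L' * norm (x - y)" using assms(3) by linarith+
qed

text \<open>The Borel counterpart of \<open>locally_integrable\<close>: product measurability and
  Fubini over \<open>lborel\<close> ask for Borel representatives.\<close>

definition locint :: "(real^'n::finite \<Rightarrow> real) \<Rightarrow> bool" where
  "locint U \<longleftrightarrow> U \<in> borel_measurable borel \<and> (\<forall>x r. (\<integral>\<^sup>+y\<in>cball x r. ennreal \<bar>U y\<bar> \<partial>lborel) < \<infinity>)"

lemma kernel_continuous: "kernel R L f \<Longrightarrow> continuous_on S f"
proof -
  assume k: "kernel R L f"
  then have "(max L 0)-lipschitz_on S f"
  proof (intro lipschitz_onI)
    fix x y
    have "\<bar>f x - f y\<bar> \<le> L * norm (x - y)" using k by (simp add: kernel_def)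
    also have "\<dots> \<le> max L 0 * norm (x - y)" by (intro mult_right_mono) auto
    finally show "dist (f x) (f y) \<le> max L 0 * dist x y" by (simp add: dist_norm)
  qed simp
  then show ?thesis by (rule lipschitz_on_continuous_on)
qed

lemma kernel_measurable: "kernel R L f \<Longrightarrow> f \<in> borel_measurable borel"
  by (rule borel_measurable_continuous_onI) (rule kernel_continuous)

text \<open>Differences \<open>f t - f (t - v)\<close> of kernels act as kernels too; for them the
  sup bound, proportional to \<open>norm v\<close>, is the information that counts.\<close>

definition bsupp :: "real \<Rightarrow> real \<Rightarrow> (real^'n::finite \<Rightarrow> real) \<Rightarrow> bool" where
  "bsupp R L f \<longleftrightarrow> f \<in> borel_measurable borel \<and> (\<forall>x. R < norm x \<longrightarrow> f x = 0) \<and> (\<forall>x. \<bar>f x\<bar> \<le> L)"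

lemma kernel_bsupp: "kernel R L f \<Longrightarrow> bsupp R L f"
  using kernel_measurable by (auto simp: bsupp_def kernel_def)

lemma bsupp_le:
  assumes k: "bsupp R L f" and a: "0 < a"
  shows "ennreal \<bar>f (a *\<^sub>R (y - x))\<bar> \<le> ennreal L * indicator (cball x (R / a)) y"
proof (cases "y \<in> cball x (R / a)")
  case True
  have "\<bar>f (a *\<^sub>R (y - x))\<bar> \<le> L" using k by (simp add: bsupp_def)
  then show ?thesis using True by (simp add: ennreal_leI)
next
  case False
  then have "R < a * norm (y - x)" using a by (simp add: dist_norm norm_minus_commute pos_le_divide_eq
      not_le mult.commute)
  then have "R < norm (a *\<^sub>R (y - x))" using a by (simp only: norm_scaleR abs_of_pos)
  then show ?thesis using k by (simp add: bsupp_def)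
qed

lemma locint_bsupp_integrable:
  assumes U: "locint U" and k: "bsupp R L f" and a: "0 < a"
  shows "integrable lborel (\<lambda>y. U y * f (a *\<^sub>R (y - x)))"
    and locint_bsupp_bound: "ennreal \<bar>LINT y|lborel. U y * f (a *\<^sub>R (y - x))\<bar>
      \<le> ennreal L * (\<integral>\<^sup>+y\<in>cball x (R / a). ennreal \<bar>U y\<bar> \<partial>lborel)"
proof -
  have [measurable]: "f \<in> borel_measurable borel" using k by (simp add: bsupp_def)
  have [measurable]: "U \<in> borel_measurable borel" using U by (simp add: locint_def)
  have "ennreal (norm (U y * f (a *\<^sub>R (y - x)))) \<le> ennreal L * (ennreal \<bar>U y\<bar>
      * indicator (cball x (R / a)) y)" for y
    using mult_left_mono[OF bsupp_le[OF k a, of y x], of "ennreal \<bar>U y\<bar>"]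
    by (simp add: abs_mult ennreal_mult ac_simps)
  then have "(\<integral>\<^sup>+y. ennreal (norm (U y * f (a *\<^sub>R (y - x)))) \<partial>lborel)
     \<le> (\<integral>\<^sup>+y. ennreal L * (ennreal \<bar>U y\<bar> * indicator (cball x (R / a)) y) \<partial>lborel)"
    by (intro nn_integral_mono)
  also have "\<dots> = ennreal L * (\<integral>\<^sup>+y\<in>cball x (R / a). ennreal \<bar>U y\<bar> \<partial>lborel)"
    by (simp add: nn_integral_cmult)
  finally have le: "(\<integral>\<^sup>+y. ennreal (norm (U y * f (a *\<^sub>R (y - x)))) \<partial>lborel)
    \<le> ennreal L * (\<integral>\<^sup>+y\<in>cball x (R / a). ennreal \<bar>U y\<bar> \<partial>lborel)" .
  also have "\<dots> < \<infinity>" using U by (simp add: locint_def ennreal_mult_less_top)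
  finally show int: "integrable lborel (\<lambda>y. U y * f (a *\<^sub>R (y - x)))" by (intro integrableI_bounded) auto
  have "ennreal \<bar>LINT y|lborel. U y * f (a *\<^sub>R (y - x))\<bar> \<le> (\<integral>\<^sup>+y. ennreal (norm (U y
      * f (a *\<^sub>R (y - x)))) \<partial>lborel)"
    using integral_norm_bound_ennreal[OF int] by simp
  then show "ennreal \<bar>LINT y|lborel. U y * f (a *\<^sub>R (y - x))\<bar>
      \<le> ennreal L * (\<integral>\<^sup>+y\<in>cball x (R / a). ennreal \<bar>U y\<bar> \<partial>lborel)"
    using le by (rule order_trans)
qed

lemmas locint_kernel_integrable = locint_bsupp_integrable[OF _ kernel_bsupp]

text \<open>\<open>V i\<close> is the weak pure derivative of order \<open>N\<close> of
  \<open>U\<close> in direction \<open>i\<close>. Mixed derivatives do not occur, since the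
  telescoping kernel splits coordinate by coordinate.\<close>

definition pure_derivs :: "nat \<Rightarrow> (real^'n::finite \<Rightarrow> real) \<Rightarrow> ('n \<Rightarrow> real^'n \<Rightarrow> real) \<Rightarrow> bool" where
  "pure_derivs N U V \<longleftrightarrow> (\<forall>i \<phi>. test_function \<phi> \<longrightarrow>
     (LINT y|lborel. U y * partials (replicate N i) \<phi> y) = (-1) ^ N * (LINT y|lborel. V i y * \<phi> y))"

text \<open>Replacing the factors \<eta>(t) by 2 \<eta>(2t) one coordinate at a time writes the
  difference of consecutive kernels as a sum over \<open>i\<close> of tensor products with
  \<open>(deriv ^^ Suc N) \<zeta>\<close> in slot \<open>i\<close>. Of these derivatives
  \<open>N\<close> are moved to \<open>U\<close> by \<open>pure_derivs\<close>; the last one stays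
  and gives \<open>\<kappa> i\<close> mean zero. Rescaling by \<open>a\<close> and the signs of the
  integration by parts yield \<open>(- 1 / a) ^ N\<close>.\<close>

lemma kernel_package:
  fixes N :: nat
  obtains \<Phi> :: "real^'n::finite \<Rightarrow> real" and \<kappa> :: "'n \<Rightarrow> real^'n \<Rightarrow> real" and R L :: real
  where "1 \<le> R" "1 \<le> L" "kernel R L \<Phi>" "\<And>i. kernel R L (\<kappa> i)"
    "(LINT x|lborel. \<Phi> x) = 1" "\<And>i. (LINT x|lborel. \<kappa> i x) = 0"
    "\<And>U V a x. 0 < a \<Longrightarrow> locint U \<Longrightarrow> pure_derivs N U V \<Longrightarrow>
      (LINT y|lborel. U y * (2 ^ CARD('n) * \<Phi> ((2 * a) *\<^sub>R (y - x)) - \<Phi> (a *\<^sub>R (y - x))))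
        = (\<Sum>i\<in>UNIV. (- 1 / a) ^ N * (LINT y|lborel. V i y * \<kappa> i (a *\<^sub>R (y - x))))"
proof -
  let ?n = "CARD('n)"
  obtain \<eta> \<zeta> where \<eta>: "smooth1 \<eta>" and \<zeta>: "smooth1 \<zeta>" and supp: "\<And>t. 1 < \<bar>t\<bar> \<Longrightarrow> \<eta> t = 0" "\<And>t. 1 < \<bar>t\<bar> \<Longrightarrow> \<zeta> t = 0"
    and int: "(LINT t|lborel. \<eta> t) = 1" and tel: "\<And>t. 2 * \<eta> (2 * t) - \<eta> t = (deriv ^^ Suc N) \<zeta> t"
    using kernel1[of N] by blast
  define \<eta>2 where "\<eta>2 t = 2 * \<eta> (2 * t) + 0 * \<eta> t" for t
  have \<eta>2: "smooth1 \<eta>2" unfolding \<eta>2_def by (intro smooth1_lincomb smooth1_double \<eta>)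
  have supp2: "\<eta>2 t = 0" if "1 < \<bar>t\<bar>" for t using that supp(1)[of "2 * t"] by (simp add: \<eta>2_def abs_mult)
  have suppd: "deriv \<zeta> t = 0" if "1 < \<bar>t\<bar>" for t
  proof (rule DERIV_imp_deriv)
    show "(\<zeta> has_real_derivative 0) (at t)"
    proof (rule has_field_derivative_transform_within_open[of "\<lambda>_. 0" _ _ "- {-1..1}"])
      show "t \<in> - {-1..1}" using that by auto
    qed (use supp in \<open>auto simp: not_le abs_if\<close>)
  qed
  let ?ok = "\<lambda>G. \<forall>i k. smooth1 (G i k) \<and> (\<forall>t. 1 < \<bar>t\<bar> \<longrightarrow> G i k t = 0)"
  have "\<exists>G :: 'n \<Rightarrow> 'n \<Rightarrow> real \<Rightarrow> real. ?ok G \<and> (\<forall>x. tens (\<lambda>k. if k \<in> S then \<eta>2 else \<eta>) x - tens (\<lambda>_. \<eta>) x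
      = (\<Sum>i\<in>S. tens ((G i)(i := (deriv ^^ Suc N) \<zeta>)) x))" if "finite S" for S :: "'n set"
    using that
  proof (induction S)
    case empty
    then show ?case using \<eta> supp by (intro exI[of _ "\<lambda>_ _. \<eta>"]) auto
  next
    case (insert i S)
    then obtain G :: "'n \<Rightarrow> 'n \<Rightarrow> real \<Rightarrow> real" where G: "?ok G"
      "\<And>x. tens (\<lambda>k. if k \<in> S then \<eta>2 else \<eta>) x - tens (\<lambda>_. \<eta>) x
      = (\<Sum>i\<in>S. tens ((G i)(i := (deriv ^^ Suc N) \<zeta>)) x)" by blast
    let ?g = "\<lambda>k. if k \<in> S then \<eta>2 else \<eta>"
    have "tens (\<lambda>k. if k \<in> insert i S then \<eta>2 else \<eta>) x - tens (\<lambda>_. \<eta>) x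
      = (\<Sum>j\<in>insert i S. tens (((G(i := ?g)) j)(j := (deriv ^^ Suc N) \<zeta>)) x)" for x
    proof -
      have e1: "(\<lambda>k. if k \<in> insert i S then \<eta>2 else \<eta>) = ?g(i := \<eta>2)" by auto
      have e2: "?g = ?g(i := \<eta>)" using insert by auto
      have "tens (\<lambda>k. if k \<in> insert i S then \<eta>2 else \<eta>) x - tens ?g x = tens (?g(i := (deriv ^^ Suc N) \<zeta>)) x"
        unfolding e1 by (subst (2) e2) (simp add: tens_upd tel[symmetric] \<eta>2_def left_diff_distrib del:
            funpow.simps)
      moreover have "(\<Sum>j\<in>S. tens (((G(i := ?g)) j)(j := (deriv ^^ Suc N) \<zeta>)) x)
          = (\<Sum>j\<in>S. tens ((G j)(j := (deriv ^^ Suc N) \<zeta>)) x)"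
        using insert by (intro sum.cong) auto
      ultimately show ?thesis using insert G(2)[of x] by (simp del: funpow.simps)
    qed
    moreover have "?ok (G(i := ?g))" using G(1) \<eta> \<eta>2 supp supp2 by auto
    ultimately show ?case by blast
  qed
  from this[of UNIV] obtain G :: "'n \<Rightarrow> 'n \<Rightarrow> real \<Rightarrow> real" where G: "?ok G"
      "\<And>x. tens (\<lambda>k. \<eta>2) x - tens (\<lambda>_. \<eta>) x = (\<Sum>i\<in>UNIV. tens ((G i)(i := (deriv ^^ Suc N) \<zeta>)) x)"
    by auto
  define \<Phi> :: "real^'n \<Rightarrow> real" where "\<Phi> = tens (\<lambda>_. \<eta>)"
  \<comment> \<open>Slot \<open>i\<close> with \<open>N\<close> of its \<open>Suc N\<close>
    derivatives removed.\<close>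
  define H where "H i = (G i)(i := deriv \<zeta>)" for i
  define \<kappa> where "\<kappa> i = tens (H i)" for i
  have H: "smooth1 (H i k)" "1 < \<bar>t\<bar> \<Longrightarrow> H i k t = 0" for i k t
    using G(1) \<zeta> suppd by (auto simp: H_def intro: smooth1_deriv)
  have \<Phi>2: "2 ^ ?n * \<Phi> (2 *\<^sub>R x) = tens (\<lambda>_. \<eta>2) x" for x
    by (simp add: \<Phi>_def tens_def \<eta>2_def prod.distrib)
  obtain L0 where L0: "kernel (real ?n) L0 \<Phi>" using kernel_tens[of "\<lambda>_. \<eta>"] \<eta> supp unfolding \<Phi>_def by blast
  have "\<exists>L. kernel (real ?n) L (\<kappa> i)" for i unfolding \<kappa>_def by (rule kernel_tens) (use H in auto)
  then obtain l where l: "\<And>i. kernel (real ?n) (l i) (\<kappa> i)" by metis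
  define L where "L = Max (insert 1 (insert L0 (range l)))"
  have L: "1 \<le> L" "L0 \<le> L" "\<And>i. l i \<le> L" unfolding L_def by (rule Max_ge; simp)+
  show thesis
  proof (rule that[of "real ?n" L \<Phi> \<kappa>])
    show "1 \<le> real ?n" by (simp add: Suc_le_eq)
    show "kernel (real ?n) L \<Phi>" "kernel (real ?n) L (\<kappa> i)" for i
      using kernel_mono[OF L0 order_refl L(2)] kernel_mono[OF l order_refl L(3)] by auto
    have ib: "integrable lborel f" if "smooth1 f" "\<And>t. 1 < \<bar>t\<bar> \<Longrightarrow> f t = 0" for f :: "real \<Rightarrow> real"
      using smooth1_continuous[OF that(1)] that(2) by (rule integrable_compact_support1)
    show "(LINT x|lborel. \<Phi> x) = 1"
      unfolding \<Phi>_def by (subst lborel_integral_tens) (auto intro: ib \<eta> supp simp: int)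
    fix i
    \<comment> \<open>The interval reaches beyond \<open>{-1..1}\<close>, so that
      \<open>\<zeta>\<close> vanishes at both ends by \<open>supp\<close>.\<close>
    have "(\<integral>x. deriv \<zeta> x * indicator {-2..2} x \<partial>lborel) = \<zeta> 2 - \<zeta> (-2)"
      by (rule integral_FTC_Icc_real) (use smooth1_DERIV[OF \<zeta>] smooth1_continuous[OF smooth1_deriv[OF \<zeta>],
          of UNIV]
            in \<open>auto simp: continuous_on_eq_continuous_at\<close>)
    moreover have "(\<lambda>x. deriv \<zeta> x * indicator {-2..2} x) = deriv \<zeta>"
    proof
      fix t show "deriv \<zeta> t * indicator {-2..2} t = deriv \<zeta> t"
        using suppd[of t] by (cases "1 < \<bar>t\<bar>") (auto simp: indicator_def)
    qed
    ultimately have z: "(LINT t|lborel. H i i t) = 0" using supp by (simp add: H_def)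
    show "(LINT x|lborel. \<kappa> i x) = 0"
      unfolding \<kappa>_def using z
      by (subst lborel_integral_tens) (auto intro!: ib H prod_zero simp: exI[of _ i])
  next
    fix U :: "real^'n \<Rightarrow> real" and V and a :: real and x :: "real^'n"
    assume a: "0 < a" and U: "locint U" and UV: "pure_derivs N U V"
    let ?\<psi> = "\<lambda>i y. tens ((G i)(i := (deriv ^^ Suc N) \<zeta>)) (a *\<^sub>R (y - x))"
    define T where "T i k t = H i k (a * (t - x $ k))" for i k t
    have Ts: "smooth1 (T i k)" for i k unfolding T_def by (intro smooth1_affine H)
    \<comment> \<open>\<open>test_function_tens\<close> asks for one radius valid in all
      coordinates; the sum of all absolute coordinates dominates each centre
      \<open>x $ k\<close>.\<close>
    have Tb: "T i k t = 0" if "(\<Sum>k\<in>UNIV. \<bar>x $ k\<bar>) + 1 / a < \<bar>t\<bar>" for i k t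
    proof -
      have "\<bar>x $ k\<bar> \<le> (\<Sum>k\<in>UNIV. \<bar>x $ k\<bar>)" by (rule member_le_sum) auto
      then have "1 / a < \<bar>t - x $ k\<bar>" using that by linarith
      then have "1 < a * \<bar>t - x $ k\<bar>" using a by (simp add: pos_divide_less_eq mult.commute)
      then have "1 < \<bar>a * (t - x $ k)\<bar>" using a by (simp only: abs_mult abs_of_pos)
      then show ?thesis unfolding T_def by (rule H)
    qed
    have Tt: "tens (T i) y = \<kappa> i (a *\<^sub>R (y - x))" for i y
      by (simp add: tens_def T_def \<kappa>_def)
    have part: "partials (replicate N i) (tens (T i)) y = a ^ N * ?\<psi> i y" for i y
    proof -
      have "(deriv ^^ N) (T i i) = (\<lambda>t. a ^ N * (deriv ^^ Suc N) \<zeta> (a * (t - x $ i)))"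
        unfolding T_def funpow_deriv_affine[OF H(1)]
        by (simp only: H_def fun_upd_same funpow_Suc_right o_apply)
      then show ?thesis
        unfolding partials_replicate_tens[of "T i", OF Ts]
            by (simp add: tens_upd T_def H_def del: funpow.simps)
    qed
    have ibp: "(LINT y|lborel. U y * ?\<psi> i y) = (- 1 / a) ^ N * (LINT y|lborel. V i y
        * \<kappa> i (a *\<^sub>R (y - x)))" for i
    proof -
      have "test_function (tens (T i))" by (rule test_function_tens[OF Ts Tb])
      then have "(LINT y|lborel. U y * (a ^ N * ?\<psi> i y)) = (-1) ^ N * (LINT y|lborel. V i y
          * \<kappa> i (a *\<^sub>R (y - x)))"
        using UV unfolding pure_derivs_def part[symmetric] Tt[symmetric] by blast
      then have "a ^ N * (LINT y|lborel. U y * ?\<psi> i y) = (-1) ^ N * (LINT y|lborel. V i y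
          * \<kappa> i (a *\<^sub>R (y - x)))"
        by (simp add: mult.left_commute[of _ "a ^ N"] del: funpow.simps)
      moreover have ne: "a ^ N \<noteq> 0" using a by simp
      ultimately show ?thesis
        unfolding power_divide times_divide_eq_left nonzero_eq_divide_eq[OF ne] by (simp only: mult.commute)
    qed
    have k: "\<exists>L. kernel (real ?n) L (tens ((G i)(i := (deriv ^^ Suc N) \<zeta>)))" for i
    proof (rule kernel_tens)
      fix k show "smooth1 (((G i)(i := (deriv ^^ Suc N) \<zeta>)) k)"
        using G(1) smooth1_funpow_deriv[OF \<zeta>] by (auto simp del: funpow.simps)
      fix t :: real assume "1 < \<bar>t\<bar>"
      \<comment> \<open>Slot \<open>i\<close> vanishes there by the telescoping identity, whose
        other side is supported in \<open>{-1..1}\<close>.\<close>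
      then show "((G i)(i := (deriv ^^ Suc N) \<zeta>)) k t = 0"
        using G(1) tel[of t] supp2[of t] supp(1)[of t] by (auto simp: \<eta>2_def simp del: funpow.simps)
    qed
    have "(LINT y|lborel. U y * (2 ^ ?n * \<Phi> ((2 * a) *\<^sub>R (y - x)) - \<Phi> (a *\<^sub>R (y - x))))
       = (LINT y|lborel. (\<Sum>i\<in>UNIV. U y * ?\<psi> i y))"
    proof (intro Bochner_Integration.integral_cong refl)
      fix y
      have "2 ^ ?n * \<Phi> ((2 * a) *\<^sub>R (y - x)) - \<Phi> (a *\<^sub>R (y - x)) = (\<Sum>i\<in>UNIV. ?\<psi> i y)"
        using \<Phi>2[of "a *\<^sub>R (y - x)"] G(2)[of "a *\<^sub>R (y - x)"] by (simp add: \<Phi>_def del: funpow.simps)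
      then show "U y * (2 ^ ?n * \<Phi> ((2 * a) *\<^sub>R (y - x)) - \<Phi> (a *\<^sub>R (y - x))) = (\<Sum>i\<in>UNIV. U y * ?\<psi> i y)"
        by (simp add: sum_distrib_left del: funpow.simps)
    qed
    also have "\<dots> = (\<Sum>i\<in>UNIV. LINT y|lborel. U y * ?\<psi> i y)"
    proof (intro Bochner_Integration.integral_sum)
      fix i
      obtain L where "kernel (real ?n) L (tens ((G i)(i := (deriv ^^ Suc N) \<zeta>)))" using k[of i] by blast
      then show "integrable lborel (\<lambda>y. U y * ?\<psi> i y)" by (rule locint_kernel_integrable[OF U _ a])
    qed
    finally show "(LINT y|lborel. U y * (2 ^ ?n * \<Phi> ((2 * a) *\<^sub>R (y - x)) - \<Phi> (a *\<^sub>R (y - x))))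
        = (\<Sum>i\<in>UNIV. (- 1 / a) ^ N * (LINT y|lborel. V i y * \<kappa> i (a *\<^sub>R (y - x))))"
      by (simp only: ibp)
  qed (use L in auto)
qed

section \<open>Mollification\<close>

text \<open>By linearity and L1 limits it is enough to treat indicators. Outer regularity encloses
  the set in an open \<open>W\<close> of almost the same measure, and the functions
  \<open>min 1 (k * infdist x (- W))\<close> increase to the indicator of \<open>W\<close>.\<close>

lemma ex_continuous_L1_approx:
  fixes f :: "'a::euclidean_space \<Rightarrow> real"
  assumes "integrable lborel f" "0 < e"
  shows "\<exists>g. continuous_on UNIV g \<and> integrable lborel g \<and> (\<integral>x. \<bar>f x - g x\<bar> \<partial>lborel) < e"
proof -
  have approx_trans: "\<exists>g. continuous_on UNIV g \<and> integrable lborel g \<and> (\<integral>x. \<bar>f x - g x\<bar> \<partial>lborel) < e"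
    if hyp: "integrable lborel f" "integrable lborel h" "(\<integral>x. \<bar>f x - h x\<bar> \<partial>lborel) < e / 2"
      "\<exists>g. continuous_on UNIV g \<and> integrable lborel g \<and> (\<integral>x. \<bar>h x - g x\<bar> \<partial>lborel) < e / 2"
    for f h :: "'a \<Rightarrow> real" and e
  proof -
    obtain g where g: "continuous_on UNIV g" "integrable lborel g" "(\<integral>x. \<bar>h x - g x\<bar> \<partial>lborel) < e / 2"
      using hyp(4) by blast
    have "(\<integral>x. \<bar>f x - g x\<bar> \<partial>lborel) \<le> (\<integral>x. \<bar>f x - h x\<bar> + \<bar>h x - g x\<bar> \<partial>lborel)"
      using hyp(1,2) g by (intro integral_mono) auto
    also have "\<dots> = (\<integral>x. \<bar>f x - h x\<bar> \<partial>lborel) + (\<integral>x. \<bar>h x - g x\<bar> \<partial>lborel)"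
      using hyp(1,2) g by (intro Bochner_Integration.integral_add) auto
    finally have "(\<integral>x. \<bar>f x - g x\<bar> \<partial>lborel) < e" using hyp(3) g(3) by linarith
    then show ?thesis using g by blast
  qed
  have "\<forall>e>0. \<exists>g. continuous_on UNIV g \<and> integrable lborel g \<and> (\<integral>x. \<bar>f x - g x\<bar> \<partial>lborel) < e"
    using assms(1)
  proof (induction rule: integrable_induct)
    case (base A c)
    show ?case
    proof (intro allI impI)
      fix e :: real assume e: "0 < e"
      \<comment> \<open>The summand 1 covers the coefficient \<open>c = 0\<close>, and the factor 2
        makes room for two errors of size \<open>e'\<close>.\<close>
      define e' where "e' = e / (2 * (\<bar>c\<bar> + 1))"
      have e': "0 < e'" using e by (simp add: e'_def add_pos_nonneg)
      have A: "A \<in> sets borel" using base by simp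
      obtain W where W: "open W" "A \<subseteq> W" "emeasure lborel (W - A) < ennreal e'"
        using outer_regular_lborel[OF A e'] by blast
      have "emeasure lborel W \<le> emeasure lborel A + emeasure lborel (W - A)"
        using W A emeasure_subadditive[of A lborel "W - A"] by (simp add: Un_absorb1)
      also have "\<dots> < \<infinity>" using base W(3) by (auto simp: less_top intro: order.strict_trans)
      finally have Wfin: "emeasure lborel W < \<infinity>" .
      have [measurable]: "W \<in> sets borel" using W by simp
      \<comment> \<open>The distance to the empty set is 0 by convention, so the complement of
        \<open>W\<close> has to contain a point; it does, because \<open>W\<close> has finite
        measure.\<close>
      have neU: "- W \<noteq> {}"
      proof
        assume "- W = {}" then have "W = UNIV" by auto
        then show False using Wfin by simp
      qed
      have iW: "integrable lborel (indicat_real W)" using Wfin by (intro integrable_real_indicator) auto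
      have iA: "integrable lborel (indicat_real A)" using base by (intro integrable_real_indicator) auto
      define g where "g k x = min 1 (real k * infdist x (- W))" for k x
      have gcont: "continuous_on UNIV (g k)" for k
        unfolding g_def by (intro continuous_intros)
      have [measurable]: "g k \<in> borel_measurable borel" for k
        using gcont by (rule borel_measurable_continuous_onI)
      have gle: "norm (g k x) \<le> indicat_real W x" for k x
        using infdist_nonneg[of x "- W"] by (auto simp: g_def indicator_def)
      have glim: "(\<lambda>k. g k x) \<longlonglongrightarrow> indicat_real W x" for x
      proof (cases "x \<in> W")
        case True
        then have d: "0 < infdist x (- W)"
          using in_closed_iff_infdist_zero[of "- W" x] W(1) neU infdist_nonneg[of x "- W"]
              by (auto simp: closed_Compl order.strict_iff_order)
        obtain K :: nat where K: "1 / infdist x (- W) < K" using reals_Archimedean2 by blast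
        have "g k x = 1" if "K \<le> k" for k
        proof -
          have "1 / infdist x (- W) < real k" using K that by linarith
          then show ?thesis using d by (simp add: g_def field_simps)
        qed
        then have "eventually (\<lambda>k. g k x = 1) sequentially" by (auto simp: eventually_sequentially)
        then show ?thesis using True by (simp add: tendsto_eventually)
      next
        case False
        then show ?thesis by (simp add: g_def)
      qed
      have ig: "integrable lborel (g k)" for k
        by (rule Bochner_Integration.integrable_bound[OF iW]) (use gle in \<open>auto simp: indicator_def\<close>)
      have "(\<lambda>k. \<integral>x. \<bar>indicat_real W x - g k x\<bar> \<partial>lborel) \<longlonglongrightarrow> (\<integral>x. 0 \<partial>(lborel :: 'a measure))"
      proof (rule integral_dominated_convergence[where w = "\<lambda>x. 2 * indicat_real W x"])
        show "AE x in lborel. (\<lambda>k. \<bar>indicat_real W x - g k x\<bar>) \<longlonglongrightarrow> 0"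
          using tendsto_rabs_zero[OF Lim_null[THEN iffD1, OF glim]] by (simp add: abs_minus_commute)
        show "AE x in lborel. norm \<bar>indicat_real W x - g k x\<bar> \<le> 2 * indicat_real W x" for k
          using gle[of k] by (intro AE_I2) (auto simp: indicator_def abs_le_iff)
      qed (use iW in auto)
      then have "eventually (\<lambda>k. (\<integral>x. \<bar>indicat_real W x - g k x\<bar> \<partial>lborel) < e') sequentially"
        using e' by (intro order_tendstoD(2)[where a = e']) auto
      then obtain k where k: "(\<integral>x. \<bar>indicat_real W x - g k x\<bar> \<partial>lborel) < e'"
        by (auto simp: eventually_sequentially)
      have "(\<integral>x. \<bar>indicat_real A x - indicat_real W x\<bar> \<partial>lborel) = (\<integral>x. indicat_real (W - A) x \<partial>lborel)"
        using W(2) by (intro Bochner_Integration.integral_cong) (auto simp: indicator_def)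
      also have "\<dots> = measure lborel (W - A)" using A by simp
      also have "\<dots> < e'" 
      proof -
        have "emeasure lborel (W - A) = ennreal (measure lborel (W - A))"
          using W(3) by (intro emeasure_eq_ennreal_measure) auto
        then show ?thesis using W(3) by (simp add: ennreal_less_iff)
      qed
      finally have AW: "(\<integral>x. \<bar>indicat_real A x - indicat_real W x\<bar> \<partial>lborel) < e'" .
      have "(\<integral>x. \<bar>indicat_real A x - g k x\<bar> \<partial>lborel)
          \<le> (\<integral>x. \<bar>indicat_real A x - indicat_real W x\<bar> + \<bar>indicat_real W x - g k x\<bar> \<partial>lborel)"
        using iA iW ig by (intro integral_mono) auto
      also have "\<dots> = (\<integral>x. \<bar>indicat_real A x - indicat_real W x\<bar> \<partial>lborel)
          + (\<integral>x. \<bar>indicat_real W x - g k x\<bar> \<partial>lborel)"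
        using iA iW ig by (intro Bochner_Integration.integral_add) auto
      finally have Ag: "(\<integral>x. \<bar>indicat_real A x - g k x\<bar> \<partial>lborel) < 2 * e'" using AW k by linarith
      have "(\<integral>x. \<bar>indicat_real A x *\<^sub>R c - c * g k x\<bar> \<partial>lborel) = (\<integral>x. \<bar>c\<bar>
          * \<bar>indicat_real A x - g k x\<bar> \<partial>lborel)"
      proof (intro Bochner_Integration.integral_cong refl)
        fix x
        have "indicat_real A x *\<^sub>R c - c * g k x = c * (indicat_real A x - g k x)"
            by (simp add: algebra_simps)
        then show "\<bar>indicat_real A x *\<^sub>R c - c * g k x\<bar> = \<bar>c\<bar> * \<bar>indicat_real A x - g k x\<bar>"
          by (simp only: abs_mult)
      qed
      also have "\<dots> \<le> (\<bar>c\<bar> + 1) * (\<integral>x. \<bar>indicat_real A x - g k x\<bar> \<partial>lborel)"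
        by (simp add: distrib_right)
      also have "\<dots> < (\<bar>c\<bar> + 1) * (2 * e')" using Ag by (intro mult_strict_left_mono) auto
      also have "\<dots> = e" by (simp add: e'_def field_simps)
      finally show "\<exists>g. continuous_on UNIV g \<and> integrable lborel g
          \<and> (\<integral>x. \<bar>indicat_real A x *\<^sub>R c - g x\<bar> \<partial>lborel) < e"
        using gcont[of k] ig[of k] by (intro exI[of _ "\<lambda>x. c * g k x"]) (auto intro!: continuous_intros)
    qed
  next
    case (add f1 f2)
    show ?case
    proof (intro allI impI)
      fix e :: real assume "0 < e"
      then have e2: "0 < e / 2" by simp
      obtain g1 where g1: "continuous_on UNIV g1" "integrable lborel g1" "(\<integral>x. \<bar>f1 x - g1 x\<bar> \<partial>lborel) < e / 2"
        using add(3) e2 by blast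
      obtain g2 where g2: "continuous_on UNIV g2" "integrable lborel g2" "(\<integral>x. \<bar>f2 x - g2 x\<bar> \<partial>lborel) < e / 2"
        using add(4) e2 by blast
      have "(\<integral>x. \<bar>f1 x + f2 x - (g1 x + g2 x)\<bar> \<partial>lborel) \<le> (\<integral>x. \<bar>f1 x - g1 x\<bar> + \<bar>f2 x - g2 x\<bar> \<partial>lborel)"
        using add(1,2) g1(2) g2(2) by (intro integral_mono) auto
      also have "\<dots> = (\<integral>x. \<bar>f1 x - g1 x\<bar> \<partial>lborel) + (\<integral>x. \<bar>f2 x - g2 x\<bar> \<partial>lborel)"
        using add(1,2) g1(2) g2(2) by (intro Bochner_Integration.integral_add) auto
      finally show "\<exists>g. continuous_on UNIV g \<and> integrable lborel g \<and> (\<integral>x. \<bar>f1 x + f2 x - g x\<bar> \<partial>lborel) < e"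
        using g1 g2 by (intro exI[of _ "\<lambda>x. g1 x + g2 x"]) (auto intro!: continuous_intros)
    qed
  next
    case (lim f s)
    show ?case
    proof (intro allI impI)
      fix e :: real assume e: "0 < e"
      have "(\<lambda>i. \<integral>x. \<bar>f x - s i x\<bar> \<partial>lborel) \<longlonglongrightarrow> (\<integral>x. 0 \<partial>(lborel :: 'a measure))"
      proof (rule integral_dominated_convergence[where w = "\<lambda>x. 3 * norm (f x)"])
        show "AE x in lborel. (\<lambda>i. \<bar>f x - s i x\<bar>) \<longlonglongrightarrow> 0"
        proof (intro AE_I2)
          fix x :: 'a assume "x \<in> space lborel"
          then have "(\<lambda>i. s i x) \<longlonglongrightarrow> f x" using lim(2) by simp
          then have "(\<lambda>i. f x - s i x) \<longlonglongrightarrow> f x - f x" by (intro tendsto_intros)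
          then show "(\<lambda>i. \<bar>f x - s i x\<bar>) \<longlonglongrightarrow> 0" by (simp add: tendsto_rabs_zero)
        qed
        show "AE x in lborel. norm \<bar>f x - s i x\<bar> \<le> 3 * norm (f x)" for i
        proof (intro AE_I2)
          fix x :: 'a assume "x \<in> space lborel"
          then have "norm (s i x) \<le> 2 * norm (f x)" using lim(3) by simp
          then show "norm \<bar>f x - s i x\<bar> \<le> 3 * norm (f x)"
            using norm_triangle_ineq4[of "f x" "s i x"] by simp
        qed
        show "integrable lborel (\<lambda>x. 3 * norm (f x))" using lim(4) by simp
      qed (use lim(1,4) in auto)
      then have "eventually (\<lambda>i. (\<integral>x. \<bar>f x - s i x\<bar> \<partial>lborel) < e / 2) sequentially"
        using e by (intro order_tendstoD(2)[where a = "e / 2"]) auto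
      then obtain i where "(\<integral>x. \<bar>f x - s i x\<bar> \<partial>lborel) < e / 2"
        by (auto simp: eventually_sequentially)
      moreover have "\<exists>g. continuous_on UNIV g \<and> integrable lborel g \<and> (\<integral>x. \<bar>s i x - g x\<bar> \<partial>lborel) < e / 2"
        using lim(5)[of i] half_gt_zero[OF e] by blast
      ultimately show "\<exists>g. continuous_on UNIV g \<and> integrable lborel g \<and> (\<integral>x. \<bar>f x - g x\<bar> \<partial>lborel) < e"
        using approx_trans[OF lim(4) lim(1)] by blast
    qed
  qed
  then show ?thesis using assms(2) by blast
qed

section \<open>Dyadic mollifications and their increments\<close>

definition mol :: "(real^'n::finite \<Rightarrow> real) \<Rightarrow> nat \<Rightarrow> (real^'n \<Rightarrow> real) \<Rightarrow> real^'n \<Rightarrow> real" where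
  "mol f j U x = (2 ^ j) ^ CARD('n) * (LINT y|lborel. U y * f ((2 ^ j) *\<^sub>R (y - x)))"

lemma lborel_integral_scale:
  fixes f :: "real^'n::finite \<Rightarrow> real"
  assumes [measurable]: "f \<in> borel_measurable borel" and a: "0 < a"
  shows "a ^ CARD('n) * (LINT y|lborel. f (a *\<^sub>R (y - x))) = (LINT y|lborel. f y)"
proof -
  have "(LINT y|lborel. f (a *\<^sub>R (y - x)))
    = (LINT y|density (distr lborel borel (\<lambda>y. x + (1 / a) *\<^sub>R y)) (\<lambda>_. ennreal (\<bar>1 / a\<bar> ^ DIM(real^'n))).
        f (a *\<^sub>R (y - x)))"
    using a by (subst lborel_affine[of "1 / a" x]) auto
  also have "\<dots> = (LINT y|distr lborel borel (\<lambda>y. x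
      + (1 / a) *\<^sub>R y). (1 / a) ^ CARD('n) *\<^sub>R f (a *\<^sub>R (y - x)))"
    using a by (subst integral_density) auto
  also have "\<dots> = (LINT y|lborel. (1 / a) ^ CARD('n) * f y)"
    using a by (subst integral_distr) auto
  finally show ?thesis using a by (simp add: power_divide)
qed

lemma locint_shift:
  assumes "locint V" shows "locint (\<lambda>y. V y - c)"
  unfolding locint_def
proof (intro conjI allI)
  have [measurable]: "V \<in> borel_measurable borel" using assms by (simp add: locint_def)
  show "(\<lambda>y. V y - c) \<in> borel_measurable borel" by measurable
  fix x r
  have "(\<integral>\<^sup>+y\<in>cball x r. ennreal \<bar>V y - c\<bar> \<partial>lborel)
     \<le> (\<integral>\<^sup>+y. ennreal \<bar>V y\<bar> * indicator (cball x r) y + ennreal \<bar>c\<bar> * indicator (cball x r) y \<partial>lborel)"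
    by (intro nn_integral_mono) (auto simp: indicator_def ennreal_plus[symmetric] simp del: ennreal_plus
        intro!: ennreal_leI)
  also have "\<dots> = (\<integral>\<^sup>+y\<in>cball x r. ennreal \<bar>V y\<bar> \<partial>lborel) + ennreal \<bar>c\<bar> * emeasure lborel (cball x r)"
    by (simp add: nn_integral_add nn_integral_cmult_indicator)
  also have "\<dots> < \<infinity>"
    using assms emeasure_lborel_cball_finite[of x r] by (auto simp: locint_def ennreal_mult_less_top)
  finally show "(\<integral>\<^sup>+y\<in>cball x r. ennreal \<bar>V y - c\<bar> \<partial>lborel) < \<infinity>" .
qed

text \<open>For a kernel of mean zero one may subtract \<open>V z\<close> from \<open>V\<close>; averaging over \<open>z\<close> in the support of
  the kernel gives a bound by a mean oscillation.\<close>

lemma mol_mean_zero_le: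
  fixes V :: "real^'n::finite \<Rightarrow> real"
  assumes f: "bsupp R L f" and f0: "(LINT y|lborel. f y) = 0" and R: "0 < R" and L: "0 \<le> L" and V: "locint V"
    and d: "case_prod d \<in> borel_measurable (borel \<Otimes>\<^sub>M borel)" "\<And>y z. \<bar>V y - V z\<bar> \<le> d y z"
  shows "ennreal \<bar>mol f j V x\<bar> \<le> ennreal (L / (ball_vol TYPE('n) * R ^ CARD('n)) * ((2 ^ j) ^ CARD('n))^2)
      * osc d (R / 2 ^ j) x"
proof -
  let ?a = "2 ^ j :: real" and ?n = "CARD('n)"
  let ?B = "cball x (R / ?a)"
  let ?I = "LINT y|lborel. V y * f (?a *\<^sub>R (y - x))"
  define v where "v = ball_vol TYPE('n) * (R / ?a) ^ ?n"
  have v: "0 < v" "emeasure lborel ?B = ennreal v" using R by (auto simp: v_def emeasure_cball_cart)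
  note [measurable] = d(1)
  have [measurable]: "f \<in> borel_measurable borel" using f by (simp add: bsupp_def)
  have I: "ennreal \<bar>?I\<bar> \<le> ennreal L * (\<integral>\<^sup>+y\<in>?B. ennreal (d y z) \<partial>lborel)" for z
  proof -
    have "integrable lborel (\<lambda>y. V y * f (?a *\<^sub>R (y - x)))" by (rule locint_bsupp_integrable[OF V f]) simp
    moreover have "integrable lborel (\<lambda>y. V z * f (?a *\<^sub>R (y - x)))"
      by (rule locint_bsupp_integrable[of "\<lambda>_. V z", OF _ f]) (use locint_shift[of "\<lambda>_. 0" "- V z"] in \<open>auto simp: locint_def\<close>)
    moreover have "(LINT y|lborel. V z * f (?a *\<^sub>R (y - x))) = 0"
      using lborel_integral_scale[of f ?a x] f0 by simp
    ultimately have "?I = (LINT y|lborel. (V y - V z) * f (?a *\<^sub>R (y - x)))"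
      by (simp add: left_diff_distrib)
    also have "ennreal \<bar>\<dots>\<bar> \<le> ennreal L * (\<integral>\<^sup>+y\<in>?B. ennreal \<bar>V y - V z\<bar> \<partial>lborel)"
      by (rule locint_bsupp_bound[OF locint_shift[OF V] f]) simp
    also have "\<dots> \<le> ennreal L * (\<integral>\<^sup>+y\<in>?B. ennreal (d y z) \<partial>lborel)"
      using d(2) by (intro mult_left_mono nn_integral_mono mult_right_mono ennreal_leI) auto
    finally show ?thesis .
  qed
  have "ennreal \<bar>?I\<bar> * ennreal v = (\<integral>\<^sup>+z. ennreal \<bar>?I\<bar> * indicator ?B z \<partial>lborel)"
    using v by (simp add: nn_integral_cmult_indicator)
  also have "\<dots> \<le> (\<integral>\<^sup>+z. (ennreal L * (\<integral>\<^sup>+y\<in>?B. ennreal (d y z) \<partial>lborel)) * indicator ?B z \<partial>lborel)"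
    by (intro nn_integral_mono mult_right_mono I) auto
  also have "\<dots> = ennreal L * osc d (R / ?a) x"
    unfolding osc_def by (simp add: nn_integral_cmult mult.assoc)
  finally have Iv: "ennreal \<bar>?I\<bar> * ennreal v \<le> ennreal L * osc d (R / ?a) x" .
  have "ennreal \<bar>mol f j V x\<bar> = ennreal (?a ^ ?n / v) * (ennreal \<bar>?I\<bar> * ennreal v)"
    using v by (simp add: mol_def abs_mult ennreal_mult[symmetric])
  also have "\<dots> \<le> ennreal (?a ^ ?n / v) * (ennreal L * osc d (R / ?a) x)"
    by (intro mult_left_mono Iv) auto
  also have "\<dots> = ennreal (?a ^ ?n / v * L) * osc d (R / ?a) x"
    using v L by (subst ennreal_mult) (auto simp: mult.assoc)
  also have "?a ^ ?n / v * L = L / (ball_vol TYPE('n) * R ^ ?n) * (?a ^ ?n)^2"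
    by (simp add: v_def power_divide power2_eq_square)
  finally show ?thesis .
qed

lemma bsupp_mono:
  assumes "bsupp R L f" "R \<le> R'" "L \<le> L'" shows "bsupp R' L' f"
  using assms unfolding bsupp_def by (meson dual_order.strict_trans2 dual_order.trans)

lemma bsupp_diff_translate:
  assumes k: "kernel R L f" and v: "norm v \<le> 1"
  shows "bsupp (R + 1) (L * norm v) (\<lambda>t. f t - f (t - v))"
  unfolding bsupp_def
proof (intro conjI allI impI)
  note [measurable] = kernel_measurable[OF k]
  show "(\<lambda>t. f t - f (t - v)) \<in> borel_measurable borel" by measurable
  fix t
  show "\<bar>f t - f (t - v)\<bar> \<le> L * norm v"
  proof -
    have "\<bar>f t - f (t - v)\<bar> \<le> L * norm (t - (t - v))" using k unfolding kernel_def by blast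
    then show ?thesis by simp
  qed
  assume t: "R + 1 < norm t"
  have "norm t \<le> norm (t - v) + norm v" using norm_triangle_ineq[of "t - v" v] by simp
  then have "R < norm (t - v)" "R < norm t" using t v by linarith+
  then show "f t - f (t - v) = 0" using k by (simp add: kernel_def)
qed

text \<open>Moving the centre amounts to translating the kernel, so an increment of a mollification
  is a mollification by a kernel difference, which is small when the translation is.\<close>

lemma mol_diff_eq:
  assumes k: "kernel R L f" and U: "locint U"
  shows "mol f j U x - mol f j U y = mol (\<lambda>t. f t - f (t - (2 ^ j) *\<^sub>R (y - x))) j U x"
proof -
  have e: "(2 ^ j) *\<^sub>R (w - x) - (2 ^ j) *\<^sub>R (y - x) = (2 ^ j) *\<^sub>R (w - y)" for w
    by (simp add: scaleR_diff_right)
  have "integrable lborel (\<lambda>w. U w * f ((2 ^ j) *\<^sub>R (w - x)))" "integrable lborel (\<lambda>w. U w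
      * f ((2 ^ j) *\<^sub>R (w - y)))"
    by (rule locint_kernel_integrable[OF U k]; simp)+
  then show ?thesis
    unfolding mol_def e right_diff_distrib
    by (subst Bochner_Integration.integral_diff) (auto simp: right_diff_distrib)
qed

lemma integral_diff_translate:
  fixes f :: "real^'n::finite \<Rightarrow> real"
  assumes k: "kernel R L f"
  shows "(LINT t|lborel. f t - f (t - v)) = 0"
proof -
  note [measurable] = kernel_measurable[OF k]
  have one: "locint (\<lambda>_::real^'n. 1)"
    using locint_shift[of "\<lambda>_. 0" "-1"] by (auto simp: locint_def)
  have "integrable lborel (\<lambda>y. f (y - x))" for x
    using locint_kernel_integrable[OF one k, of 1 x] by simp
  from this[of 0] this[of v] have "(LINT t|lborel. f t - f (t - v))
      = (LINT t|lborel. f t) - (LINT t|lborel. f (t - v))"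
    by simp
  then show ?thesis using lborel_integral_scale[of f 1 v] by simp
qed

text \<open>If \<open>2^j * norm (x - y) \<le> 1\<close>, the kernel difference supplies this
  quantity as a factor; otherwise the triangle inequality is enough. The radius \<open>R + 1\<close>
  is used in both cases, as translated kernels reach that far.\<close>

lemma mol_mean_zero_diff_le:
  fixes V :: "real^'n::finite \<Rightarrow> real"
  assumes k: "kernel R L f" and f0: "(LINT y|lborel. f y) = 0" and R: "0 < R" and L: "0 \<le> L" and V: "locint V"
    and d: "case_prod d \<in> borel_measurable (borel \<Otimes>\<^sub>M borel)" "\<And>y z. \<bar>V y - V z\<bar> \<le> d y z"
  shows "ennreal \<bar>mol f j V x - mol f j V y\<bar>
    \<le> ennreal (min 1 (2 ^ j * norm (x - y))) * (ennreal (L / (ball_vol TYPE('n) * (R + 1) ^ CARD('n))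
        * ((2 ^ j) ^ CARD('n))^2)
        * (osc d ((R + 1) / 2 ^ j) x + osc d ((R + 1) / 2 ^ j) y))"
proof -
  let ?c = "L / (ball_vol TYPE('n) * (R + 1) ^ CARD('n)) * ((2 ^ j) ^ CARD('n))^2"
  let ?v = "(2 ^ j) *\<^sub>R (y - x)"
  have nv: "norm ?v = 2 ^ j * norm (x - y)" by (simp add: norm_minus_commute del: scaleR_right_diff_distrib)
  have R1: "0 < R + 1" using R by simp
  have c0: "0 \<le> ?c" using L R by simp
  show ?thesis
  proof (cases "norm ?v \<le> 1")
    case True
    have "ennreal \<bar>mol f j V x - mol f j V y\<bar>
        \<le> ennreal (L * norm ?v / (ball_vol TYPE('n) * (R + 1) ^ CARD('n)) * ((2 ^ j) ^ CARD('n))^2)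
            * osc d ((R + 1) / 2 ^ j) x"
      unfolding mol_diff_eq[OF k V]
      by (rule mol_mean_zero_le[OF bsupp_diff_translate[OF k True] integral_diff_translate[OF k] R1 _ V
          d]) (use L in simp)
    also have "L * norm ?v / (ball_vol TYPE('n) * (R + 1) ^ CARD('n)) * ((2 ^ j) ^ CARD('n))^2
        = min 1 (2 ^ j * norm (x - y)) * ?c"
      using True nv by simp
    also have "ennreal (min 1 (2 ^ j * norm (x - y)) * ?c) = ennreal (min 1 (2 ^ j * norm (x - y)))
        * ennreal ?c"
      using c0 by (intro ennreal_mult) auto
    finally show ?thesis
      by (rule order_trans) (auto simp: mult.assoc intro!: mult_left_mono)
  next
    case False
    have b: "bsupp (R + 1) L f" using kernel_bsupp[OF k] by (rule bsupp_mono) auto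
    have "ennreal \<bar>mol f j V x - mol f j V y\<bar> \<le> ennreal (\<bar>mol f j V x\<bar> + \<bar>mol f j V y\<bar>)"
      by (intro ennreal_leI) linarith
    also have "\<dots> = ennreal \<bar>mol f j V x\<bar> + ennreal \<bar>mol f j V y\<bar>" by simp
    also have "\<dots> \<le> ennreal ?c * osc d ((R + 1) / 2 ^ j) x + ennreal ?c * osc d ((R + 1) / 2 ^ j) y"
      by (intro add_mono mol_mean_zero_le[OF b f0 R1 L V d])
    also have "\<dots> = ennreal (min 1 (2 ^ j * norm (x - y))) * (ennreal ?c * (osc d ((R + 1) / 2 ^ j) x
        + osc d ((R + 1) / 2 ^ j) y))"
      using False nv by (simp add: distrib_left)
    finally show ?thesis .
  qed
qed

lemma mol_low_le:
  fixes U :: "real^'n::finite \<Rightarrow> real"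
  assumes f: "bsupp R L f" and U: "locint U"
  shows "ennreal \<bar>mol f 0 U x\<bar> \<le> ennreal L * (\<integral>\<^sup>+y\<in>cball x R. ennreal \<bar>U y\<bar> \<partial>lborel)"
  using locint_bsupp_bound[OF U f, of 1 x] by (simp add: mol_def)

text \<open>The coarsest scale, where the kernel need not have mean zero: the size of
  \<open>U\<close> replaces its oscillation.\<close>

lemma mol_low_diff_le:
  fixes U :: "real^'n::finite \<Rightarrow> real"
  assumes k: "kernel R L f" and U: "locint U" and L: "0 \<le> L"
  shows "ennreal \<bar>mol f 0 U x - mol f 0 U y\<bar>
     \<le> ennreal (min 1 (norm (x - y))) * (ennreal L * ((\<integral>\<^sup>+w\<in>cball x (R + 1). ennreal \<bar>U w\<bar> \<partial>lborel)
         + (\<integral>\<^sup>+w\<in>cball y (R + 1). ennreal \<bar>U w\<bar> \<partial>lborel)))"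
proof (cases "norm (y - x) \<le> 1")
  case True
  have "bsupp (R + 1) (L * norm (y - x)) (\<lambda>t. f t - f (t - (2 ^ 0) *\<^sub>R (y - x)))"
    using bsupp_diff_translate[OF k True] by simp
  from mol_low_le[OF this U, of x] have "ennreal \<bar>mol f 0 U x - mol f 0 U y\<bar>
      \<le> ennreal (L * norm (y - x)) * (\<integral>\<^sup>+w\<in>cball x (R + 1). ennreal \<bar>U w\<bar> \<partial>lborel)"
    unfolding mol_diff_eq[OF k U] .
  also have "ennreal (L * norm (y - x)) = ennreal (min 1 (norm (x - y))) * ennreal L"
    using True L by (simp add: norm_minus_commute ennreal_mult mult.commute)
  finally show ?thesis by (rule order_trans) (auto simp: mult.assoc intro!: mult_left_mono)
next
  case False
  have b: "bsupp (R + 1) L f" using kernel_bsupp[OF k] by (rule bsupp_mono) auto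
  have "ennreal \<bar>mol f 0 U x - mol f 0 U y\<bar> \<le> ennreal (\<bar>mol f 0 U x\<bar> + \<bar>mol f 0 U y\<bar>)"
    by (intro ennreal_leI) linarith
  also have "\<dots> = ennreal \<bar>mol f 0 U x\<bar> + ennreal \<bar>mol f 0 U y\<bar>" by simp
  also have "\<dots> \<le> ennreal L * (\<integral>\<^sup>+w\<in>cball x (R + 1). ennreal \<bar>U w\<bar> \<partial>lborel) + ennreal L * (\<integral>\<^sup>+w\<in>cball y (R
      + 1). ennreal \<bar>U w\<bar> \<partial>lborel)"
    by (intro add_mono mol_low_le[OF b U])
  finally show ?thesis using False by (simp add: distrib_left norm_minus_commute)
qed

section \<open>Almost everywhere convergence of mollifications\<close>

lemma measurable_mol:
  fixes U :: "real^'n::finite \<Rightarrow> real"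
  assumes [measurable]: "f \<in> borel_measurable borel" "U \<in> borel_measurable borel"
  shows "mol f j U \<in> borel_measurable borel"
  unfolding mol_def by measurable

lemma mol_L1_le:
  fixes h :: "real^'n::finite \<Rightarrow> real"
  assumes f: "bsupp R L f" and R: "0 < R" and h: "locint h" and L: "0 \<le> L"
  shows "(\<integral>\<^sup>+x. ennreal \<bar>mol f j h x\<bar> \<partial>lborel) \<le> ennreal (L * (ball_vol TYPE('n) * R ^ CARD('n)))
      * (\<integral>\<^sup>+x. ennreal \<bar>h x\<bar> \<partial>lborel)"
proof -
  let ?a = "2 ^ j :: real" and ?n = "CARD('n)"
  have [measurable]: "h \<in> borel_measurable borel" using h by (simp add: locint_def)
  have "(\<integral>\<^sup>+x. ennreal \<bar>mol f j h x\<bar> \<partial>lborel)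
      \<le> (\<integral>\<^sup>+x. ennreal (?a ^ ?n * L) * (\<integral>\<^sup>+y. ennreal \<bar>h y\<bar>
          * indicator (cball x (R / ?a)) y \<partial>lborel) \<partial>lborel)"
  proof (intro nn_integral_mono)
    fix x
    have "ennreal \<bar>mol f j h x\<bar> = ennreal (?a ^ ?n) * ennreal \<bar>LINT y|lborel. h y * f (?a *\<^sub>R (y - x))\<bar>"
      by (simp add: mol_def abs_mult ennreal_mult)
    also have "\<dots> \<le> ennreal (?a ^ ?n) * (ennreal L * (\<integral>\<^sup>+y\<in>cball x (R / ?a). ennreal \<bar>h y\<bar> \<partial>lborel))"
      by (intro mult_left_mono locint_bsupp_bound[OF h f]) auto
    finally show "ennreal \<bar>mol f j h x\<bar> \<le> ennreal (?a ^ ?n * L) * (\<integral>\<^sup>+y. ennreal \<bar>h y\<bar>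
        * indicator (cball x (R / ?a)) y \<partial>lborel)"
      using L by (simp add: ennreal_mult mult.assoc)
  qed
  also have "\<dots> = ennreal (?a ^ ?n * L) * (\<integral>\<^sup>+x. \<integral>\<^sup>+y. ennreal \<bar>h y\<bar>
      * indicator (cball x (R / ?a)) y \<partial>lborel \<partial>lborel)"
    by (intro nn_integral_cmult) measurable
  also have "(\<integral>\<^sup>+x. \<integral>\<^sup>+y. ennreal \<bar>h y\<bar> * indicator (cball x (R / ?a)) y \<partial>lborel \<partial>lborel)
      = (\<integral>\<^sup>+y. \<integral>\<^sup>+x. ennreal \<bar>h y\<bar> * indicator (cball x (R / ?a)) y \<partial>lborel \<partial>lborel)"
    by (intro lborel_pair.Fubini') measurable
  also have "\<dots> = (\<integral>\<^sup>+y. ennreal \<bar>h y\<bar> * ennreal (ball_vol TYPE('n) * (R / ?a) ^ ?n) \<partial>lborel)"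
  proof (intro nn_integral_cong)
    fix y :: "real^'n"
    have "(\<integral>\<^sup>+x. indicator (cball x (R / ?a)) y \<partial>lborel) = (\<integral>\<^sup>+x. indicator (cball y (R / ?a)) x \<partial>lborel)"
      by (intro nn_integral_cong) (auto simp: indicator_def dist_commute)
    also have "\<dots> = ennreal (ball_vol TYPE('n) * (R / ?a) ^ ?n)" using R by (simp add: emeasure_cball_cart)
    finally show "(\<integral>\<^sup>+x. ennreal \<bar>h y\<bar> * indicator (cball x (R / ?a)) y \<partial>lborel) = ennreal \<bar>h y\<bar>
        * ennreal (ball_vol TYPE('n) * (R / ?a) ^ ?n)"
      by (simp add: nn_integral_cmult)
  qed
  also have "\<dots> = ennreal (ball_vol TYPE('n) * (R / ?a) ^ ?n) * (\<integral>\<^sup>+y. ennreal \<bar>h y\<bar> \<partial>lborel)"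
    by (subst nn_integral_multc) (auto simp: mult.commute)
  also have "ennreal (?a ^ ?n * L) * \<dots> = ennreal (?a ^ ?n * L * (ball_vol TYPE('n) * (R / ?a) ^ ?n))
      * (\<integral>\<^sup>+y. ennreal \<bar>h y\<bar> \<partial>lborel)"
    using L R by (subst (2) ennreal_mult) (auto simp: mult.assoc)
  also have "?a ^ ?n * L * (ball_vol TYPE('n) * (R / ?a) ^ ?n) = L * (ball_vol TYPE('n) * R ^ ?n)"
    by (simp add: power_divide)
  finally show ?thesis .
qed

lemma mol_continuous_approx:
  fixes g :: "real^'n::finite \<Rightarrow> real"
  assumes f: "bsupp R L f" and f1: "(LINT y|lborel. f y) = 1" and R: "0 < R" and L: "0 < L"
    and g: "continuous_on UNIV g" and e: "0 < e"
  shows "\<exists>j0. \<forall>j\<ge>j0. \<forall>x\<in>cball 0 r. \<bar>mol f j g x - g x\<bar> \<le> e"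
proof -
  let ?n = "CARD('n)"
  define K where "K = L * (ball_vol TYPE('n) * R ^ ?n)"
  have K: "0 < K" using L R by (simp add: K_def)
  have [measurable]: "f \<in> borel_measurable borel" using f by (simp add: bsupp_def)
  have [measurable]: "g \<in> borel_measurable borel" using g by (rule borel_measurable_continuous_onI)
  have lg: "locint g"
    unfolding locint_def
  proof (intro conjI allI)
    fix x :: "real^'n" and r
    have "integrable lborel (\<lambda>y. indicator (cball x r) y *\<^sub>R g y)"
      using g by (intro borel_integrable_compact) (auto intro: continuous_on_subset)
    then have "(\<integral>\<^sup>+y. ennreal (norm (indicator (cball x r) y *\<^sub>R g y)) \<partial>lborel) < \<infinity>"
      by (simp add: integrable_iff_bounded)
    also have "(\<integral>\<^sup>+y. ennreal (norm (indicator (cball x r) y *\<^sub>R g y)) \<partial>lborel)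
        = (\<integral>\<^sup>+y\<in>cball x r. ennreal \<bar>g y\<bar> \<partial>lborel)"
      by (intro nn_integral_cong) (auto simp: indicator_def)
    finally show "(\<integral>\<^sup>+y\<in>cball x r. ennreal \<bar>g y\<bar> \<partial>lborel) < \<infinity>" .
  qed measurable
  \<comment> \<open>For centres in the ball of radius \<open>r\<close> the kernel reaches at most
    \<open>R\<close> further, because the scales \<open>2^-j\<close> are at most 1.\<close>
  have "uniformly_continuous_on (cball 0 (r + R)) g"
    using g by (intro compact_uniformly_continuous) (auto intro: continuous_on_subset)
  then obtain \<delta> where \<delta>: "0 < \<delta>" "\<And>x y. x \<in> cball 0 (r + R) \<Longrightarrow> y \<in> cball 0 (r + R) \<Longrightarrow> dist y x < \<delta>
      \<Longrightarrow> dist (g y) (g x) < e / K"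
    using e K unfolding uniformly_continuous_on_def by (metis divide_pos_pos)
  obtain j0 :: nat where j0: "R / \<delta> < 2 ^ j0" using real_arch_pow[of 2 "R / \<delta>"] by auto
  have "\<bar>mol f j g x - g x\<bar> \<le> e" if j: "j0 \<le> j" and x: "x \<in> cball 0 r" for j x
  proof -
    let ?a = "2 ^ j :: real"
    have "(2::real) ^ j0 \<le> ?a" using j by (intro power_increasing) auto
    then have "R / \<delta> < ?a" using j0 by linarith
    then have aR: "R / ?a < \<delta>" using \<delta>(1) by (simp add: field_simps)
    have "1 \<le> ?a" by simp
    then have aR': "R / ?a \<le> R" using R by (simp add: pos_divide_le_eq)
    have "integrable lborel (\<lambda>y. g y * f (?a *\<^sub>R (y - x)))" by (rule locint_bsupp_integrable[OF lg f]) simp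
    moreover have "integrable lborel (\<lambda>y. g x * f (?a *\<^sub>R (y - x)))"
      by (rule locint_bsupp_integrable[of "\<lambda>_. g x", OF _ f]) (use locint_shift[of "\<lambda>_. 0" "- g x"] in \<open>auto simp: locint_def\<close>)
    moreover have "?a ^ ?n * (LINT y|lborel. g x * f (?a *\<^sub>R (y - x))) = g x"
      using lborel_integral_scale[of f ?a x] f1 by simp
    ultimately have eq: "mol f j g x - g x = ?a ^ ?n * (LINT y|lborel. (g y - g x) * f (?a *\<^sub>R (y - x)))"
      by (simp add: mol_def left_diff_distrib right_diff_distrib)
    have "ennreal \<bar>LINT y|lborel. (g y - g x) * f (?a *\<^sub>R (y - x))\<bar> \<le> ennreal L
        * (\<integral>\<^sup>+y\<in>cball x (R / ?a). ennreal \<bar>g y - g x\<bar> \<partial>lborel)"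
      by (rule locint_bsupp_bound[OF locint_shift[OF lg] f]) simp
    also have "\<dots> \<le> ennreal L * (\<integral>\<^sup>+y. ennreal (e / K) * indicator (cball x (R / ?a)) y \<partial>lborel)"
    proof (intro mult_left_mono nn_integral_mono)
      fix y
      show "ennreal \<bar>g y - g x\<bar> * indicator (cball x (R / ?a)) y \<le> ennreal (e / K)
          * indicator (cball x (R / ?a)) y"
      proof (cases "y \<in> cball x (R / ?a)")
        case True
        have "norm y \<le> r + R" using True x aR' dist_triangle[of 0 y x] by (simp add: dist_norm)
        moreover have "norm x \<le> r + R" using x R by simp
        moreover have "dist y x < \<delta>" using True aR by (simp add: dist_commute)
        ultimately have "dist (g y) (g x) < e / K" using \<delta>(2)[of x y] by simp
        then show ?thesis using True by (simp add: dist_norm ennreal_leI less_imp_le)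
      qed simp
    qed auto
    also have "\<dots> = ennreal (L * (e / K * (ball_vol TYPE('n) * (R / ?a) ^ ?n)))"
      using L R e K by (simp add: nn_integral_cmult_indicator emeasure_cball_cart ennreal_mult
          del: times_divide_eq_left times_divide_eq_right)
    finally have "\<bar>LINT y|lborel. (g y - g x) * f (?a *\<^sub>R (y - x))\<bar> \<le> L * (e / K * (ball_vol TYPE('n)
        * (R / ?a) ^ ?n))"
      using L R e K by (subst (asm) ennreal_le_iff) auto
    then have "?a ^ ?n * \<bar>LINT y|lborel. (g y - g x) * f (?a *\<^sub>R (y - x))\<bar> \<le> ?a ^ ?n * (L * (e / K
        * (ball_vol TYPE('n) * (R / ?a) ^ ?n)))"
      by (rule mult_left_mono) simp
    then have "\<bar>mol f j g x - g x\<bar> \<le> ?a ^ ?n * (L * (e / K * (ball_vol TYPE('n) * (R / ?a) ^ ?n)))"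
      by (simp only: eq abs_mult power_abs abs_numeral)
    also have "\<dots> = e / K * K" unfolding K_def by (simp add: power_divide)
    also have "\<dots> = e" using K by simp
    finally show ?thesis .
  qed
  then show ?thesis by blast
qed

section \<open>Littlewood-Paley bounds\<close>

lemma locint_integrable: "integrable lborel f \<Longrightarrow> locint f"
proof -
  assume f: "integrable lborel f"
  then have *: "(\<integral>\<^sup>+y. ennreal \<bar>f y\<bar> \<partial>lborel) < \<infinity>" by (simp add: integrable_iff_bounded)
  have "(\<integral>\<^sup>+y\<in>cball x r. ennreal \<bar>f y\<bar> \<partial>lborel) < \<infinity>" for x r
    by (rule le_less_trans[OF nn_integral_mono *]) (auto simp: indicator_def)
  then show ?thesis using f by (auto simp: locint_def)
qed

text \<open>Cutting \<open>U\<close> off outside the ball of radius \<open>r + R\<close> leaves its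
  mollifications on the smaller ball unchanged and makes it integrable. The cut-off is then replaced
  by a continuous function at small cost in L1.\<close>

lemma mol_L1_convergence:
  fixes U :: "real^'n::finite \<Rightarrow> real"
  assumes f: "bsupp R L f" and f1: "(LINT y|lborel. f y) = 1" and R: "0 < R" and L: "0 < L"
    and U: "locint U" and e: "0 < e" and r: "0 < r"
  shows "\<exists>j. (\<integral>\<^sup>+x\<in>cball 0 r. ennreal \<bar>mol f j U x - U x\<bar> \<partial>lborel) \<le> ennreal e"
proof -
  define F where "F y = indicator (cball 0 (r + R)) y * U y" for y
  have [measurable]: "U \<in> borel_measurable borel" "f \<in> borel_measurable borel"
    using U f by (auto simp: locint_def bsupp_def)
  have "(\<integral>\<^sup>+y. ennreal (norm (F y)) \<partial>lborel) = (\<integral>\<^sup>+y\<in>cball 0 (r + R). ennreal \<bar>U y\<bar> \<partial>lborel)"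
    by (intro nn_integral_cong) (auto simp: F_def indicator_def)
  also have "\<dots> < \<infinity>" using U by (simp add: locint_def)
  finally have F: "integrable lborel F"
    unfolding F_def by (intro integrableI_bounded) auto
  have Fm [measurable]: "F \<in> borel_measurable borel" using F by auto
  define K where "K = L * (ball_vol TYPE('n) * R ^ CARD('n))"
  have K: "0 < K" using L R by (simp add: K_def)
  define v where "v = ball_vol TYPE('n) * r ^ CARD('n)"
  have v: "0 < v" using r by (simp add: v_def)
  \<comment> \<open>The error \<open>F - g\<close> enters once directly and \<open>K\<close> times
    through its mollification, which uses up half of \<open>e\<close>; the other half is for
    \<open>g\<close>.\<close>
  define e1 where "e1 = e / (2 * (K + 1))"
  have e1: "0 < e1" using e K by (simp add: e1_def)
  obtain g where g: "continuous_on UNIV g" "integrable lborel g" "(\<integral>x. \<bar>F x - g x\<bar> \<partial>lborel) < e1"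
    using ex_continuous_L1_approx[OF F e1] by blast
  have [measurable]: "g \<in> borel_measurable borel" using g(1) by (rule borel_measurable_continuous_onI)
  have e2: "0 < e / (2 * v)" using e v by simp
  obtain j where j: "\<And>x. x \<in> cball 0 r \<Longrightarrow> \<bar>mol f j g x - g x\<bar> \<le> e / (2 * v)"
    using mol_continuous_approx[OF f f1 R L g(1) e2, of r] by blast
  let ?h = "\<lambda>x. F x - g x"
  have h: "locint ?h" using F g(2) by (intro locint_integrable) auto
  have h1: "(\<integral>\<^sup>+x. ennreal \<bar>?h x\<bar> \<partial>lborel) \<le> ennreal e1"
  proof -
    have "(\<integral>\<^sup>+x. ennreal \<bar>?h x\<bar> \<partial>lborel) = ennreal (\<integral>x. \<bar>?h x\<bar> \<partial>lborel)"
      using F g(2) by (intro nn_integral_eq_integral) auto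
    then show ?thesis using g(3) by (simp add: ennreal_leI)
  qed
  note [measurable] = measurable_mol[of f ?h j] measurable_mol[of f g j]
  have hm: "mol f j ?h \<in> borel_measurable borel" "(\<lambda>x. ?h x) \<in> borel_measurable borel"
    using measurable_mol[of f ?h j] Fm by measurable
  have pt: "ennreal \<bar>mol f j U x - U x\<bar> * indicator (cball 0 r) x
     \<le> ennreal \<bar>mol f j ?h x\<bar> + (ennreal (e / (2 * v)) * indicator (cball 0 r) x + ennreal \<bar>?h x\<bar>)" for x
  proof (cases "x \<in> cball 0 r")
    case True
    have "U y * f ((2 ^ j) *\<^sub>R (y - x)) = F y * f ((2 ^ j) *\<^sub>R (y - x))" for y
    proof (cases "y \<in> cball 0 (r + R)")
      case False
      have "norm y \<le> norm (y - x) + norm x" using norm_triangle_ineq[of "y - x" x] by simp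
      then have "R < 1 * norm (y - x)" using False True by simp
      also have "\<dots> \<le> 2 ^ j * norm (y - x)" by (intro mult_right_mono) auto
      finally have "R < norm ((2 ^ j :: real) *\<^sub>R (y - x))" by (simp del: scaleR_right_diff_distrib)
      then have "f ((2 ^ j) *\<^sub>R (y - x)) = 0" using f by (simp add: bsupp_def)
      then show ?thesis by simp
    qed (simp add: F_def)
    then have mU: "mol f j U x = mol f j F x" by (simp only: mol_def)
    have "integrable lborel (\<lambda>y. F y * f ((2 ^ j) *\<^sub>R (y - x)))" "integrable lborel (\<lambda>y. g y
        * f ((2 ^ j) *\<^sub>R (y - x)))"
      by (rule locint_bsupp_integrable[OF locint_integrable f]; use F g in simp)+
    then have mh: "mol f j ?h x = mol f j F x - mol f j g x"
      by (simp add: mol_def left_diff_distrib right_diff_distrib)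
    have FU: "F x = U x" using True R by (simp add: F_def)
    have "\<bar>mol f j U x - U x\<bar> \<le> \<bar>mol f j ?h x\<bar> + (e / (2 * v) + \<bar>?h x\<bar>)"
      using j[OF True] unfolding mU mh FU by linarith
    then have "ennreal \<bar>mol f j U x - U x\<bar> \<le> ennreal (\<bar>mol f j ?h x\<bar> + (e / (2 * v) + \<bar>?h x\<bar>))"
      by (rule ennreal_leI)
    then show ?thesis using True e2 by (simp del: mem_cball)
  qed simp
  have "(\<integral>\<^sup>+x\<in>cball 0 r. ennreal \<bar>mol f j U x - U x\<bar> \<partial>lborel)
     \<le> (\<integral>\<^sup>+x. ennreal \<bar>mol f j ?h x\<bar> + (ennreal (e / (2 * v)) * indicator (cball 0 r) x
         + ennreal \<bar>?h x\<bar>) \<partial>lborel)"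
    by (intro nn_integral_mono pt)
  also have "\<dots> = (\<integral>\<^sup>+x. ennreal \<bar>mol f j ?h x\<bar> \<partial>lborel) + (ennreal (e / (2 * v)) * ennreal v
      + (\<integral>\<^sup>+x. ennreal \<bar>?h x\<bar> \<partial>lborel))"
    using hm r by (simp add: nn_integral_add nn_integral_cmult_indicator emeasure_cball_cart v_def)
  also have "\<dots> \<le> ennreal K * ennreal e1 + (ennreal (e / (2 * v)) * ennreal v + ennreal e1)"
  proof (intro add_mono h1 order_refl)
    have "(\<integral>\<^sup>+x. ennreal \<bar>mol f j ?h x\<bar> \<partial>lborel) \<le> ennreal K * (\<integral>\<^sup>+x. ennreal \<bar>?h x\<bar> \<partial>lborel)"
      unfolding K_def using L by (intro mol_L1_le[OF f R h]) simp
    also have "\<dots> \<le> ennreal K * ennreal e1" by (intro mult_left_mono h1) auto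
    finally show "(\<integral>\<^sup>+x. ennreal \<bar>mol f j ?h x\<bar> \<partial>lborel) \<le> ennreal K * ennreal e1" .
  qed
  also have "\<dots> = ennreal (K * e1 + (e / (2 * v) * v + e1))"
  proof -
    have "ennreal K * ennreal e1 = ennreal (K * e1)" "ennreal (e / (2 * v)) * ennreal v = ennreal (e / (2
        * v) * v)"
      using K e1 e2 v by (intro ennreal_mult[symmetric]; simp)+
    moreover have "0 \<le> K * e1" "0 \<le> e / (2 * v) * v" "0 \<le> e1" using K e1 e2 v e by auto
    ultimately show ?thesis by (simp only: ennreal_plus add_nonneg_nonneg)
  qed
  also have "K * e1 + (e / (2 * v) * v + e1) = e"
  proof -
    have "K * e1 + e1 = (K + 1) * e1" by (simp add: distrib_right)
    also have "\<dots> = e / 2" using K by (simp add: e1_def field_simps)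
    finally show ?thesis using v by simp
  qed
  finally show ?thesis by blast
qed

text \<open>Errors of at most 2^-k on growing balls have a finite sum of integrals, so almost
  everywhere they are summable and tend to 0. An arbitrary sequence \<open>J\<close> of scales
  suffices, since the telescoping bound holds for all partial sums at once.\<close>

lemma mol_AE_convergence:
  fixes U :: "real^'n::finite \<Rightarrow> real"
  assumes f: "bsupp R L f" and f1: "(LINT y|lborel. f y) = 1" and R: "0 < R" and L: "0 < L"
    and U: "locint U"
  obtains J where "AE x in lborel. (\<lambda>k. mol f (J k) U x) \<longlonglongrightarrow> U x"
proof -
  have [measurable]: "U \<in> borel_measurable borel" "f \<in> borel_measurable borel"
    using U f by (auto simp: locint_def bsupp_def)
  note [measurable] = measurable_mol[of f U]
  have "\<exists>j. (\<integral>\<^sup>+x\<in>cball 0 (real (Suc k)). ennreal \<bar>mol f j U x - U x\<bar> \<partial>lborel) \<le> ennreal ((1/2) ^ k)" for k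
    by (rule mol_L1_convergence[OF f f1 R L U]) auto
  then obtain J where J: "\<And>k. (\<integral>\<^sup>+x\<in>cball 0 (real (Suc k)). ennreal \<bar>mol f (J k) U x - U x\<bar> \<partial>lborel)
      \<le> ennreal ((1/2) ^ k)"
    by metis
  let ?t = "\<lambda>k x. \<bar>mol f (J k) U x - U x\<bar> * indicator (cball 0 (real (Suc k))) x"
  have tE: "ennreal (?t k x) = ennreal \<bar>mol f (J k) U x - U x\<bar> * indicator (cball 0 (real (Suc k))) x" for k x
    by (auto simp: indicator_def)
  have m: "(\<lambda>x. ennreal \<bar>mol f (J k) U x - U x\<bar> * indicator (cball 0 (real (Suc k))) x) \<in> borel_measurable
      lborel" for k
    by measurable
  have "(\<integral>\<^sup>+x. (\<Sum>k. ennreal (?t k x)) \<partial>lborel) = (\<Sum>k. \<integral>\<^sup>+x. ennreal (?t k x) \<partial>lborel)"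
    unfolding tE by (rule nn_integral_suminf[OF m])
  also have "\<dots> \<le> (\<Sum>k. ennreal ((1/2) ^ k))"
    unfolding tE by (intro suminf_le J) auto
  also have "\<dots> = ennreal (1 / (1 - 1/2))"
    by (rule suminf_ennreal_eq) (use geometric_sums[of "1/2::real"] in auto)
  finally have "(\<integral>\<^sup>+x. (\<Sum>k. ennreal (?t k x)) \<partial>lborel) \<noteq> \<infinity>" by (auto simp: top_unique)
  then have "AE x in lborel. (\<Sum>k. ennreal (?t k x)) \<noteq> \<infinity>"
    unfolding tE by (intro nn_integral_noteq_infinite borel_measurable_suminf_order m)
  then have "AE x in lborel. (\<lambda>k. mol f (J k) U x) \<longlonglongrightarrow> U x"
  proof (rule eventually_mono)
    fix x assume fin: "(\<Sum>k. ennreal (?t k x)) \<noteq> \<infinity>"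
    have "summable (\<lambda>k. ?t k x)"
      by (rule summable_suminf_not_top) (use fin in auto)
    then have t0: "(\<lambda>k. ?t k x) \<longlonglongrightarrow> 0" by (rule summable_LIMSEQ_zero)
    obtain K :: nat where K: "norm x \<le> real K" using real_arch_simple by blast
    have "eventually (\<lambda>k. ?t k x = \<bar>mol f (J k) U x - U x\<bar>) sequentially"
      unfolding eventually_sequentially using K by (intro exI[of _ K]) (auto simp: indicator_def)
    then have "(\<lambda>k. \<bar>mol f (J k) U x - U x\<bar>) \<longlonglongrightarrow> 0"
      by (rule Lim_transform_eventually[OF t0])
    then show "(\<lambda>k. mol f (J k) U x) \<longlonglongrightarrow> U x"
      by (simp add: tendsto_rabs_zero_iff LIM_zero_iff)
  qed
  then show thesis by (rule that)
qed

text \<open>The telescoping bound holds for every partial sum with the same right-hand side and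
  therefore passes to the limit along any sequence \<open>J\<close>.\<close>

lemma real_bound_by_series:
  fixes t :: "nat \<Rightarrow> ennreal" and s :: "nat \<Rightarrow> real"
  assumes s0: "ennreal \<bar>s 0\<bar> \<le> ennreal A * t 0"
    and sd: "\<And>j. ennreal \<bar>s (Suc j) - s j\<bar> \<le> ennreal B * t j"
    and lim: "(\<lambda>k. s (J k)) \<longlonglongrightarrow> u" and AB: "0 \<le> A" "0 \<le> B"
  shows "ennreal \<bar>u\<bar> \<le> ennreal (A + B) * (\<Sum>j. t j)"
proof -
  have b: "ennreal \<bar>s J\<bar> \<le> ennreal A * t 0 + ennreal B * (\<Sum>j<J. t j)" for J
  proof (induction J)
    case (Suc J)
    have "ennreal \<bar>s (Suc J)\<bar> \<le> ennreal (\<bar>s J\<bar> + \<bar>s (Suc J) - s J\<bar>)" by (intro ennreal_leI) linarith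
    also have "\<dots> = ennreal \<bar>s J\<bar> + ennreal \<bar>s (Suc J) - s J\<bar>" by simp
    also have "\<dots> \<le> (ennreal A * t 0 + ennreal B * (\<Sum>j<J. t j)) + ennreal B * t J" by (intro add_mono Suc sd)
    finally show ?case by (simp add: distrib_left add.assoc)
  qed (use s0 in simp)
  have le: "ennreal \<bar>s J\<bar> \<le> ennreal (A + B) * (\<Sum>j. t j)" for J
  proof -
    note b
    also have "ennreal A * t 0 + ennreal B * (\<Sum>j<J. t j) \<le> ennreal A * (\<Sum>j. t j) + ennreal B * (\<Sum>j. t j)"
      using sum_le_suminf[of t "{0}"] by (intro add_mono mult_left_mono sum_le_suminf) auto
    also have "\<dots> = ennreal (A + B) * (\<Sum>j. t j)" using AB by (simp add: distrib_right)
    finally show ?thesis .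
  qed
  have "(\<lambda>k. ennreal \<bar>s (J k)\<bar>) \<longlonglongrightarrow> ennreal \<bar>u\<bar>"
    using lim by (intro tendsto_ennrealI tendsto_rabs)
  then show ?thesis by (rule LIMSEQ_le_const2) (use le in blast)
qed

text \<open>The pointwise form of a Littlewood-Paley decomposition: \<open>U\<close> is a sum of pieces at the scales
  \<open>2\<^sup>-\<^sup>j\<close> that decay like \<open>2\<^sup>-\<^sup>\<gamma>\<^sup>j\<close> and are Lipschitz at their scale.\<close>

definition lp_controlled ::
  "real \<Rightarrow> real \<Rightarrow> (nat \<Rightarrow> real^'n::finite \<Rightarrow> ennreal) \<Rightarrow> (real^'n \<Rightarrow> real) \<Rightarrow> (real^'n) set \<Rightarrow> bool" where
  "lp_controlled C \<gamma> E U Z \<longleftrightarrow>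
     (\<forall>x. x \<notin> Z \<longrightarrow> ennreal \<bar>U x\<bar> \<le> ennreal C * (\<Sum>j. ennreal ((2 ^ j) powr - \<gamma>) * E j x)) \<and>
     (\<forall>x y. x \<notin> Z \<longrightarrow> y \<notin> Z \<longrightarrow> ennreal \<bar>U x - U y\<bar> \<le> ennreal C *
        (\<Sum>j. ennreal (min 1 (2 ^ j * norm (x - y))) * (ennreal ((2 ^ j) powr - \<gamma>) * (E j x + E j y))))"

lemma lp_controlled_scale:
  assumes lp: "lp_controlled C \<gamma> E V Y" and c: "0 < c" "0 \<le> C"
    and F: "\<And>j x. E j x = ennreal (1 / c) * F j x" and Z: "\<And>x. x \<notin> Z \<Longrightarrow> U x = V x \<and> x \<notin> Y"
  shows "lp_controlled (C / c) \<gamma> F U Z"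
proof -
  have Cc: "ennreal C * (ennreal (1 / c) * S) = ennreal (C / c) * S" for S
    using c by (simp add: mult.assoc[symmetric] ennreal_mult[symmetric])
  have 1: "(\<Sum>j. ennreal ((2 ^ j) powr - \<gamma>) * E j x) = ennreal (1 / c) * (\<Sum>j. ennreal ((2 ^ j) powr - \<gamma>)
      * F j x)" for x
    unfolding F by (subst ennreal_suminf_cmult[symmetric]) (simp only: mult.left_commute)
  have 2: "(\<Sum>j. ennreal (min 1 (2 ^ j * norm (x - y))) * (ennreal ((2 ^ j) powr - \<gamma>) * (E j x + E j y)))
    = ennreal (1 / c) * (\<Sum>j. ennreal (min 1 (2 ^ j * norm (x - y))) * (ennreal ((2 ^ j) powr - \<gamma>) * (F j x
        + F j y)))" for x y
    unfolding F by (subst ennreal_suminf_cmult[symmetric]) (simp only: distrib_left mult.left_commute)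
  show ?thesis
    using lp Z unfolding lp_controlled_def 1 2 Cc by simp
qed

text \<open>Consecutive mollifications of \<open>U\<close> differ, up to sign, by
  \<open>2^(-jN)\<close> times a sum of mollifications of the \<open>V i\<close> with kernels of
  mean zero, hence by oscillations. The exponent \<open>\<theta>\<close> is free here:
  \<open>scale_energy\<close> contains \<open>(2^j) powr \<theta>\<close>, and the weight takes it
  away again.\<close>

lemma littlewood_paley_bounds:
  fixes N :: nat
  obtains R C :: real where "1 \<le> R" "1 \<le> C"
    "\<And>(U :: real^'n::finite \<Rightarrow> real) V d D \<theta>. locint U \<Longrightarrow> (\<And>i. locint (V i)) \<Longrightarrow> pure_derivs N U V \<Longrightarrow>
      case_prod d \<in> borel_measurable (borel \<Otimes>\<^sub>M borel) \<Longrightarrow> (\<And>i y z. \<bar>V i y - V i z\<bar> \<le> d y z) \<Longrightarrow>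
      (\<And>y. \<bar>U y\<bar> \<le> D y) \<Longrightarrow>
      \<exists>Z. (AE x in lborel. x \<notin> Z) \<and> lp_controlled C (real N + \<theta>) (scale_energy \<theta> R d D) U Z"
proof -
  let ?n = "CARD('n)"
  obtain \<Phi> :: "real^'n \<Rightarrow> real" and \<kappa> :: "'n \<Rightarrow> real^'n \<Rightarrow> real" and R L :: real where R: "1 \<le> R" and L: "1 \<le> L"
    and \<Phi>: "kernel R L \<Phi>" and \<kappa>: "\<And>i. kernel R L (\<kappa> i)"
    and \<Phi>1: "(LINT x|lborel. \<Phi> x) = 1" and \<kappa>0: "\<And>i. (LINT x|lborel. \<kappa> i x) = 0"
    and tel: "\<And>U V a x. 0 < a \<Longrightarrow> locint U \<Longrightarrow> pure_derivs N U V \<Longrightarrow>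
      (LINT y|lborel. U y * (2 ^ ?n * \<Phi> ((2 * a) *\<^sub>R (y - x)) - \<Phi> (a *\<^sub>R (y - x))))
        = (\<Sum>i\<in>UNIV. (- 1 / a) ^ N * (LINT y|lborel. V i y * \<kappa> i (a *\<^sub>R (y - x))))"
    by (rule kernel_package[of N], rule that) assumption+
  have R0: "0 < R" and L0: "0 \<le> L" "0 < L" using R L by auto
  define c where "c = L / (ball_vol TYPE('n) * (R + 1) ^ ?n)"
  have c: "0 \<le> c" using R L by (simp add: c_def)
  have \<Phi>b: "bsupp (R + 1) L \<Phi>" and \<kappa>b: "bsupp (R + 1) L (\<kappa> i)" for i
    by (rule bsupp_mono[OF kernel_bsupp[OF \<Phi>]]; simp) (rule bsupp_mono[OF kernel_bsupp[OF \<kappa>]]; simp)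
  have nc: "0 \<le> real ?n * c" using c by simp
  show thesis
  proof (rule that[of "R + 1" "L + real ?n * c"])
    fix U :: "real^'n \<Rightarrow> real" and V d D and \<theta> :: real
    assume U: "locint U" and V: "\<And>i. locint (V i)" and UV: "pure_derivs N U V"
      and d: "case_prod d \<in> borel_measurable (borel \<Otimes>\<^sub>M borel)" and Vd: "\<And>i y z. \<bar>V i y - V i z\<bar> \<le> d y z"
      and D: "\<And>y. \<bar>U y\<bar> \<le> D y"
    let ?E = "scale_energy \<theta> (R + 1) d D"
    let ?w = "\<lambda>j. ennreal ((2 ^ j) powr - (real N + \<theta>))"
    have step: "mol \<Phi> (Suc j) U x - mol \<Phi> j U x = (\<Sum>i\<in>UNIV. (- 1 / 2 ^ j) ^ N * mol (\<kappa> i) j (V i) x)" for j x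
    proof -
      have i: "integrable lborel (\<lambda>y. U y * \<Phi> ((2 ^ Suc j) *\<^sub>R (y - x)))" "integrable lborel (\<lambda>y. U y
          * \<Phi> ((2 ^ j) *\<^sub>R (y - x)))"
        by (rule locint_kernel_integrable[OF U \<Phi>]; simp)+
      have "mol \<Phi> (Suc j) U x - mol \<Phi> j U x = (2 ^ j) ^ ?n * (2 ^ ?n * (LINT y|lborel. U y
          * \<Phi> ((2 ^ Suc j) *\<^sub>R (y - x)))
          - (LINT y|lborel. U y * \<Phi> ((2 ^ j) *\<^sub>R (y - x))))"
        unfolding mol_def by (simp add: power_mult_distrib right_diff_distrib)
      also have "2 ^ ?n * (LINT y|lborel. U y * \<Phi> ((2 ^ Suc j) *\<^sub>R (y - x))) - (LINT y|lborel. U y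
          * \<Phi> ((2 ^ j) *\<^sub>R (y - x)))
        = (LINT y|lborel. 2 ^ ?n * (U y * \<Phi> ((2 ^ Suc j) *\<^sub>R (y - x))) - U y * \<Phi> ((2 ^ j) *\<^sub>R (y - x)))"
        using i by (subst Bochner_Integration.integral_diff) (auto simp del: power_Suc)
      also have "\<dots> = (LINT y|lborel. U y * (2 ^ ?n * \<Phi> ((2 * 2 ^ j) *\<^sub>R (y - x)) - \<Phi> ((2 ^ j) *\<^sub>R (y - x))))"
        by (intro Bochner_Integration.integral_cong) (auto simp: right_diff_distrib simp del:
            scaleR_right_diff_distrib)
      also have "\<dots> = (\<Sum>i\<in>UNIV. (- 1 / 2 ^ j) ^ N * (LINT y|lborel. V i y * \<kappa> i ((2 ^ j) *\<^sub>R (y - x))))"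
        by (rule tel[OF _ U UV]) simp
      finally show ?thesis by (simp add: mol_def sum_distrib_left mult.left_commute)
    qed
    have pw: "\<bar>(- 1 / 2 ^ j) ^ N :: real\<bar> = (2 ^ j) powr - real N" for j
      by (simp add: power_abs powr_minus powr_realpow power_one_over inverse_eq_divide)
    have wE: "ennreal ((2 ^ j) powr - real N) * (ennreal (c * ((2 ^ j) ^ ?n)^2) * osc d ((R + 1) / 2 ^ j) x)
        \<le> ennreal c * (?w j * ?E j x)" for j x
    proof -
      have "ennreal ((2 ^ j) powr - real N) * (ennreal (c * ((2 ^ j) ^ ?n)^2) * osc d ((R + 1) / 2 ^ j) x)
        = ennreal ((2 ^ j) powr - real N * (c * ((2 ^ j) ^ ?n)^2)) * osc d ((R + 1) / 2 ^ j) x"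
        using c by (simp add: ennreal_mult mult.assoc)
      also have "(2 ^ j) powr - real N * (c * ((2 ^ j) ^ ?n)^2) = c * ((2 ^ j) powr - (real N + \<theta>)
          * ((2 ^ j) powr \<theta> * ((2 ^ j) ^ ?n)^2))"
      proof -
        have "(2 ^ j :: real) powr - real N = (2 ^ j) powr - (real N + \<theta>) * (2 ^ j) powr \<theta>"
          by (simp add: powr_add[symmetric])
        then show ?thesis by simp
      qed
      also have "ennreal (c * ((2 ^ j) powr - (real N + \<theta>) * ((2 ^ j) powr \<theta> * ((2 ^ j) ^ ?n)^2)))
          * osc d ((R + 1) / 2 ^ j) x
        = ennreal c * (?w j * (ennreal ((2 ^ j) powr \<theta> * ((2 ^ j) ^ ?n)^2) * osc d ((R + 1) / 2 ^ j) x))"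
        using c by (simp add: ennreal_mult mult.assoc)
      also have "\<dots> \<le> ennreal c * (?w j * ?E j x)"
        unfolding scale_energy_def by (intro mult_left_mono) auto
      finally show ?thesis .
    qed
    have up: "ennreal \<bar>\<Sum>i\<in>UNIV. (- 1 / 2 ^ j) ^ N * q i\<bar> \<le> ennreal (real ?n)
        * (ennreal ((2 ^ j) powr - real N) * M)"
      if q: "\<And>i. ennreal \<bar>q i\<bar> \<le> M" for q :: "'n \<Rightarrow> real" and M j
    proof -
      have "ennreal \<bar>\<Sum>i\<in>UNIV. (- 1 / 2 ^ j) ^ N * q i\<bar> \<le> ennreal (\<Sum>i\<in>UNIV. \<bar>(- 1 / 2 ^ j) ^ N * q i\<bar>)"
        by (intro ennreal_leI sum_abs)
      also have "\<dots> = (\<Sum>i\<in>UNIV. ennreal ((2 ^ j) powr - real N) * ennreal \<bar>q i\<bar>)"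
        by (simp only: abs_mult pw) (simp add: sum_ennreal[symmetric] ennreal_mult)
      also have "\<dots> \<le> (\<Sum>i\<in>(UNIV :: 'n set). ennreal ((2 ^ j) powr - real N) * M)"
        by (intro sum_mono mult_left_mono q) auto
      finally show ?thesis by (simp add: ennreal_of_nat_eq_real_of_nat)
    qed
    have low: "(\<integral>\<^sup>+y\<in>cball x (R + 1). ennreal \<bar>U y\<bar> \<partial>lborel) \<le> ?w 0 * ?E 0 x" for x
    proof -
      have "(\<integral>\<^sup>+y\<in>cball x (R + 1). ennreal \<bar>U y\<bar> \<partial>lborel) \<le> (\<integral>\<^sup>+y\<in>cball x (R + 1). ennreal (D y) \<partial>lborel)"
        using D by (intro nn_integral_mono mult_right_mono ennreal_leI) auto
      also have "\<dots> \<le> ?w 0 * ?E 0 x" by (simp add: scale_energy_def)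
      finally show ?thesis .
    qed
    obtain J where J: "AE x in lborel. (\<lambda>k. mol \<Phi> (J k) U x) \<longlonglongrightarrow> U x"
      using mol_AE_convergence[OF kernel_bsupp[OF \<Phi>] \<Phi>1 R0 L0(2) U] by blast
    \<comment> \<open>One exceptional set for single points and for pairs: outside it the chosen
      mollifications converge to \<open>U\<close>.\<close>
    define Z where "Z = {x. \<not> (\<lambda>k. mol \<Phi> (J k) U x) \<longlonglongrightarrow> U x}"
    have "ennreal \<bar>U x\<bar> \<le> ennreal (L + real ?n * c) * (\<Sum>j. ?w j * ?E j x)" if x: "x \<notin> Z" for x
    proof (rule real_bound_by_series[where s = "\<lambda>j. mol \<Phi> j U x"])
      show "(\<lambda>k. mol \<Phi> (J k) U x) \<longlonglongrightarrow> U x" using x by (simp add: Z_def)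
      show "ennreal \<bar>mol \<Phi> 0 U x\<bar> \<le> ennreal L * (?w 0 * ?E 0 x)"
        by (rule order_trans[OF mol_low_le[OF \<Phi>b U] mult_left_mono[OF low]]) simp
      show "ennreal \<bar>mol \<Phi> (Suc j) U x - mol \<Phi> j U x\<bar> \<le> ennreal (real ?n * c) * (?w j * ?E j x)" for j
      proof -
        have "ennreal \<bar>mol (\<kappa> i) j (V i) x\<bar> \<le> ennreal (c * ((2 ^ j) ^ ?n)^2) * osc d ((R
            + 1) / 2 ^ j) x" for i
          unfolding c_def by (rule mol_mean_zero_le[OF \<kappa>b \<kappa>0 _ L0(1) V d Vd]) (use R in simp)
        from up[OF this] have "ennreal \<bar>mol \<Phi> (Suc j) U x - mol \<Phi> j U x\<bar>
          \<le> ennreal (real ?n) * (ennreal ((2 ^ j) powr - real N) * (ennreal (c * ((2 ^ j) ^ ?n)^2)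
              * osc d ((R + 1) / 2 ^ j) x))"
          unfolding step .
        also have "\<dots> \<le> ennreal (real ?n) * (ennreal c * (?w j * ?E j x))"
          by (intro mult_left_mono wE) auto
        finally show ?thesis using c by (simp add: ennreal_mult mult.assoc)
      qed
    qed (use L0 c in auto)
    moreover have "ennreal \<bar>U x - U y\<bar> \<le> ennreal (L + real ?n * c) *
            (\<Sum>j. ennreal (min 1 (2 ^ j * norm (x - y))) * (?w j * (?E j x
                + ?E j y)))" if x: "x \<notin> Z" "y \<notin> Z" for x y
    proof (rule real_bound_by_series[where s = "\<lambda>j. mol \<Phi> j U x - mol \<Phi> j U y"])
      show "(\<lambda>k. mol \<Phi> (J k) U x - mol \<Phi> (J k) U y) \<longlonglongrightarrow> U x - U y"
        using x by (intro tendsto_diff) (auto simp: Z_def)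
      have "ennreal \<bar>mol \<Phi> 0 U x - mol \<Phi> 0 U y\<bar> \<le> ennreal (min 1 (norm (x - y))) * (ennreal L * (?w 0
          * ?E 0 x + ?w 0 * ?E 0 y))"
        by (rule order_trans[OF mol_low_diff_le[OF \<Phi> U L0(1)]]) (intro mult_left_mono add_mono low; simp)
      then show "ennreal \<bar>mol \<Phi> 0 U x - mol \<Phi> 0 U y\<bar> \<le> ennreal L * (ennreal (min 1 (2 ^ 0 * norm (x - y)))
          * (?w 0 * (?E 0 x + ?E 0 y)))"
        by (simp add: distrib_left mult.left_commute)
      show "ennreal \<bar>mol \<Phi> (Suc j) U x - mol \<Phi> (Suc j) U y - (mol \<Phi> j U x - mol \<Phi> j U y)\<bar>
          \<le> ennreal (real ?n * c) * (ennreal (min 1 (2 ^ j * norm (x - y))) * (?w j * (?E j x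
              + ?E j y)))" for j
      proof -
        let ?m = "ennreal (min 1 (2 ^ j * norm (x - y)))"
        let ?c = "ennreal (c * ((2 ^ j) ^ ?n)^2)"
        have eq: "mol \<Phi> (Suc j) U x - mol \<Phi> (Suc j) U y - (mol \<Phi> j U x - mol \<Phi> j U y)
          = (\<Sum>i\<in>UNIV. (- 1 / 2 ^ j) ^ N * (mol (\<kappa> i) j (V i) x - mol (\<kappa> i) j (V i) y))"
          using step[of j x] step[of j y] by (simp add: right_diff_distrib sum_subtractf)
        have "ennreal \<bar>mol (\<kappa> i) j (V i) x - mol (\<kappa> i) j (V i) y\<bar> \<le> ?m * (?c * (osc d ((R + 1) / 2 ^ j) x
            + osc d ((R + 1) / 2 ^ j) y))" for i
          unfolding c_def by (rule mol_mean_zero_diff_le[OF \<kappa> \<kappa>0 R0 L0(1) V d Vd])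
        from up[OF this] have "ennreal \<bar>mol \<Phi> (Suc j) U x - mol \<Phi> (Suc j) U y - (mol \<Phi> j U x - mol \<Phi> j U y)\<bar>
          \<le> ennreal (real ?n) * (ennreal ((2 ^ j) powr - real N) * (?m * (?c * (osc d ((R + 1) / 2 ^ j) x
              + osc d ((R + 1) / 2 ^ j) y))))"
          unfolding eq .
        also have "\<dots> = ennreal (real ?n) * (?m * (ennreal ((2 ^ j) powr - real N) * (?c * osc d ((R
            + 1) / 2 ^ j) x)
            + ennreal ((2 ^ j) powr - real N) * (?c * osc d ((R + 1) / 2 ^ j) y)))"
          by (simp only: distrib_left ac_simps)
        also have "\<dots> \<le> ennreal (real ?n) * (?m * (ennreal c * (?w j * ?E j x) + ennreal c * (?w j * ?E j y)))"
          by (intro mult_left_mono add_mono wE) auto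
        also have "\<dots> = ennreal (real ?n * c) * (?m * (?w j * (?E j x + ?E j y)))"
          using c by (simp only: ennreal_mult of_nat_0_le_iff distrib_left ac_simps)
        finally show ?thesis .
      qed
    qed (use L0 c in auto)
    moreover have "AE x in lborel. x \<notin> Z" using J by (simp add: Z_def)
    ultimately show "\<exists>Z. (AE x in lborel. x \<notin> Z) \<and> lp_controlled (L + real ?n * c) (real N + \<theta>) ?E U Z"
      unfolding lp_controlled_def by (intro exI[of _ Z]) blast
  qed (use R L nc in linarith)+
qed

section \<open>Weak derivatives\<close>

lemma partials_append: "partials v (partials w \<phi>) = partials (v @ w) \<phi>"
  by (simp add: partials_def)

text \<open>Off the closed support the function vanishes in a neighbourhood, so differentiation does
  not enlarge the support.\<close>

lemma test_function_partials:
  fixes \<phi> :: "real^'n::finite \<Rightarrow> real"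
  assumes "test_function \<phi>"
  shows "test_function (partials w \<phi>)"
proof -
  have "{x. partials w \<phi> x \<noteq> 0} \<subseteq> closure {x. \<phi> x \<noteq> 0}"
  proof (induction w)
    case Nil
    then show ?case by (auto simp: partials_def intro: closure_subset[THEN subsetD])
  next
    case (Cons i w)
    have "partials (i # w) \<phi> x = 0" if x: "x \<notin> closure {x. \<phi> x \<noteq> 0}" for x
    proof -
      have "((\<lambda>_. 0) has_derivative (\<lambda>_. 0)) (at x)" by simp
      then have "(partials w \<phi> has_derivative (\<lambda>_. 0)) (at x)"
        by (rule has_derivative_transform_within_open[of _ _ _ _ "- closure {x. \<phi> x \<noteq> 0}"])
          (use x Cons in auto)
      then have "frechet_derivative (partials w \<phi>) (at x) = (\<lambda>_. 0)"
        by (rule frechet_derivative_at[symmetric])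
      then show ?thesis by (simp add: partials_def partial_def)
    qed
    then show ?case by blast
  qed
  then have "closure {x. partials w \<phi> x \<noteq> 0} \<subseteq> closure {x. \<phi> x \<noteq> 0}"
    by (simp add: closure_minimal)
  then have "compact (closure {x. partials w \<phi> x \<noteq> 0})"
  proof -
    have "compact (closure {x. \<phi> x \<noteq> 0} \<inter> closure {x. partials w \<phi> x \<noteq> 0})"
      using assms by (intro compact_Int_closed) (auto simp: test_function_def)
    moreover have "closure {x. \<phi> x \<noteq> 0} \<inter> closure {x. partials w \<phi> x \<noteq> 0} = closure {x. partials w \<phi> x \<noteq> 0}"
      using \<open>closure {x. partials w \<phi> x \<noteq> 0} \<subseteq> closure {x. \<phi> x \<noteq> 0}\<close> by blast
    ultimately show ?thesis by simp
  qed
  then show ?thesis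
    using assms unfolding test_function_def partials_append by blast
qed

section \<open>Borel representatives and local integrability\<close>

lemma measurable_test_function: "test_function \<phi> \<Longrightarrow> \<phi> \<in> borel_measurable borel"
proof -
  assume "test_function \<phi>"
  then have "partials [] \<phi> differentiable_on UNIV" unfolding test_function_def by blast
  then have "continuous_on UNIV \<phi>"
    by (intro differentiable_imp_continuous_on) (simp add: partials_def)
  then show ?thesis by (rule borel_measurable_continuous_onI)
qed

lemma locally_integrable_measurable:
  fixes u :: "real^'n::finite \<Rightarrow> real"
  assumes "locally_integrable u"
  shows "u \<in> borel_measurable lebesgue"
proof -
  have m: "(\<lambda>x. indicator (cball 0 (real k)) x *\<^sub>R u x) \<in> borel_measurable lebesgue" for k
  proof -
    have "set_integrable lebesgue (cball 0 (real k)) u"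
      using assms compact_cball unfolding locally_integrable_def by blast
    then show ?thesis unfolding set_integrable_def by (rule borel_measurable_integrable)
  qed
  have "(\<lambda>k. indicator (cball 0 (real k)) x *\<^sub>R u x) \<longlonglongrightarrow> u x" for x
  proof -
    obtain K :: nat where K: "norm x \<le> real K" using real_arch_simple by blast
    have "eventually (\<lambda>k. indicator (cball 0 (real k)) x *\<^sub>R u x = u x) sequentially"
      unfolding eventually_sequentially using K by (intro exI[of _ K]) (auto simp: indicator_def)
    then show ?thesis by (rule tendsto_eventually)
  qed
  then show ?thesis by (intro borel_measurable_LIMSEQ_real[OF _ m]) auto
qed

lemma locally_integrable_locint:
  fixes u :: "real^'n::finite \<Rightarrow> real"
  assumes u: "locally_integrable u" and v: "v \<in> borel_measurable borel" and eq: "AE x in lborel. u x = v x"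
  shows "locint v"
  unfolding locint_def
proof (intro conjI allI v)
  fix x :: "real^'n" and r
  have "integrable lebesgue (\<lambda>y. indicator (cball x r) y *\<^sub>R u y)"
    using u by (auto simp: locally_integrable_def set_integrable_def)
  then have "(\<integral>\<^sup>+y. ennreal (norm (indicator (cball x r) y *\<^sub>R u y)) \<partial>lebesgue) < \<infinity>"
    by (simp add: integrable_iff_bounded)
  also have "(\<integral>\<^sup>+y. ennreal (norm (indicator (cball x r) y *\<^sub>R u y)) \<partial>lebesgue)
     = (\<integral>\<^sup>+y\<in>cball x r. ennreal \<bar>v y\<bar> \<partial>lborel)"
    unfolding nn_integral_completion
    by (intro nn_integral_cong_AE) (use eq in \<open>auto elim!: eventually_mono simp: indicator_def\<close>)
  finally show "(\<integral>\<^sup>+y\<in>cball x r. ennreal \<bar>v y\<bar> \<partial>lborel) < \<infinity>" .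
qed

text \<open>Serves for \<open>u\<close> itself, whose membership in \<open>orlicz_space\<close> does
  not mention local integrability. One finite \<open>b\<close> with \<open>?P b \<noteq> 0\<close>
  gives \<open>\<bar>v y\<bar> \<le> b + (b / ?P b) * A \<bar>v y\<bar>\<close>; when
  \<open>?P b = \<infinity>\<close>, finiteness of the modular forces
  \<open>\<bar>v y\<bar> < b\<close> almost everywhere.\<close>

lemma modular_locint:
  fixes v :: "real^'n::finite \<Rightarrow> real"
  assumes A: "young_function A" and v[measurable]: "v \<in> borel_measurable borel"
    and I: "(\<integral>\<^sup>+x. A \<bar>v x\<bar> \<partial>lborel) \<le> 1"
  shows "locint v"
  unfolding locint_def
proof (intro conjI allI v)
  fix x :: "real^'n" and r
  let ?P = "young_extend A"
  have P: "star_function ?P" by (rule young_extend_star[OF A])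
  note [measurable] = star_function_measurable[OF P]
  obtain b where b: "b < \<infinity>" "?P b \<noteq> 0" using P by (auto simp: star_function_def)
  then have b0: "b \<noteq> 0" using star_functionD(2)[OF P] by auto
  let ?q = "b / ?P b"
  have q: "?q < \<infinity>" using b by (cases "?P b"; cases b) (auto simp: divide_ennreal)
  have pt: "ennreal \<bar>v y\<bar> \<le> b + ?q * A \<bar>v y\<bar> \<or> ?P b = \<infinity>" for y
  proof (cases "?P b = \<infinity>")
    case False
    let ?f = "ennreal \<bar>v y\<bar>"
    have "(?f - b) / b * ?P b \<le> ?P ?f" by (rule star_function_lower[OF P b0 b(1)])
    then have "?q * ((?f - b) / b * ?P b) \<le> ?q * ?P ?f" by (rule mult_left_mono) simp
    moreover have "?q * ((?f - b) / b * ?P b) = ?f - b"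
    proof -
      obtain b' p where r: "b = ennreal b'" "0 < b'" "?P b = ennreal p" "0 < p"
        using b b0 False by (cases b; cases "?P b") auto
      have "?f - b = ennreal (\<bar>v y\<bar> - b')" using r by (simp add: ennreal_minus)
      moreover have "?q = ennreal (b' / p)" unfolding r(3) unfolding r(1) using r
          by (simp add: divide_ennreal)
      moreover have "(?f - b) / b * ?P b = ennreal (max 0 (\<bar>v y\<bar> - b') / b' * p)"
        unfolding r(3) unfolding r(1) using r
        by (cases "b' \<le> \<bar>v y\<bar>") (auto simp: ennreal_minus divide_ennreal ennreal_mult[symmetric]
            ennreal_neg max_def)
      moreover have "ennreal (b' / p) * ennreal (max 0 (\<bar>v y\<bar> - b') / b' * p) = ennreal (max 0 (\<bar>v y\<bar> - b'))"
        using r by (subst ennreal_mult[symmetric]) auto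
      ultimately show ?thesis by (simp add: ennreal_max_0)
    qed
    ultimately have "?f - b \<le> ?q * A \<bar>v y\<bar>" by simp
    then have "b + (?f - b) \<le> b + ?q * A \<bar>v y\<bar>" by (rule add_left_mono)
    then show ?thesis using ennreal_le_add_diff[of ?f b] by (meson order_trans)
  qed simp
  have "AE y in lborel. ennreal \<bar>v y\<bar> \<le> b + ?q * A \<bar>v y\<bar>"
  proof (cases "?P b = \<infinity>")
    case True
    have m: "(\<lambda>y. ?P (ennreal \<bar>v y\<bar>)) \<in> borel_measurable lborel" by measurable
    have "(\<integral>\<^sup>+y. ?P (ennreal \<bar>v y\<bar>) \<partial>lborel) \<noteq> \<infinity>" using I by (auto simp: top_unique)
    then have "AE y in lborel. ?P (ennreal \<bar>v y\<bar>) \<noteq> \<infinity>" by (rule nn_integral_noteq_infinite[OF m])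
    then show ?thesis
    proof (rule eventually_mono)
      fix y assume y: "?P (ennreal \<bar>v y\<bar>) \<noteq> \<infinity>"
      have "\<not> b \<le> ennreal \<bar>v y\<bar>"
        using monoD[OF star_functionD(1)[OF P], of b "ennreal \<bar>v y\<bar>"] True y by (auto simp: top_unique)
      then have "ennreal \<bar>v y\<bar> \<le> b" by simp
      then show "ennreal \<bar>v y\<bar> \<le> b + ?q * A \<bar>v y\<bar>" by (rule order_trans) simp
    qed
  qed (use pt in auto)
  then have "(\<integral>\<^sup>+y\<in>cball x r. ennreal \<bar>v y\<bar> \<partial>lborel) \<le> (\<integral>\<^sup>+y. b * indicator (cball x r) y + ?q
      * ?P (ennreal \<bar>v y\<bar>) \<partial>lborel)"
    by (intro nn_integral_mono_AE) (auto elim!: eventually_mono simp: indicator_def)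
  also have "\<dots> = b * emeasure lborel (cball x r) + ?q * (\<integral>\<^sup>+y. A \<bar>v y\<bar> \<partial>lborel)"
    by (simp add: nn_integral_add nn_integral_cmult nn_integral_cmult_indicator del: young_extend_ennreal)
        simp
  also have "\<dots> \<le> b * emeasure lborel (cball x r) + ?q * 1"
    by (intro add_left_mono mult_left_mono I) auto
  also have "\<dots> < \<infinity>"
    using b(1) q emeasure_lborel_cball_finite[of x r] by (simp add: ennreal_mult_less_top)
  finally show "(\<integral>\<^sup>+y\<in>cball x r. ennreal \<bar>v y\<bar> \<partial>lborel) < \<infinity>" .
qed

text \<open>With a strict inequality some admissible number lies below \<open>lam\<close>, and
  monotonicity of \<open>A\<close> does the rest; whether the infimum is attained does not
  matter.\<close>

lemma luxemburg_norm_lt_imp: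
  assumes A: "young_function A" and lt: "luxemburg_norm A u < ennreal lam"
  shows "(\<integral>\<^sup>+x. A (\<bar>u x\<bar> / lam) \<partial>lebesgue) \<le> 1"
proof -
  obtain l where l: "0 < l" "(\<integral>\<^sup>+x. A (\<bar>u x\<bar> / l) \<partial>lebesgue) \<le> 1" "ennreal l < ennreal lam"
    using lt unfolding luxemburg_norm_def by (auto simp: INF_less_iff)
  then have "l < lam" by (simp add: ennreal_less_iff)
  then have "(\<integral>\<^sup>+x. A (\<bar>u x\<bar> / lam) \<partial>lebesgue) \<le> (\<integral>\<^sup>+x. A (\<bar>u x\<bar> / l) \<partial>lebesgue)"
    using l(1) by (intro nn_integral_mono young_function_mono[OF A] divide_left_mono) auto
  then show ?thesis using l(2) by simp
qed

lemma frac_seminorm_lt_imp: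
  fixes U :: "'i \<Rightarrow> real^'n::finite \<Rightarrow> real"
  assumes A: "young_function A" and lt: "frac_seminorm \<theta> A I U < ennreal lam"
  shows "(\<integral>\<^sup>+y. (\<integral>\<^sup>+x. A (L2_set (\<lambda>i. U i x - U i y) I / (lam * norm (x - y) powr \<theta>))
                   / ennreal (norm (x - y) ^ CARD('n)) \<partial>lebesgue) \<partial>lebesgue) \<le> 1"
proof -
  obtain l where l: "0 < l" "(\<integral>\<^sup>+y. (\<integral>\<^sup>+x. A (L2_set (\<lambda>i. U i x - U i y) I / (l * norm (x - y) powr \<theta>))
                   / ennreal (norm (x - y) ^ CARD('n)) \<partial>lebesgue) \<partial>lebesgue) \<le> 1" "ennreal l < ennreal lam"
    using lt unfolding frac_seminorm_def by (auto simp: INF_less_iff)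
  then have ll: "l < lam" by (simp add: ennreal_less_iff)
  have "A (L2_set (\<lambda>i. U i x - U i y) I / (lam * norm (x - y) powr \<theta>))
      \<le> A (L2_set (\<lambda>i. U i x - U i y) I / (l * norm (x - y) powr \<theta>))" for x y
  proof (cases "x = y")
    case False
    then show ?thesis using l(1) ll
      by (intro young_function_mono[OF A] divide_left_mono mult_right_mono) (auto simp: L2_set_nonneg)
  qed simp
  then have "(\<integral>\<^sup>+y. (\<integral>\<^sup>+x. A (L2_set (\<lambda>i. U i x - U i y) I / (lam * norm (x - y) powr \<theta>))
                   / ennreal (norm (x - y) ^ CARD('n)) \<partial>lebesgue) \<partial>lebesgue)
     \<le> (\<integral>\<^sup>+y. (\<integral>\<^sup>+x. A (L2_set (\<lambda>i. U i x - U i y) I / (l * norm (x - y) powr \<theta>))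
                   / ennreal (norm (x - y) ^ CARD('n)) \<partial>lebesgue) \<partial>lebesgue)"
    by (intro nn_integral_mono divide_right_mono_ennreal)
  then show ?thesis using l(2) by simp
qed

section \<open>Scaled derivatives of a Sobolev function\<close>

lemma finite_words [simp]: "finite (words k :: 'n::finite list set)"
  using finite_lists_length_eq[of "UNIV :: 'n set" k] by (simp add: words_def)

lemma weak_deriv_is_weak_deriv:
  fixes u :: "real^'n::finite \<Rightarrow> real"
  assumes "u \<in> sobolev_space m A" "w \<noteq> []" "length w \<le> m"
  shows "is_weak_deriv w u (weak_deriv w u)"
proof -
  have k: "length w \<in> {1..m}" using assms(2,3) by (cases w) auto
  have "\<forall>k\<in>{1..m}. \<forall>w\<in>words k. \<exists>v. is_weak_deriv w u v"
    using assms(1) by (auto simp: sobolev_space_def)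
  from bspec[OF this k] have "\<exists>v. is_weak_deriv w u v" by (simp add: words_def)
  then have "is_weak_deriv w u (SOME v. is_weak_deriv w u v)" by (rule someI_ex)
  then show ?thesis using assms(2) by (simp add: weak_deriv_def)
qed

lemma locint_divide:
  assumes "locint U" "0 < (l::real)" shows "locint (\<lambda>x. U x / l)"
  unfolding locint_def
proof (intro conjI allI)
  have [measurable]: "U \<in> borel_measurable borel" using assms by (simp add: locint_def)
  show "(\<lambda>x. U x / l) \<in> borel_measurable borel" by measurable
  fix x r
  have "ennreal \<bar>U y / l\<bar> * indicator (cball x r) y = ennreal (1 / l) * (ennreal \<bar>U y\<bar>
      * indicator (cball x r) y)" for y
    using assms(2) by (simp add: abs_divide ennreal_mult[symmetric] mult.assoc[symmetric])
  then have "(\<integral>\<^sup>+y\<in>cball x r. ennreal \<bar>U y / l\<bar> \<partial>lborel) = ennreal (1 / l)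
      * (\<integral>\<^sup>+y\<in>cball x r. ennreal \<bar>U y\<bar> \<partial>lborel)"
    by (simp add: nn_integral_cmult)
  then show "(\<integral>\<^sup>+y\<in>cball x r. ennreal \<bar>U y / l\<bar> \<partial>lborel) < \<infinity>"
    using assms(1) by (simp add: locint_def ennreal_mult_less_top)
qed

text \<open>Testing \<open>u\<close> against \<open>partials (w @ replicate N i) \<phi>\<close> in
  two ways shows that its derivative along this word is the weak pure derivative of order
  \<open>N\<close> of its derivative along \<open>w\<close>. Borel versions are chosen for all words
  at once, so that these relations hold between the same representatives.\<close>

lemma scaled_derivs:
  fixes u :: "real^'n::finite \<Rightarrow> real"
  assumes A: "young_function A" and u: "u \<in> sobolev_space m A"
      and lam: "0 < lam" "luxemburg_norm A u < ennreal lam"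
  obtains v where "\<And>w. length w \<le> m \<Longrightarrow> locint (v w)"
    "\<And>w. length w \<le> m \<Longrightarrow> AE x in lborel. weak_deriv w u x / lam = v w x"
    "\<And>w N. length w + N \<le> m \<Longrightarrow> pure_derivs N (v w) (\<lambda>i. v (w @ replicate N i))"
proof -
  have um: "u \<in> borel_measurable lebesgue" using u by (simp add: sobolev_space_def orlicz_space_def)
  have wm: "weak_deriv w u \<in> borel_measurable lebesgue" if "length w \<le> m" for w
  proof (cases "w = []")
    case False
    then show ?thesis using weak_deriv_is_weak_deriv[OF u False that]
      by (intro locally_integrable_measurable) (simp add: is_weak_deriv_def)
  qed (simp add: weak_deriv_def um)
  have "\<exists>v. length w \<le> m \<longrightarrow> v \<in> borel_measurable borel \<and> (AE x in lborel. weak_deriv w u x = v x)" for w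
    using completion_ex_borel_measurable_real[of "weak_deriv w u" lborel] wm[of w] by auto
  then obtain v0 where v0: "\<And>w. length w \<le> m \<Longrightarrow> v0 w \<in> borel_measurable borel"
    "\<And>w. length w \<le> m \<Longrightarrow> AE x in lborel. weak_deriv w u x = v0 w x" by metis
  define v where "v w x = v0 w x / lam" for w x
  have vm: "v w \<in> borel_measurable borel" if "length w \<le> m" for w
    using v0(1)[OF that] unfolding v_def by measurable
  have vAE: "AE x in lborel. weak_deriv w u x / lam = v w x" if "length w \<le> m" for w
    using v0(2)[OF that] by eventually_elim (simp add: v_def)
  have li: "locint (v w)" if "length w \<le> m" for w
  proof (cases "w = []")
    case True
    have "(\<integral>\<^sup>+x. A (\<bar>u x\<bar> / lam) \<partial>lebesgue) \<le> 1" by (rule luxemburg_norm_lt_imp[OF A lam(2)])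
    also have "(\<integral>\<^sup>+x. A (\<bar>u x\<bar> / lam) \<partial>lebesgue) = (\<integral>\<^sup>+x. A \<bar>v [] x\<bar> \<partial>lborel)"
      unfolding nn_integral_completion
    proof (rule nn_integral_cong_AE, rule eventually_mono)
      show "AE x in lborel. weak_deriv [] u x / lam = v [] x" using vAE[of "[]"] by simp
      fix x assume "weak_deriv [] u x / lam = v [] x"
      then have "v [] x = u x / lam" by (simp add: weak_deriv_def)
      then show "A (\<bar>u x\<bar> / lam) = A \<bar>v [] x\<bar>" by (simp only: abs_divide abs_of_pos[OF lam(1)])
    qed
    finally show ?thesis unfolding True using vm[of "[]"] by (intro modular_locint[OF A]) auto
  next
    case False
    have "locint (v0 w)"
      using weak_deriv_is_weak_deriv[OF u False that] v0[OF that]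
      by (intro locally_integrable_locint[of "weak_deriv w u"]) (auto simp: is_weak_deriv_def)
    then show ?thesis unfolding v_def using lam(1) by (rule locint_divide)
  qed
  have wd: "(LINT x|lebesgue. u x * partials w \<phi> x) = (-1) ^ length w * (LINT x|lebesgue. weak_deriv w u x
      * \<phi> x)"
    if "length w \<le> m" "test_function \<phi>" for w \<phi>
  proof (cases "w = []")
    case False
    then show ?thesis using weak_deriv_is_weak_deriv[OF u False that(1)] that(2)
        by (simp add: is_weak_deriv_def)
  qed (simp add: weak_deriv_def partials_def)
  have tr: "(LINT x|lborel. v w x * \<psi> x) = (LINT x|lebesgue. weak_deriv w u x * \<psi> x) / lam"
    if w: "length w \<le> m" and \<psi>: "test_function \<psi>" for w \<psi>
  proof -
    note [measurable] = vm[OF w] measurable_test_function[OF \<psi>] v0(1)[OF w]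
    have "(LINT x|lborel. v w x * \<psi> x) = (LINT x|lborel. v0 w x * \<psi> x) / lam"
      by (simp add: v_def)
    also have "(LINT x|lborel. v0 w x * \<psi> x) = (LINT x|lebesgue. v0 w x * \<psi> x)"
      by (rule integral_completion[symmetric]) measurable
    also have "\<dots> = (LINT x|lebesgue. weak_deriv w u x * \<psi> x)"
    proof (rule integral_cong_AE)
      show "AE x in lebesgue. v0 w x * \<psi> x = weak_deriv w u x * \<psi> x"
        using AE_completion[OF v0(2)[OF w]] by eventually_elim simp
      show "(\<lambda>x. v0 w x * \<psi> x) \<in> borel_measurable lebesgue" by (intro measurable_completion) measurable
      have "\<psi> \<in> borel_measurable lebesgue" by (intro measurable_completion) measurable
      then show "(\<lambda>x. weak_deriv w u x * \<psi> x) \<in> borel_measurable lebesgue" using wm[OF w] by measurable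
    qed
    finally show ?thesis .
  qed
  have pd: "pure_derivs N (v w) (\<lambda>i. v (w @ replicate N i))" if "length w + N \<le> m" for w N
    unfolding pure_derivs_def
  proof (intro allI impI)
    fix i :: 'n and \<phi> :: "real^'n \<Rightarrow> real" assume \<phi>: "test_function \<phi>"
    let ?\<psi> = "partials (replicate N i) \<phi>" and ?w = "w @ replicate N i"
    have \<psi>: "test_function ?\<psi>" using \<phi> by (rule test_function_partials)
    have "(-1) ^ length w * (LINT x|lebesgue. weak_deriv w u x * ?\<psi> x) = (LINT x|lebesgue. u x
        * partials ?w \<phi> x)"
      using wd[OF _ \<psi>, of w] that by (simp add: partials_append)
    also have "\<dots> = (-1) ^ length ?w * (LINT x|lebesgue. weak_deriv ?w u x * \<phi> x)"
      using that by (intro wd \<phi>) simp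
    also have "\<dots> = (-1) ^ length w * ((-1) ^ N * (LINT x|lebesgue. weak_deriv ?w u x * \<phi> x))"
      by (simp add: power_add mult.assoc)
    finally have "(LINT x|lebesgue. weak_deriv w u x * ?\<psi> x) = (-1) ^ N
        * (LINT x|lebesgue. weak_deriv ?w u x * \<phi> x)"
      by simp
    then show "(LINT y|lborel. v w y * ?\<psi> y) = (-1) ^ N * (LINT y|lborel. v ?w y * \<phi> y)"
      using that by (simp add: tr \<phi> \<psi>)
  qed
  show thesis by (rule that[OF li vAE pd])
qed

section \<open>The embedding\<close>

lemma abs_le_L2_set: "finite I \<Longrightarrow> i \<in> I \<Longrightarrow> \<bar>f i\<bar> \<le> L2_set f I"
  using member_le_L2_set[of I i "\<lambda>i. \<bar>f i\<bar>"] by (simp add: L2_set_def)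

lemma L2_set_divide: "0 < l \<Longrightarrow> L2_set (\<lambda>i. f i / l) I = L2_set f I / l"
  using L2_set_right_distrib[of "1 / l" f I] by simp

lemma measurable_L2_set:
  assumes "\<And>i. i \<in> I \<Longrightarrow> f i \<in> borel_measurable M"
  shows "(\<lambda>x. L2_set (\<lambda>i. f i x) I) \<in> borel_measurable M"
  unfolding L2_set_def
proof (rule borel_measurable_continuous_onI[OF continuous_on_real_sqrt[OF continuous_on_id], THEN
    measurable_compose_rev])
  show "(\<lambda>x. \<Sum>i\<in>I. (f i x)\<^sup>2) \<in> borel_measurable M"
    using assms by (intro borel_measurable_sum borel_measurable_power)
qed

text \<open>\<open>lam\<close> is a strict upper bound for each norm involved, so that the unit
  bounds hold for the modulars of the functions divided by \<open>lam\<close>.\<close>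

definition embedding_data :: "nat \<Rightarrow> real \<Rightarrow> (real \<Rightarrow> ennreal) \<Rightarrow> (real^'n::finite \<Rightarrow> real) \<Rightarrow> nat \<Rightarrow> real \<Rightarrow>
    bool" where
  "embedding_data m \<theta> A u k lam \<longleftrightarrow> young_function A \<and> u \<in> sobolev_space m A \<and> 0 < lam \<and>
     luxemburg_norm A u < ennreal lam \<and> luxemburg_norm A (grad_length k u) < ennreal lam \<and>
     frac_seminorm \<theta> A (words m) (\<lambda>w. weak_deriv w u) < ennreal lam"

text \<open>A single family \<open>F\<close> and a single exceptional set serve all derivatives of
  order \<open>k\<close>, so that their components can be summed.\<close>

definition scale_controlled :: "real \<Rightarrow> real \<Rightarrow> real \<Rightarrow> (real \<Rightarrow> ennreal) \<Rightarrow> (real^'n::finite \<Rightarrow> real) \<Rightarrow> nat \<Rightarrow> real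
    \<Rightarrow> (nat \<Rightarrow> real^'n \<Rightarrow> ennreal) \<Rightarrow> (real^'n) set \<Rightarrow> bool" where
  "scale_controlled C K \<gamma> A u k lam F Z \<longleftrightarrow>
     (\<forall>j. F j \<in> borel_measurable borel) \<and>
     (\<forall>j x. young_extend A (F j x) \<le> ennreal ((2 ^ j) ^ CARD('n))) \<and>
     (\<Sum>j. \<integral>\<^sup>+x. young_extend A (F j x) \<partial>lborel) \<le> ennreal K \<and>
     (AE x in lborel. x \<notin> Z) \<and>
     (\<forall>w\<in>words k. lp_controlled C \<gamma> F (\<lambda>x. weak_deriv w u x / lam) Z)"

lemma scale_controlledD:
  assumes "scale_controlled C K \<gamma> A (u :: real^'n::finite \<Rightarrow> real) k lam F Z"
  shows "F j \<in> borel_measurable borel" "young_extend A (F j x) \<le> ennreal ((2 ^ j) ^ CARD('n))"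
    "(\<Sum>j. \<integral>\<^sup>+x. young_extend A (F j x) \<partial>lborel) \<le> ennreal K"
    "AE x in lborel. x \<notin> Z"
    "w \<in> words k \<Longrightarrow> x \<notin> Z \<Longrightarrow>
      ennreal \<bar>weak_deriv w u x / lam\<bar> \<le> ennreal C * (\<Sum>j. ennreal ((2 ^ j) powr - \<gamma>) * F j x)"
    "w \<in> words k \<Longrightarrow> x \<notin> Z \<Longrightarrow> y \<notin> Z \<Longrightarrow>
      ennreal \<bar>weak_deriv w u x / lam - weak_deriv w u y / lam\<bar> \<le> ennreal C *
        (\<Sum>j. ennreal (min 1 (2 ^ j * norm (x - y))) * (ennreal ((2 ^ j) powr - \<gamma>) * (F j x + F j y)))"
  using assms unfolding scale_controlled_def lp_controlled_def by simp_all

text \<open>Joins \<open>littlewood_paley_bounds\<close>, which controls derivatives by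
  \<open>scale_energy\<close>, with \<open>scale_energy_bounds\<close>, which controls the modulars
  of \<open>scale_energy\<close>. Both are eliminated before \<open>A\<close> and \<open>u\<close>
  are fixed, which keeps \<open>C\<close> and \<open>K\<close> independent of them.\<close>

lemma derivative_scale_bounds:
  assumes km: "k \<le> m" and \<theta>: "0 < \<theta>"
  obtains C K where "0 < C" "1 \<le> K"
    "\<And>A (u :: real^'n::finite \<Rightarrow> real) lam. embedding_data m \<theta> A u k lam \<Longrightarrow>
      \<exists>F Z. scale_controlled C K (real (m - k) + \<theta>) A u k lam F Z"
proof (rule littlewood_paley_bounds[of "m - k", where 'n = 'n])
  fix R C0 :: real
  assume R: "1 \<le> R" and C0: "1 \<le> C0" and LP:
    "\<And>(U :: real^'n \<Rightarrow> real) V d D \<theta>. locint U \<Longrightarrow> (\<And>i. locint (V i)) \<Longrightarrow> pure_derivs (m - k) U V \<Longrightarrow>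
      case_prod d \<in> borel_measurable (borel \<Otimes>\<^sub>M borel) \<Longrightarrow> (\<And>i y z. \<bar>V i y - V i z\<bar> \<le> d y z) \<Longrightarrow>
      (\<And>y. \<bar>U y\<bar> \<le> D y) \<Longrightarrow>
      \<exists>Z. (AE x in lborel. x \<notin> Z) \<and> lp_controlled C0 (real (m - k) + \<theta>) (scale_energy \<theta> R d D) U Z"
  show thesis
  proof (rule scale_energy_bounds[OF \<theta> R, where 'n = 'n])
    fix c K :: real
    assume c: "0 < c" and K: "1 \<le> K" and SE:
      "\<And>P (d :: real^'n \<Rightarrow> real^'n \<Rightarrow> real) D j x.
        unit_energy P \<theta> d D \<Longrightarrow>
        P (ennreal c * scale_energy \<theta> R d D j x) \<le> ennreal ((2 ^ j) ^ CARD('n)) \<and>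
        (\<Sum>j. \<integral>\<^sup>+x. P (ennreal c * scale_energy \<theta> R d D j x) \<partial>lborel) \<le> ennreal K"
    show thesis
    proof (rule that[of "C0 / c" K])
      show "0 < C0 / c" using C0 c by simp
      fix A and u :: "real^'n \<Rightarrow> real" and lam
      assume "embedding_data m \<theta> A u k lam"
      then have A: "young_function A" and u: "u \<in> sobolev_space m A"
          and lam: "0 < lam" "luxemburg_norm A u < ennreal lam"
        and lk: "luxemburg_norm A (grad_length k u) < ennreal lam"
        and ls: "frac_seminorm \<theta> A (words m) (\<lambda>w. weak_deriv w u) < ennreal lam"
        by (auto simp: embedding_data_def)
      let ?P = "young_extend A"
      have P: "star_function ?P" by (rule young_extend_star[OF A])
      obtain v where v: "\<And>w. length w \<le> m \<Longrightarrow> locint (v w)"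
        "\<And>w. length w \<le> m \<Longrightarrow> AE x in lborel. weak_deriv w u x / lam = v w x"
        "\<And>w N. length w + N \<le> m \<Longrightarrow> pure_derivs N (v w) (\<lambda>i. v (w @ replicate N i))"
        by (rule scaled_derivs[OF A u lam], rule that) assumption+
      have vm: "v w \<in> borel_measurable borel" if "length w \<le> m" for w
        using v(1)[OF that] by (simp add: locint_def)
      \<comment> \<open>The distance of the full gradients of order \<open>m\<close> dominates the
        increment of every component, in particular of the pure derivatives along
        \<open>w @ replicate (m - k) i\<close>.\<close>
      define d where "d z y = L2_set (\<lambda>w. v w z - v w y) (words m)" for z y
      define D where "D y = L2_set (\<lambda>w. v w y) (words k)" for y
      have dm: "case_prod d \<in> borel_measurable (borel \<Otimes>\<^sub>M borel)"
      proof -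
        have "(\<lambda>p. L2_set (\<lambda>w. v w (fst p) - v w (snd p)) (words m)) \<in> borel_measurable (borel \<Otimes>\<^sub>M borel)"
        proof (rule measurable_L2_set)
          fix w :: "'n list" assume "w \<in> words m"
          then have [measurable]: "v w \<in> borel_measurable borel" by (intro vm) (simp add: words_def)
          show "(\<lambda>p. v w (fst p) - v w (snd p)) \<in> borel_measurable (borel \<Otimes>\<^sub>M borel)" by measurable
        qed
        then show ?thesis by (simp add: d_def case_prod_beta')
      qed
      have Dm: "D \<in> borel_measurable borel"
        unfolding D_def using km by (intro measurable_L2_set vm) (simp add: words_def)
      have d0: "d y y = 0" "0 \<le> d y z" for y z by (auto simp: d_def L2_set_def intro: sum_nonneg)
      have good: "AE x in lborel. \<forall>w\<in>words k \<union> words m. weak_deriv w u x / lam = v w x"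
      proof (rule AE_finite_allI)
        fix w :: "'n list" assume "w \<in> words k \<union> words m"
        then have "length w \<le> m" using km by (auto simp: words_def)
        then show "AE x in lborel. weak_deriv w u x / lam = v w x" by (rule v(2))
      qed simp
      have ID: "(\<integral>\<^sup>+y. ?P (ennreal (D y)) \<partial>lborel) \<le> 1"
      proof -
        have "(\<integral>\<^sup>+y. ?P (ennreal (D y)) \<partial>lborel) = (\<integral>\<^sup>+x. A (\<bar>grad_length k u x\<bar> / lam) \<partial>lebesgue)"
          unfolding nn_integral_completion
        proof (rule nn_integral_cong_AE, rule eventually_mono[OF good])
          fix x assume x: "\<forall>w\<in>words k \<union> words m. weak_deriv w u x / lam = v w x"
          have "D x = L2_set (\<lambda>w. weak_deriv w u x / lam) (words k)"
            unfolding D_def using x by (intro L2_set_cong) auto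
          also have "\<dots> = \<bar>grad_length k u x\<bar> / lam"
            using lam(1) by (simp add: L2_set_divide grad_length_def abs_of_nonneg L2_set_nonneg)
          finally show "?P (ennreal (D x)) = A (\<bar>grad_length k u x\<bar> / lam)" using lam(1) by simp
        qed
        also have "\<dots> \<le> 1" by (rule luxemburg_norm_lt_imp[OF A lk])
        finally show ?thesis .
      qed
      have Id: "(\<integral>\<^sup>+y. \<integral>\<^sup>+z. ?P (ennreal (d z y / norm (z - y) powr \<theta>)) / ennreal (norm (z - y) ^
          CARD('n)) \<partial>lborel \<partial>lborel) \<le> 1"
      proof -
        have "(\<integral>\<^sup>+y. \<integral>\<^sup>+z. ?P (ennreal (d z y / norm (z - y) powr \<theta>)) / ennreal (norm (z - y) ^ CARD('n))
            \<partial>lborel \<partial>lborel)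
          = (\<integral>\<^sup>+y. (\<integral>\<^sup>+x. A (L2_set (\<lambda>w. weak_deriv w u x - weak_deriv w u y) (words m) / (lam
              * norm (x - y) powr \<theta>))
                     / ennreal (norm (x - y) ^ CARD('n)) \<partial>lebesgue) \<partial>lebesgue)"
          unfolding nn_integral_completion
        proof (rule nn_integral_cong_AE, rule eventually_mono[OF good], rule nn_integral_cong_AE, rule
            eventually_mono[OF good])
          fix y x assume y: "\<forall>w\<in>words k \<union> words m. weak_deriv w u y / lam = v w y"
            and x: "\<forall>w\<in>words k \<union> words m. weak_deriv w u x / lam = v w x"
          have "d x y = L2_set (\<lambda>w. (weak_deriv w u x - weak_deriv w u y) / lam) (words m)"
            unfolding d_def using x y by (intro L2_set_cong) (auto simp: diff_divide_distrib)
          then have "d x y / norm (x - y) powr \<theta> = L2_set (\<lambda>w. weak_deriv w u x - weak_deriv w u y) (words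
              m) / (lam * norm (x - y) powr \<theta>)"
            using lam(1) by (simp add: L2_set_divide)
          moreover have "0 \<le> d x y / norm (x - y) powr \<theta>" using d0 by simp
          ultimately show "?P (ennreal (d x y / norm (x - y) powr \<theta>)) / ennreal (norm (x - y) ^ CARD('n))
            = A (L2_set (\<lambda>w. weak_deriv w u x - weak_deriv w u y) (words m) / (lam
                * norm (x - y) powr \<theta>)) / ennreal (norm (x - y) ^ CARD('n))"
            by simp
        qed
        also have "\<dots> \<le> 1" by (rule frac_seminorm_lt_imp[OF A ls])
        finally show ?thesis .
      qed
      define F where "F j x = ennreal c * scale_energy \<theta> R d D j x" for j x
      have Fm: "F j \<in> borel_measurable borel" for j
        unfolding F_def using measurable_scale_energy[OF dm Dm] by measurable
      have EF: "scale_energy \<theta> R d D j x = ennreal (1 / c) * F j x" for j x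
        unfolding F_def using c by (simp add: mult.assoc[symmetric] ennreal_mult[symmetric])
      have F: "?P (F j x) \<le> ennreal ((2 ^ j) ^ CARD('n))" "(\<Sum>j. \<integral>\<^sup>+x. ?P (F j x) \<partial>lborel) \<le> ennreal K" for j x
        using SE[of ?P d D] P dm Dm d0 Id ID by (auto simp: F_def unit_energy_def)
      define Q where "Q w Z \<longleftrightarrow> (AE x in lborel. x \<notin> Z) \<and>
        lp_controlled C0 (real (m - k) + \<theta>) (scale_energy \<theta> R d D) (v w) Z" for w Z
      have "\<exists>Z. Q w Z" if True: "w \<in> words k" for w
      proof -
        have w: "length w = k" using True by (simp add: words_def)
        show ?thesis
          unfolding Q_def
        proof (rule LP[where V = "\<lambda>i. v (w @ replicate (m - k) i)"])
          show "locint (v w)" using w km by (intro v) simp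
          show "locint (v (w @ replicate (m - k) i))" for i using w km by (intro v) simp
          show "pure_derivs (m - k) (v w) (\<lambda>i. v (w @ replicate (m - k) i))" using w km by (intro v) simp
          show "\<bar>v (w @ replicate (m - k) i) y - v (w @ replicate (m - k) i) z\<bar> \<le> d y z" for i y z
          proof -
            have "w @ replicate (m - k) i \<in> words m" using w km by (simp add: words_def)
            from abs_le_L2_set[OF finite_words this, of "\<lambda>w. v w y - v w z"] show ?thesis
                by (simp only: d_def)
          qed
          show "\<bar>v w y\<bar> \<le> D y" for y unfolding D_def by (rule abs_le_L2_set[OF finite_words True])
        qed (rule dm)
      qed
      then have "\<forall>w\<in>words k. \<exists>Z. Q w Z" by (rule ballI)
      from bchoice[OF this] obtain Zw where QZ: "\<forall>w\<in>words k. Q w (Zw w)" by (rule exE)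
      have Zw: "AE x in lborel. x \<notin> Zw w" "lp_controlled C0 (real (m - k)
          + \<theta>) (scale_energy \<theta> R d D) (v w) (Zw w)"
        if "w \<in> words k" for w
        using QZ that by (auto simp: Q_def)
      \<comment> \<open>The exceptional sets of the finitely many words, together with the points
        where a Borel version differs from the scaled \<open>weak_deriv\<close>.\<close>
      define Z where "Z = {x. \<not> ((\<forall>w\<in>words k \<union> words m. weak_deriv w u x / lam = v w x)
          \<and> (\<forall>w\<in>words k. x \<notin> Zw w))}"
      have "AE x in lborel. \<forall>w\<in>words k. x \<notin> Zw w" by (intro AE_finite_allI Zw) auto
      with good have ZAE: "AE x in lborel. x \<notin> Z" by eventually_elim (simp add: Z_def)
      have lp: "lp_controlled (C0 / c) (real (m - k)
          + \<theta>) F (\<lambda>x. weak_deriv w u x / lam) Z" if "w \<in> words k" for w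
        by (rule lp_controlled_scale[OF Zw(2)[OF that] c _ EF]) (use C0 that in \<open>auto simp: Z_def\<close>)
      have "scale_controlled (C0 / c) K (real (m - k) + \<theta>) A u k lam F Z"
        unfolding scale_controlled_def by (intro conjI allI ballI Fm F ZAE lp)
      then show "\<exists>F Z. scale_controlled (C0 / c) K (real (m - k) + \<theta>) A u k lam F Z" by blast
    qed (rule K)
  qed
qed

section \<open>Estimates for the derivatives of one order\<close>

lemma sum_words_bound:
  assumes "\<And>w. w \<in> words k \<Longrightarrow> ennreal \<bar>f w\<bar> \<le> ennreal C * (S :: ennreal)" "0 \<le> C"
  shows "ennreal (\<Sum>w\<in>(words k :: 'n::finite list set). \<bar>f w\<bar>)
      \<le> ennreal (real (card (words k :: 'n list set)) * C) * S"
proof -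
  have "ennreal (\<Sum>w\<in>(words k :: 'n list set). \<bar>f w\<bar>) = (\<Sum>w\<in>words k. ennreal \<bar>f w\<bar>)"
    by (rule sum_ennreal[symmetric]) simp
  also have "\<dots> \<le> (\<Sum>w\<in>(words k :: 'n list set). ennreal C * S)" by (rule sum_mono) (rule assms(1))
  also have "\<dots> = ennreal (real (card (words k :: 'n list set))) * (ennreal C * S)"
    by (simp add: ennreal_of_nat_eq_real_of_nat)
  finally show ?thesis using assms(2) by (simp add: ennreal_mult mult.assoc)
qed

lemma card_words_pos: "0 < card (words k :: 'n::finite list set)"
proof -
  have "replicate k undefined \<in> (words k :: 'n list set)" by (simp add: words_def)
  then show ?thesis by (auto simp: card_gt_0_iff)
qed

text \<open>In the application \<open>real (m - k) + \<theta> - \<sigma>\<close> equals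
  \<open>r - k\<close>, the decay left over after \<open>\<sigma>\<close> has been used to pass from
  \<open>A\<close> to its conjugate. The components are summed in absolute value, which dominates
  the Euclidean length of the gradient.\<close>

lemma derivative_norm_le:
  assumes km: "k \<le> m" and \<theta>: "0 < \<theta>" and \<sigma>: "0 < \<sigma>" "\<sigma> < real CARD('n::finite)" and \<kappa>: "0 < real (m - k)
      + \<theta> - \<sigma>"
  obtains c where "0 < c"
    "\<And>A (u :: real^'n \<Rightarrow> real) lam. embedding_data m \<theta> A u k lam \<Longrightarrow>
      luxemburg_norm (sobolev_conj CARD('n) \<sigma> A) (grad_length k u) \<le> ennreal (c * lam)"
proof (rule derivative_scale_bounds[OF km \<theta>, where 'n = 'n])
  fix C K :: real
  assume C: "0 < C" and K: "1 \<le> K" and main: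
    "\<And>A (u :: real^'n::finite \<Rightarrow> real) lam. embedding_data m \<theta> A u k lam \<Longrightarrow>
      \<exists>F Z. scale_controlled C K (real (m - k) + \<theta>) A u k lam F Z"
  let ?\<kappa> = "real (m - k) + \<theta> - \<sigma>"
  define C' where "C' = real (card (words k :: 'n list set)) * C"
  have C': "0 < C'" using C card_words_pos[of k, where 'n = 'n] by (simp add: C'_def)
  \<comment> \<open>The reciprocal of the factor in front of \<open>X\<close> in
    \<open>dominated_modular\<close>.\<close>
  define c where "c = K * (2 * C' * geom_bound ?\<kappa>)"
  have c: "0 < c" using K C' geom_bound_pos[OF \<kappa>] by (simp add: c_def)
  show thesis
  proof (rule that[OF c])
    fix A and u :: "real^'n \<Rightarrow> real" and lam
    assume ed: "embedding_data m \<theta> A u k lam"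
    then have A: "young_function A" and lam: "0 < lam" by (auto simp: embedding_data_def)
    let ?B = "sobolev_conj CARD('n) \<sigma> A"
    obtain F Z where FZ: "scale_controlled C K (real (m - k) + \<theta>) A u k lam F Z" using main[OF ed]
        by (elim exE)
    note F = scale_controlledD(1-3)[OF FZ] and Z = scale_controlledD(4)[OF FZ] and b
        = scale_controlledD(5)[OF FZ]
    define X where "X x = (\<Sum>w\<in>words k. \<bar>weak_deriv w u x / lam\<bar>)" for x
    have "(\<integral>\<^sup>+x. ?B (1 / K / (2 * C' * geom_bound ?\<kappa>) * X x) \<partial>lborel) \<le> 1"
    proof (rule dominated_modular[OF young_extend_star[OF A] sobolev_conj_dominated[OF A \<sigma>] F K C' \<kappa>])
      show "AE x in lborel. ennreal (X x) \<le> ennreal C' * (\<Sum>j. ennreal ((2 ^ j) powr - (\<sigma> + ?\<kappa>)) * F j x)"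
        using Z
      proof (rule eventually_mono)
        fix x assume "x \<notin> Z"
        then show "ennreal (X x) \<le> ennreal C' * (\<Sum>j. ennreal ((2 ^ j) powr - (\<sigma> + ?\<kappa>)) * F j x)"
          unfolding X_def C'_def using b C by (intro sum_words_bound) auto
      qed
    qed (simp add: X_def sum_nonneg)
    moreover have "?B (\<bar>grad_length k u x\<bar> / (c * lam)) \<le> ?B (1 / K / (2 * C' * geom_bound ?\<kappa>) * X x)" for x
    proof (rule sobolev_conj_mono[OF A])
      have "\<bar>grad_length k u x\<bar> \<le> (\<Sum>w\<in>words k. \<bar>weak_deriv w u x\<bar>)"
        unfolding grad_length_def using L2_set_le_sum_abs[of "\<lambda>w. weak_deriv w u x" "words k"]
        by (simp add: L2_set_nonneg)
      also have "\<dots> = lam * X x" using lam by (simp add: X_def abs_divide sum_divide_distrib[symmetric])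
      finally have "\<bar>grad_length k u x\<bar> / (c * lam) \<le> lam * X x / (c * lam)"
        using c lam by (intro divide_right_mono) auto
      also have "\<dots> = 1 / K / (2 * C' * geom_bound ?\<kappa>) * X x" using lam by (simp add: c_def)
      finally show "\<bar>grad_length k u x\<bar> / (c * lam) \<le> 1 / K / (2 * C' * geom_bound ?\<kappa>) * X x" .
    qed
    ultimately have "(\<integral>\<^sup>+x. ?B (\<bar>grad_length k u x\<bar> / (c * lam)) \<partial>lebesgue) \<le> 1"
      unfolding nn_integral_completion by (rule order_trans[OF nn_integral_mono, rotated])
    then show "luxemburg_norm ?B (grad_length k u) \<le> ennreal (c * lam)"
      unfolding luxemburg_norm_def using c lam by (intro INF_lower) auto
  qed
qed

text \<open>Up to the factor \<open>(2^j) powr - \<sigma>\<close> the left side is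
  \<open>min 1 \<tau> * \<tau> powr - \<rho>\<close> at \<open>\<tau> = 2^j * h\<close>, that is
  \<open>\<tau> powr (1 - \<rho>)\<close> below 1 and \<open>\<tau> powr - \<rho>\<close> above.
  Both branches decay because \<open>0 < \<rho> < 1\<close>. The exponent is written as twice a half
  to fit the weight in \<open>dominated_seminorm\<close>.\<close>

lemma scaled_min_le_decay:
  assumes h: "0 < h" and \<rho>: "0 < \<rho>" "\<rho> < 1"
  shows "min 1 (2 ^ j * h) * (2 ^ j) powr - (\<rho> + \<sigma>) / h powr \<rho>
    \<le> decay (2 * (min \<rho> (1 - \<rho>) / 2)) (2 ^ j * h) * (2 ^ j) powr - \<sigma>"
proof -
  define \<tau> where "\<tau> = 2 ^ j * h"
  have \<tau>: "0 < \<tau>" using h by (simp add: \<tau>_def)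
  let ?e = "min \<rho> (1 - \<rho>)"
  have "min 1 \<tau> * \<tau> powr - \<rho> \<le> decay ?e \<tau>"
  proof (cases "\<tau> \<le> 1")
    case True
    have "min 1 \<tau> * \<tau> powr - \<rho> = \<tau> powr (1 - \<rho>)"
      using True \<tau> by (simp add: powr_diff powr_minus_divide)
    moreover have "\<tau> powr (1 - \<rho>) \<le> \<tau> powr ?e" using True \<tau> by (intro powr_mono') auto
    moreover have "\<tau> powr (1 - \<rho>) \<le> \<tau> powr - ?e" using True \<tau> \<rho> by (intro powr_mono') (auto simp: min_def)
    ultimately show ?thesis by (simp add: decay_def)
  next
    case False
    have "min 1 \<tau> = 1" using False by simp
    then have "min 1 \<tau> * \<tau> powr - \<rho> = \<tau> powr - \<rho>" by simp
    moreover have "\<tau> powr - \<rho> \<le> \<tau> powr ?e" using False \<rho> by (intro powr_mono) auto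
    moreover have "\<tau> powr - \<rho> \<le> \<tau> powr - ?e" using False by (intro powr_mono) auto
    ultimately show ?thesis unfolding decay_def by linarith
  qed
  then have "min 1 \<tau> * \<tau> powr - \<rho> * (2 ^ j) powr - \<sigma> \<le> decay ?e \<tau> * (2 ^ j) powr - \<sigma>"
    by (rule mult_right_mono) simp
  moreover have "min 1 (2 ^ j * h) * (2 ^ j) powr - (\<rho> + \<sigma>) / h powr \<rho> = min 1 \<tau> * \<tau> powr - \<rho>
      * (2 ^ j) powr - \<sigma>"
  proof -
    have "\<tau> powr - \<rho> = (2 ^ j) powr - \<rho> / h powr \<rho>"
      using h unfolding \<tau>_def by (subst powr_mult) (auto simp: powr_minus_divide)
    moreover have "(2 ^ j :: real) powr - (\<rho> + \<sigma>) = (2 ^ j) powr - \<rho> * (2 ^ j) powr - \<sigma>"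
      by (simp add: powr_add[symmetric])
    ultimately show ?thesis by (simp add: \<tau>_def)
  qed
  ultimately show ?thesis by (simp add: \<tau>_def)
qed

text \<open>In the application \<open>k\<close> is the integer part of \<open>r\<close> and
  \<open>\<rho>\<close> its fractional part, so beyond \<open>\<sigma>\<close> exactly the decay
  \<open>\<rho>\<close> is left, and division by |x - y|^\<rho> consumes it. The Lipschitz weight of
  each scale then becomes a weight decaying in both directions, which makes the scales
  summable.\<close>

lemma derivative_seminorm_le:
  assumes km: "k \<le> m" and \<theta>: "0 < \<theta>" and \<sigma>: "0 < \<sigma>" "\<sigma> < real CARD('n::finite)"
    and \<rho>: "0 < \<rho>" "\<rho> < 1" "real (m - k) + \<theta> = \<rho> + \<sigma>"
  obtains c where "0 < c"
    "\<And>A (u :: real^'n \<Rightarrow> real) lam. embedding_data m \<theta> A u k lam \<Longrightarrow>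
      frac_seminorm \<rho> (sobolev_conj CARD('n) \<sigma> A) (words k) (\<lambda>w. weak_deriv w u) \<le> ennreal (c * lam)"
proof (rule derivative_scale_bounds[OF km \<theta>, where 'n = 'n])
  fix C K :: real
  assume C: "0 < C" and K: "1 \<le> K" and main:
    "\<And>A (u :: real^'n::finite \<Rightarrow> real) lam. embedding_data m \<theta> A u k lam \<Longrightarrow>
      \<exists>F Z. scale_controlled C K (real (m - k) + \<theta>) A u k lam F Z"
  define \<epsilon> where "\<epsilon> = min \<rho> (1 - \<rho>) / 2"
  have \<epsilon>: "0 < \<epsilon>" using \<rho> by (simp add: \<epsilon>_def)
  define C' where "C' = real (card (words k :: 'n list set)) * C"
  have C': "0 < C'" using C card_words_pos[of k, where 'n = 'n] by (simp add: C'_def)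
  define Q where "Q = max 1 (2 * (ball_vol TYPE('n) * 2 ^ CARD('n)) * geom_bound \<epsilon>)"
  have Q: "1 \<le> Q" "2 * (ball_vol TYPE('n) * 2 ^ CARD('n)) * geom_bound \<epsilon> \<le> Q" by (auto simp: Q_def)
  define c where "c = (2 * Q * K) * (2 * (2 * C') * (2 * geom_bound \<epsilon>))"
  have c: "0 < c" using K C' Q geom_bound_pos[OF \<epsilon>] by (simp add: c_def)
  show thesis
  proof (rule that[OF c])
    fix A and u :: "real^'n \<Rightarrow> real" and lam
    assume ed: "embedding_data m \<theta> A u k lam"
    then have A: "young_function A" and lam: "0 < lam" by (auto simp: embedding_data_def)
    let ?B = "sobolev_conj CARD('n) \<sigma> A"
    obtain F Z where FZ: "scale_controlled C K (real (m - k) + \<theta>) A u k lam F Z" using main[OF ed]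
        by (elim exE)
    note F = scale_controlledD(1-3)[OF FZ] and Z = scale_controlledD(4)[OF FZ] and b
        = scale_controlledD(6)[OF FZ]
    define X where "X x y = (\<Sum>w\<in>words k. \<bar>weak_deriv w u x / lam - weak_deriv w u y / lam\<bar>) / norm (x - y)
        powr \<rho>" for x y
    have X0: "0 \<le> X x y" for x y by (simp add: X_def sum_nonneg)
    have pt: "ennreal (X x y) \<le> ennreal C' * (\<Sum>j. ennreal (decay (2 * \<epsilon>) (2 ^ j * norm (x - y)))
        * (ennreal ((2 ^ j) powr - \<sigma>) * (F j x + F j y)))"
      if x: "x \<notin> Z" and y: "y \<notin> Z" for x y
    proof (cases "x = y")
      case False
      let ?h = "norm (x - y)"
      have h: "0 < ?h" using False by simp
      let ?S = "\<Sum>w\<in>words k. \<bar>weak_deriv w u x / lam - weak_deriv w u y / lam\<bar>"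
      have "ennreal ?S \<le> ennreal C' * (\<Sum>j. ennreal (min 1 (2 ^ j * ?h)) * (ennreal ((2 ^ j) powr - (\<rho>
          + \<sigma>)) * (F j x + F j y)))"
        unfolding C'_def using b[OF _ x y] C unfolding \<rho>(3) by (intro sum_words_bound) auto
      then have "ennreal (1 / ?h powr \<rho>) * ennreal ?S \<le> ennreal (1 / ?h powr \<rho>) * (ennreal C'
          * (\<Sum>j. ennreal (min 1 (2 ^ j * ?h)) * (ennreal ((2 ^ j) powr - (\<rho> + \<sigma>)) * (F j x + F j y))))"
        by (intro mult_left_mono) auto
      moreover have "ennreal (1 / ?h powr \<rho>) * ennreal ?S = ennreal (X x y)"
        by (subst ennreal_mult[symmetric]) (auto simp: X_def sum_nonneg)
      moreover have "ennreal (1 / ?h powr \<rho>) * (ennreal C' * (\<Sum>j. ennreal (min 1 (2 ^ j * ?h))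
          * (ennreal ((2 ^ j) powr - (\<rho> + \<sigma>)) * (F j x + F j y))))
        = ennreal C' * (\<Sum>j. ennreal (1 / ?h powr \<rho>) * (ennreal (min 1 (2 ^ j * ?h))
            * (ennreal ((2 ^ j) powr - (\<rho> + \<sigma>)) * (F j x + F j y))))"
        by (simp only: ennreal_suminf_cmult mult.left_commute)
      moreover have "\<dots> \<le> ennreal C' * (\<Sum>j. ennreal (decay (2 * \<epsilon>) (2 ^ j * ?h))
          * (ennreal ((2 ^ j) powr - \<sigma>) * (F j x + F j y)))"
      proof (intro mult_left_mono suminf_le)
        fix j
        have "ennreal (1 / ?h powr \<rho>) * (ennreal (min 1 (2 ^ j * ?h)) * (ennreal ((2 ^ j) powr - (\<rho> + \<sigma>))
            * (F j x + F j y)))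
          = ennreal (min 1 (2 ^ j * ?h) * (2 ^ j) powr - (\<rho> + \<sigma>) / ?h powr \<rho>) * (F j x + F j y)"
        proof -
          have "min 1 (2 ^ j * ?h) * (2 ^ j) powr - (\<rho> + \<sigma>) / ?h powr \<rho> = 1 / ?h powr \<rho> * (min 1 (2 ^ j
              * ?h) * (2 ^ j) powr - (\<rho> + \<sigma>))"
            by simp
          also have "ennreal \<dots> = ennreal (1 / ?h powr \<rho>) * (ennreal (min 1 (2 ^ j * ?h))
              * ennreal ((2 ^ j) powr - (\<rho> + \<sigma>)))"
            by (subst ennreal_mult, simp, simp, subst ennreal_mult) auto
          finally show ?thesis by (simp only: mult.assoc)
        qed
        also have "\<dots> \<le> ennreal (decay (2 * \<epsilon>) (2 ^ j * ?h) * (2 ^ j) powr - \<sigma>) * (F j x + F j y)"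
          unfolding \<epsilon>_def by (intro mult_right_mono ennreal_leI scaled_min_le_decay h \<rho>) auto
        also have "\<dots> = ennreal (decay (2 * \<epsilon>) (2 ^ j * ?h)) * (ennreal ((2 ^ j) powr - \<sigma>) * (F j x + F j y))"
          by (subst ennreal_mult) (auto simp: mult.assoc)
        finally show "ennreal (1 / ?h powr \<rho>) * (ennreal (min 1 (2 ^ j * ?h))
            * (ennreal ((2 ^ j) powr - (\<rho> + \<sigma>)) * (F j x + F j y)))
          \<le> ennreal (decay (2 * \<epsilon>) (2 ^ j * ?h)) * (ennreal ((2 ^ j) powr - \<sigma>) * (F j x + F j y))" .
      qed auto
      ultimately show ?thesis by simp
    qed (simp add: X_def)
    have I1: "(\<integral>\<^sup>+y. \<integral>\<^sup>+x. ?B (1 / (2 * Q * K) / (2 * (2 * C') * (2 * geom_bound \<epsilon>)) * X x y)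
      / ennreal (norm (x - y) ^ CARD('n)) \<partial>lborel \<partial>lborel) \<le> 1"
    proof (rule dominated_seminorm[OF young_extend_star[OF A] sobolev_conj_dominated[OF A \<sigma>] F K C' \<epsilon> Q X0])
      show "AE y in lborel. AE x in lborel. ennreal (X x y) \<le> ennreal C' *
         (\<Sum>j. ennreal (decay (2 * \<epsilon>) (2 ^ j * norm (x - y))) * (ennreal ((2 ^ j) powr - \<sigma>) * (F j x
             + F j y)))"
        by (rule eventually_mono[OF Z], rule eventually_mono[OF Z]) (rule pt)
    qed
    have B: "?B (L2_set (\<lambda>w. weak_deriv w u x - weak_deriv w u y) (words k) / (c * lam * norm (x - y) powr \<rho>))
      \<le> ?B (1 / (2 * Q * K) / (2 * (2 * C') * (2 * geom_bound \<epsilon>)) * X x y)" for x y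
    proof (rule sobolev_conj_mono[OF A])
      let ?S = "\<Sum>w\<in>words k. \<bar>weak_deriv w u x / lam - weak_deriv w u y / lam\<bar>"
      have "L2_set (\<lambda>w. weak_deriv w u x - weak_deriv w u y) (words k)
          \<le> (\<Sum>w\<in>words k. \<bar>weak_deriv w u x - weak_deriv w u y\<bar>)"
        by (rule L2_set_le_sum_abs)
      also have "\<dots> = lam * ?S"
        using lam by (simp add: diff_divide_distrib[symmetric] abs_divide sum_divide_distrib[symmetric])
      finally have "L2_set (\<lambda>w. weak_deriv w u x - weak_deriv w u y) (words k) / (c * lam
          * norm (x - y) powr \<rho>)
         \<le> lam * ?S / (c * lam * norm (x - y) powr \<rho>)"
        using c lam by (intro divide_right_mono) auto
      also have "\<dots> = 1 / c * X x y" using lam by (simp add: X_def)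
      also have "1 / c = 1 / (2 * Q * K) / (2 * (2 * C') * (2 * geom_bound \<epsilon>))" by (simp add: c_def)
      finally show "L2_set (\<lambda>w. weak_deriv w u x - weak_deriv w u y) (words k) / (c * lam
          * norm (x - y) powr \<rho>)
        \<le> 1 / (2 * Q * K) / (2 * (2 * C') * (2 * geom_bound \<epsilon>)) * X x y" .
    qed
    have "(\<integral>\<^sup>+y. (\<integral>\<^sup>+x. ?B (L2_set (\<lambda>w. weak_deriv w u x - weak_deriv w u y) (words k) / (c * lam
        * norm (x - y) powr \<rho>))
                   / ennreal (norm (x - y) ^ CARD('n)) \<partial>lebesgue) \<partial>lebesgue) \<le> 1"
      unfolding nn_integral_completion
      by (rule order_trans[OF _ I1]) (intro nn_integral_mono divide_right_mono_ennreal B)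
    then show "frac_seminorm \<rho> ?B (words k) (\<lambda>w. weak_deriv w u) \<le> ennreal (c * lam)"
      unfolding frac_seminorm_def using c lam by (intro INF_lower) auto
  qed
qed

section \<open>Assembling norms and constants\<close>

lemma luxemburg_grad_length_0: "luxemburg_norm A (grad_length 0 u) = luxemburg_norm A u"
proof -
  have "grad_length 0 u = (\<lambda>x. \<bar>u x\<bar>)"
    by (simp add: fun_eq_iff grad_length_def words_0 weak_deriv_def)
  then show ?thesis by (simp add: luxemburg_norm_abs)
qed

text \<open>The estimates hold for every \<open>lam\<close> above the norm of \<open>u\<close>, and
  letting \<open>lam\<close> decrease to it gives the inequality. With
  \<open>s = m + \<theta>\<close> and \<open>r = l + \<rho>\<close>, the norms require
  \<open>r - k > 0\<close> for all \<open>k \<le> l\<close>, and the seminorm, taken at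
  \<open>k = l\<close>, requires \<open>0 < \<rho> < 1\<close>.\<close>

lemma embedding_constant:
  fixes r s :: real
  assumes r: "0 < r" "r \<notin> \<nat>" and s: "0 < s" "s \<notin> \<nat>" and \<sigma>: "0 < s - r" "s - r < real CARD('n::finite)"
  shows "\<exists>c>0. \<forall>A. young_function A \<longrightarrow> (\<forall>u :: real^'n \<Rightarrow> real. u \<in> frac_sobolev_space s A \<longrightarrow>
      u \<in> frac_sobolev_space r (sobolev_conj CARD('n) (s - r) A) \<and>
      frac_sobolev_norm r (sobolev_conj CARD('n) (s - r) A) u \<le> ennreal c * frac_sobolev_norm s A u)"
proof -
  define m where "m = nat \<lfloor>s\<rfloor>"
  define l where "l = nat \<lfloor>r\<rfloor>"
  define \<theta> where "\<theta> = frac s"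
  define \<rho> where "\<rho> = frac r"
  have nonint: "x \<notin> \<int>" if "0 < x" "x \<notin> \<nat>" for x :: real
    using that by (auto simp: Nats_altdef2)
  have sm: "s = real m + \<theta>" and rl: "r = real l + \<rho>" using s r
      by (auto simp: m_def l_def \<theta>_def \<rho>_def frac_def)
  have \<theta>: "0 < \<theta>" "\<theta> < 1" and \<rho>: "0 < \<rho>" "\<rho> < 1"
    using nonint[OF s] nonint[OF r] by (auto simp: \<theta>_def \<rho>_def frac_gt_0_iff frac_lt_1)
  have lm: "l \<le> m" using \<sigma>(1) unfolding l_def m_def by (intro nat_mono floor_mono) simp
  \<comment> \<open>The quantity equals \<open>r - k\<close>, hence is at least
    \<open>\<rho>\<close>.\<close>
  have \<kappa>: "0 < real (m - k) + \<theta> - (s - r)" if "k \<le> l" for k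
    using that lm \<rho>(1) sm rl by (simp add: of_nat_diff)
  have \<rho>\<sigma>: "real (m - l) + \<theta> = \<rho> + (s - r)" using lm sm rl by (simp add: of_nat_diff)
  \<comment> \<open>The condition \<open>k \<le> l\<close> stands inside the existential, so that
    one function \<open>c\<close> of \<open>k\<close> can be chosen.\<close>
  have "\<exists>c. k \<le> l \<longrightarrow> 0 < c \<and> (\<forall>A (u :: real^'n \<Rightarrow> real) lam. embedding_data m \<theta> A u k lam \<longrightarrow>
      luxemburg_norm (sobolev_conj CARD('n) (s - r) A) (grad_length k u) \<le> ennreal (c * lam))" for k
  proof (cases "k \<le> l")
    case True
    then have km: "k \<le> m" using lm by simp
    show ?thesis
    proof (rule derivative_norm_le[OF km \<theta>(1) \<sigma> \<kappa>[OF True]])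
      fix c :: real
      assume "0 < c" and "\<And>A (u :: real^'n \<Rightarrow> real) lam. embedding_data m \<theta> A u k lam \<Longrightarrow>
        luxemburg_norm (sobolev_conj CARD('n) (s - r) A) (grad_length k u) \<le> ennreal (c * lam)"
      then show ?thesis by (intro exI[of _ c] impI conjI allI)
    qed
  qed auto
  then obtain c where c: "\<And>k. k \<le> l \<Longrightarrow> 0 < c k"
    "\<And>k A (u :: real^'n \<Rightarrow> real) lam. k \<le> l \<Longrightarrow> embedding_data m \<theta> A u k lam \<Longrightarrow>
      luxemburg_norm (sobolev_conj CARD('n) (s - r) A) (grad_length k u) \<le> ennreal (c k * lam)"
    by metis
  obtain c' where c': "0 < c'"
    "\<And>A (u :: real^'n \<Rightarrow> real) lam. embedding_data m \<theta> A u l lam \<Longrightarrow>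
      frac_seminorm \<rho> (sobolev_conj CARD('n) (s - r) A) (words l) (\<lambda>w. weak_deriv w u) \<le> ennreal (c' * lam)"
    by (rule derivative_seminorm_le[OF lm \<theta>(1) \<sigma> \<rho> \<rho>\<sigma>], rule that) assumption+
  define C where "C = (\<Sum>k=0..l. c k) + c'"
  have Cs: "0 \<le> (\<Sum>k=0..l. c k)" using c(1) by (intro sum_nonneg) (auto intro: less_imp_le)
  have C: "0 < C" using Cs c'(1) by (simp add: C_def)
  have main: "u \<in> frac_sobolev_space r (sobolev_conj CARD('n) (s - r) A) \<and>
      frac_sobolev_norm r (sobolev_conj CARD('n) (s - r) A) u \<le> ennreal C * frac_sobolev_norm s A u"
    if A: "young_function A" and u: "u \<in> frac_sobolev_space s A" for A and u :: "real^'n \<Rightarrow> real"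
  proof -
    let ?B = "sobolev_conj CARD('n) (s - r) A"
    have um: "u \<in> sobolev_space m A" and us: "grad_seminorm s A u < \<infinity>"
      using u by (auto simp: frac_sobolev_space_def m_def)
    have lux: "luxemburg_norm A (grad_length k u) < \<infinity>" if "k \<le> m" for k
    proof (cases "k = 0")
      case True
      then show ?thesis using um by (simp add: luxemburg_grad_length_0 sobolev_space_def orlicz_space_def)
    next
      case False
      then show ?thesis using um that by (auto simp: sobolev_space_def orlicz_space_def)
    qed
    have Ns: "sobolev_norm m A u = (\<Sum>k=0..m. luxemburg_norm A (grad_length k u))"
        by (simp add: sobolev_norm_def)
    have nfin: "frac_sobolev_norm s A u < \<infinity>"
    proof -
      have "(\<Sum>k=0..m. luxemburg_norm A (grad_length k u)) < top"
        using lux by (subst ennreal_sum_less_top) auto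
      then show ?thesis using us by (simp add: frac_sobolev_norm_def m_def[symmetric] Ns)
    qed
    then obtain N where N: "frac_sobolev_norm s A u = ennreal N" "0 \<le> N"
        by (cases "frac_sobolev_norm s A u") auto
    have ed: "embedding_data m \<theta> A u k lam" if k: "k \<le> m" and lam: "N < lam" for k lam
    proof -
      have lt: "x < ennreal lam" if "x \<le> frac_sobolev_norm s A u" for x
        using that N lam by (auto simp: ennreal_less_iff intro: le_less_trans)
      have le: "luxemburg_norm A (grad_length j u) \<le> frac_sobolev_norm s A u" if "j \<le> m" for j
      proof -
        have "luxemburg_norm A (grad_length j u) \<le> sobolev_norm m A u"
          unfolding Ns using that by (intro member_le_sum) auto
        also have "\<dots> \<le> frac_sobolev_norm s A u" by (simp add: frac_sobolev_norm_def m_def)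
        finally show ?thesis .
      qed
      have "frac_seminorm \<theta> A (words m) (\<lambda>w. weak_deriv w u) \<le> frac_sobolev_norm s A u"
        by (simp add: frac_sobolev_norm_def grad_seminorm_def m_def \<theta>_def)
      then show ?thesis
        using A um N(2) lam lt le[OF k] le[of 0] by (auto simp: embedding_data_def luxemburg_grad_length_0)
    qed
    have bound: "frac_sobolev_norm r ?B u \<le> ennreal (C * lam)" if lam: "N < lam" for lam
    proof -
      have l0: "0 < lam" using lam N(2) by simp
      have "frac_sobolev_norm r ?B u = (\<Sum>k=0..l. luxemburg_norm ?B (grad_length k u))
          + frac_seminorm \<rho> ?B (words l) (\<lambda>w. weak_deriv w u)"
        by (simp add: frac_sobolev_norm_def sobolev_norm_def grad_seminorm_def l_def \<rho>_def)
      also have "\<dots> \<le> (\<Sum>k=0..l. ennreal (c k * lam)) + ennreal (c' * lam)"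
        using lm by (intro add_mono sum_mono c c' ed lam) auto
      also have "(\<Sum>k=0..l. ennreal (c k * lam)) = ennreal (\<Sum>k=0..l. c k * lam)"
        using c(1) l0 by (intro sum_ennreal) (auto intro: less_imp_le)
      also have "\<dots> + ennreal (c' * lam) = ennreal (C * lam)"
        using Cs c'(1) l0 by (simp add: C_def distrib_right sum_distrib_right[symmetric]
            ennreal_plus[symmetric] del: ennreal_plus)
      finally show ?thesis .
    qed
    \<comment> \<open>\<open>embedding_data\<close> asks for strict bounds, so \<open>N\<close>
      itself is reached through \<open>lam = N + e / C\<close>; this also covers
      \<open>N = 0\<close>.\<close>
    have "frac_sobolev_norm r ?B u \<le> ennreal (C * N)"
    proof (rule ennreal_le_epsilon)
      fix e :: real assume e: "0 < e"
      have "frac_sobolev_norm r ?B u \<le> ennreal (C * (N + e / C))" by (rule bound) (use e C in simp)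
      also have "C * (N + e / C) = C * N + e" using C by (simp add: distrib_left)
      finally show "frac_sobolev_norm r ?B u \<le> ennreal (C * N) + ennreal e" using C N(2) e by simp
    qed
    then have le: "frac_sobolev_norm r ?B u \<le> ennreal C * frac_sobolev_norm s A u"
      using C N by (simp add: ennreal_mult)
    have fin: "frac_sobolev_norm r ?B u < \<infinity>"
      using bound[of "N + 1"] by (simp add: le_less_trans)
    have luxB: "luxemburg_norm ?B (grad_length k u) < \<infinity>" if "k \<le> l" for k
    proof -
      have "luxemburg_norm ?B (grad_length k u) \<le> sobolev_norm l ?B u"
        unfolding sobolev_norm_def using that by (intro member_le_sum) auto
      also have "\<dots> \<le> frac_sobolev_norm r ?B u" by (simp add: frac_sobolev_norm_def l_def)
      finally show ?thesis using fin by (rule le_less_trans)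
    qed
    have "u \<in> sobolev_space l ?B"
    proof -
      have "u \<in> borel_measurable lebesgue" using um by (simp add: sobolev_space_def orlicz_space_def)
      then have "u \<in> orlicz_space ?B" using luxB[of 0] by (simp add: orlicz_space_def luxemburg_grad_length_0)
      \<comment> \<open>Existence of the weak derivatives is inherited from the domain space because
        \<open>l \<le> m\<close>; their membership in the target space comes from the norm
        estimate.\<close>
      moreover have "(\<forall>w\<in>words k. \<exists>v. is_weak_deriv w u v)
          \<and> grad_length k u \<in> orlicz_space ?B" if k: "k \<in> {1..l}" for k
      proof -
        have "k \<in> {1..m}" using k lm by auto
        then have "(\<forall>w\<in>words k. \<exists>v. is_weak_deriv w u v) \<and> grad_length k u \<in> orlicz_space A"
          using um unfolding sobolev_space_def by blast
        then show ?thesis using luxB[of k] k by (auto simp: orlicz_space_def)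
      qed
      ultimately show ?thesis by (simp add: sobolev_space_def)
    qed
    moreover have "grad_seminorm r ?B u < \<infinity>"
      using fin by (simp add: frac_sobolev_norm_def)
    ultimately show ?thesis using le by (simp add: frac_sobolev_space_def l_def)
  qed
  show ?thesis using C main by blast
qed

theorem theorem2p1:
  fixes r s :: real
  assumes "0 < r" "r \<notin> \<nat>" "0 < s" "s \<notin> \<nat>"
    and "0 < s - r" "s - r < real CARD('n::finite)"
  shows
    "(\<forall>A. young_function A \<and> converges_near_zero CARD('n) (s - r) A \<longrightarrow>
        continuously_embedded
          (frac_sobolev_space s A :: (real^'n \<Rightarrow> real) set)
          (frac_sobolev_norm s A)
          (frac_sobolev_space r (sobolev_conj CARD('n) (s - r) A))
          (frac_sobolev_norm r (sobolev_conj CARD('n) (s - r) A))) \<and>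
     (\<exists>c>0. \<forall>A. young_function A \<and> converges_near_zero CARD('n) (s - r) A \<longrightarrow>
        (\<forall>u :: real^'n \<Rightarrow> real. u \<in> frac_sobolev_space s A \<longrightarrow>
           frac_sobolev_norm r (sobolev_conj CARD('n) (s - r) A) u
             \<le> ennreal c * frac_sobolev_norm s A u))"
proof -
  obtain c where "0 < c" and "\<And>A (u :: real^'n \<Rightarrow> real). young_function A \<Longrightarrow> u \<in> frac_sobolev_space s A \<Longrightarrow>
      u \<in> frac_sobolev_space r (sobolev_conj CARD('n) (s - r) A) \<and>
      frac_sobolev_norm r (sobolev_conj CARD('n) (s - r) A) u \<le> ennreal c * frac_sobolev_norm s A u"
    using embedding_constant[OF assms] by blast
  then show ?thesis unfolding continuously_embedded_def by blast
qed

end
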